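(* Let $\mathcal{X}$ be a finite or countable state space and $(X_n)_{n\ge 1}$ a Markov chain on $\mathcal{X}$ with transition kernel $P$, assumed ergodic with (unique) stationary distribution $\mu$, and with $X_1\sim\mu$. Let $r:\mathcal{X}\to\mathbb{R}$ with $|r|\le R_{\max}$, let $\gamma\in(0,1)$, $V_{\max}=R_{\max}/(1-\gamma)$, and let $v(i)=\mathbb{E}[\sum_{j\ge0}\gamma^j r(X_j)\mid X_0=i]$ be the value function. Let $\phi=(\phi_1,\dots,\phi_d)^T$ be feature functions $\phi_j:\mathcal{X}\to\mathbb{R}$ with $|\phi_j|\le L$, assumed linearly independent, and let $\Phi$ be the $|\mathcal{X}|\times d$ matrix with rows $\phi(x)^T$. Let $\lambda\in(0,1)$. Assume $(X_n)$ is $\beta$-mixing with $\beta_i\le\overline\beta e^{-b i^{\kappa}}$ for constants $\overline\beta>0,b>0,\kappa>0$. For $n\ge1$, $\delta\in(0,1)$ define $$\Lambda(n,\delta)=\log\Big(\frac{8n^2}{\delta}\Big)+\log(\max\{4e^2,n\overline\beta\}),\qquad I(n,\delta)=32\Lambda(n,\delta)\max\Big\{\frac{\Lambda(n,\delta)}{b},1\Big\}^{1/\kappa}.$$ Let $\nu$ be the smallest eigenvalue of $\Phi^TD_\mu\Phi$ and let $n_0(\delta)$ be the smallest integer such that for all $n\ge n_0(\delta)$, $$\frac{2dL^2}{(1-\gamma)\nu}\left[\frac{2}{\sqrt{n-1}}\sqrt{\Big(\Big\lceil\tfrac{\log(n-1)}{\log(1/(\lambda\gamma))}\Big\rceil+1\Big)I(n-1,\delta)}+\frac{1}{(n-1)(1-\lambda\gamma)}+\frac{2}{n-1}\Big\lceil\tfrac{\log(n-1)}{\log(1/(\lambda\gamma))}\Big\rceil\right]<1.$$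 Then there is a function $h(n,\delta)=\tilde O(1/n)$ such that for every $\delta\in(0,1)$, with probability at least $1-\delta$, for all $n\ge n_0(\delta)$ the matrix $\hat A$ (computed from $X_1,\dots,X_n$) is invertible and $$\|v_{LSTD(\lambda)}-\hat v_{LSTD(\lambda)}\|_\mu\le\frac{4V_{\max}dL^2}{\sqrt{n-1}(1-\gamma)\nu}\sqrt{\Big(1+\Big\lceil\tfrac{\log(n-1)}{\log(1/(\lambda\gamma))}\Big\rceil\Big)I(n-1,\delta)}+h(n,\delta).$$
   Context: $D_\mu$ is the diagonal matrix with entries $\mu(x)$; $\|f\|_\mu=\sqrt{\sum_x|f(x)|^2\mu(x)}$. $\Pi=\Phi(\Phi^TD_\mu\Phi)^{-1}\Phi^TD_\mu$ is the $\mu$-orthogonal projection onto the span of the features. The Bellman operator is $Tv(i)=r(i)+\gamma\mathbb{E}[v(X_1)\mid X_0=i]$, and $T^\lambda v=(1-\lambda)\sum_{i\ge0}\lambda^iT^{i+1}v$. $v_{LSTD(\lambda)}$ is the unique solution of $v=\Pi T^\lambda v$; equivalently $v_{LSTD(\lambda)}=\Phi A^{-1}b$ with $A=\Phi^TD_\mu(I-\gamma P)(I-\lambda\gamma P)^{-1}\Phi$ and $b=\Phi^TD_\mu(I-\gamma\lambda P)^{-1}r$. Given a trajectory $X_1,\dots,X_n$, the LSTD($\lambda$) estimates are $z_i=\sum_{k=1}^i(\lambda\gamma)^{i-k}\phi(X_k)$, $\hat A=\frac{1}{n-1}\sum_{i=1}^{n-1}z_i(\phi(X_i)-\gamma\phi(X_{i+1}))^T$,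 $\hat b=\frac1{n-1}\sum_{i=1}^{n-1}z_ir(X_i)$, and $\hat v_{LSTD(\lambda)}=\Phi\hat A^{-1}\hat b$. The $\beta$-mixing coefficients are $\beta_i=\sup_{t\ge1}\mathbb{E}[\sup_{B\in\sigma(X_{t+i}^\infty)}|P(B\mid\sigma(X_1^t))-P(B)|]$, where $X_l^j=\{X_l,\dots,X_j\}$. The notation $f(n)=\tilde O(g(n))$ means $f(n)=O(g(n)\log^k g(n))$ for some $k\ge0$. *)

theory Defs
  imports "HOL-Probability.Probability" "HOL-Library.Landau_Symbols"
begin

definition stochastic :: "('s \<Rightarrow> 's \<Rightarrow> real) \<Rightarrow> bool" where
  "stochastic P \<longleftrightarrow> (\<forall>x y. 0 \<le> P x y) \<and> (\<forall>x. ((\<lambda>y. P x y) has_sum 1) UNIV)"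

fun kpow :: "('s \<Rightarrow> 's \<Rightarrow> real) \<Rightarrow> nat \<Rightarrow> 's \<Rightarrow> 's \<Rightarrow> real" where
  "kpow P 0 x y = (if x = y then 1 else 0)"
| "kpow P (Suc n) x y = (\<Sum>\<^sub>\<infinity>z. P x z * kpow P n z y)"

definition irreducible_kernel :: "('s \<Rightarrow> 's \<Rightarrow> real) \<Rightarrow> bool" where
  "irreducible_kernel P \<longleftrightarrow> (\<forall>x y. \<exists>n>0. kpow P n x y > 0)"

definition aperiodic_kernel :: "('s \<Rightarrow> 's \<Rightarrow> real) \<Rightarrow> bool" where
  "aperiodic_kernel P \<longleftrightarrow> (\<forall>x. Gcd {n. n > 0 \<and> kpow P n x x > 0} = 1)"

text \<open>Ergodic (countable state space): irreducible and aperiodic; positive recurrence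
  is guaranteed by the existence of a stationary distribution (assumed separately).\<close>
definition ergodic_kernel :: "('s \<Rightarrow> 's \<Rightarrow> real) \<Rightarrow> bool" where
  "ergodic_kernel P \<longleftrightarrow> irreducible_kernel P \<and> aperiodic_kernel P"

definition stationary_dist :: "('s \<Rightarrow> 's \<Rightarrow> real) \<Rightarrow> ('s \<Rightarrow> real) \<Rightarrow> bool" where
  "stationary_dist P \<mu> \<longleftrightarrow> (\<forall>x. 0 \<le> \<mu> x) \<and> (\<mu> has_sum 1) UNIV \<and>
     (\<forall>y. (\<Sum>\<^sub>\<infinity>x. \<mu> x * P x y) = \<mu> y)"

definition Pop :: "('s \<Rightarrow> 's \<Rightarrow> real) \<Rightarrow> ('s \<Rightarrow> real) \<Rightarrow> 's \<Rightarrow> real" where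
  "Pop P f x = (\<Sum>\<^sub>\<infinity>y. P x y * f y)"

text \<open>((I - c P)^{-1} f)(x) = sum_k c^k (P^k f)(x).\<close>
definition resolvent :: "('s \<Rightarrow> 's \<Rightarrow> real) \<Rightarrow> real \<Rightarrow> ('s \<Rightarrow> real) \<Rightarrow> 's \<Rightarrow> real" where
  "resolvent P c f x = (\<Sum>k. c ^ k * ((Pop P ^^ k) f) x)"

definition markov_chain_from ::
  "'a measure \<Rightarrow> (nat \<Rightarrow> 'a \<Rightarrow> 's) \<Rightarrow> ('s \<Rightarrow> 's \<Rightarrow> real) \<Rightarrow> ('s \<Rightarrow> real) \<Rightarrow> bool" where
  "markov_chain_from M X P \<mu> \<longleftrightarrow>
     (\<forall>k. X k \<in> measurable M (count_space UNIV)) \<and>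
     (\<forall>n\<ge>1. \<forall>xs :: nat \<Rightarrow> 's.
        measure M {\<omega> \<in> space M. \<forall>k\<in>{1..n}. X k \<omega> = xs k}
        = \<mu> (xs 1) * (\<Prod>k\<in>{1..<n}. P (xs k) (xs (Suc k))))"

definition future_sigma :: "'a measure \<Rightarrow> (nat \<Rightarrow> 'a \<Rightarrow> 's) \<Rightarrow> nat \<Rightarrow> 'a set set" where
  "future_sigma M X m =
     sigma_sets (space M) (\<Union>j\<in>{m..}. range (\<lambda>A. X j -` A \<inter> space M))"

definition past_atom :: "'a measure \<Rightarrow> (nat \<Rightarrow> 'a \<Rightarrow> 's) \<Rightarrow> 's list \<Rightarrow> 'a set" where
  "past_atom M X xs = {\<omega> \<in> space M. \<forall>k<length xs. X (Suc k) \<omega> = xs ! k}"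

text \<open>beta_i = sup_{t>=1} E[ sup_{B in sigma(X_{t+i}^oo)} |P(B | sigma(X_1^t)) - P(B)| ].
  Since the state space is countable, sigma(X_1^t) is generated by the countable partition
  into the atoms past_atom, on which P(B | sigma(X_1^t)) = P(B \<inter> atom)/P(atom) (a.s.), so
  the expectation is the (countable) sum over atoms weighted by their probabilities.\<close>
definition beta_coef :: "'a measure \<Rightarrow> (nat \<Rightarrow> 'a \<Rightarrow> 's) \<Rightarrow> nat \<Rightarrow> real" where
  "beta_coef M X i =
     (SUP t\<in>{1..}. \<Sum>\<^sub>\<infinity>xs\<in>{xs :: 's list. length xs = t}.
        measure M (past_atom M X xs) *
        (SUP B\<in>future_sigma M X (t + i).
           \<bar>measure M (B \<inter> past_atom M X xs) / measure M (past_atom M X xs) - measure M B\<bar>))"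

definition outer :: "real ^ 'd \<Rightarrow> real ^ 'd \<Rightarrow> real ^ 'd ^ 'd" where
  "outer u w = (\<chi> j l. u $ j * w $ l)"

definition gram :: "('s \<Rightarrow> real) \<Rightarrow> ('s \<Rightarrow> real ^ 'd) \<Rightarrow> real ^ 'd ^ 'd" where
  "gram \<mu> \<phi> = (\<chi> j l. \<Sum>\<^sub>\<infinity>x. \<mu> x * \<phi> x $ j * \<phi> x $ l)"

definition is_eigenvalue :: "real ^ 'd ^ 'd \<Rightarrow> real \<Rightarrow> bool" where
  "is_eigenvalue G e \<longleftrightarrow> (\<exists>v. v \<noteq> 0 \<and> G *v v = e *s v)"

definition min_eigenvalue :: "real ^ 'd ^ 'd \<Rightarrow> real" where
  "min_eigenvalue G = Min {e. is_eigenvalue G e}"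

definition A_lstd :: "('s \<Rightarrow> 's \<Rightarrow> real) \<Rightarrow> ('s \<Rightarrow> real) \<Rightarrow> ('s \<Rightarrow> real ^ 'd)
    \<Rightarrow> real \<Rightarrow> real \<Rightarrow> real ^ 'd ^ 'd" where
  "A_lstd P \<mu> \<phi> \<gamma> lam = (\<chi> j l.
     \<Sum>\<^sub>\<infinity>x. \<mu> x * \<phi> x $ j *
       (resolvent P (lam * \<gamma>) (\<lambda>y. \<phi> y $ l) x
        - \<gamma> * Pop P (resolvent P (lam * \<gamma>) (\<lambda>y. \<phi> y $ l)) x))"

definition b_lstd :: "('s \<Rightarrow> 's \<Rightarrow> real) \<Rightarrow> ('s \<Rightarrow> real) \<Rightarrow> ('s \<Rightarrow> real ^ 'd)
    \<Rightarrow> ('s \<Rightarrow> real) \<Rightarrow> real \<Rightarrow> real \<Rightarrow> real ^ 'd" where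
  "b_lstd P \<mu> \<phi> r \<gamma> lam = (\<chi> j. \<Sum>\<^sub>\<infinity>x. \<mu> x * \<phi> x $ j * resolvent P (\<gamma> * lam) r x)"

definition v_lstd :: "('s \<Rightarrow> 's \<Rightarrow> real) \<Rightarrow> ('s \<Rightarrow> real) \<Rightarrow> ('s \<Rightarrow> real ^ 'd)
    \<Rightarrow> ('s \<Rightarrow> real) \<Rightarrow> real \<Rightarrow> real \<Rightarrow> 's \<Rightarrow> real" where
  "v_lstd P \<mu> \<phi> r \<gamma> lam x =
     \<phi> x \<bullet> (matrix_inv (A_lstd P \<mu> \<phi> \<gamma> lam) *v b_lstd P \<mu> \<phi> r \<gamma> lam)"

definition z_trace :: "('s \<Rightarrow> real ^ 'd) \<Rightarrow> real \<Rightarrow> real \<Rightarrow> (nat \<Rightarrow> 's) \<Rightarrow> nat \<Rightarrow> real ^ 'd" where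
  "z_trace \<phi> \<gamma> lam xs i = (\<Sum>k=1..i. ((lam * \<gamma>) ^ (i - k)) *\<^sub>R \<phi> (xs k))"

definition A_hat :: "('s \<Rightarrow> real ^ 'd) \<Rightarrow> real \<Rightarrow> real \<Rightarrow> (nat \<Rightarrow> 's) \<Rightarrow> nat \<Rightarrow> real ^ 'd ^ 'd" where
  "A_hat \<phi> \<gamma> lam xs n = (1 / real (n - 1)) *\<^sub>R
     (\<Sum>i=1..n-1. outer (z_trace \<phi> \<gamma> lam xs i) (\<phi> (xs i) - \<gamma> *\<^sub>R \<phi> (xs (Suc i))))"

definition b_hat :: "('s \<Rightarrow> real ^ 'd) \<Rightarrow> ('s \<Rightarrow> real) \<Rightarrow> real \<Rightarrow> real \<Rightarrow> (nat \<Rightarrow> 's) \<Rightarrow> nat \<Rightarrow> real ^ 'd" where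
  "b_hat \<phi> r \<gamma> lam xs n = (1 / real (n - 1)) *\<^sub>R
     (\<Sum>i=1..n-1. r (xs i) *\<^sub>R z_trace \<phi> \<gamma> lam xs i)"

definition v_hat :: "('s \<Rightarrow> real ^ 'd) \<Rightarrow> ('s \<Rightarrow> real) \<Rightarrow> real \<Rightarrow> real \<Rightarrow> (nat \<Rightarrow> 's) \<Rightarrow> nat \<Rightarrow> 's \<Rightarrow> real" where
  "v_hat \<phi> r \<gamma> lam xs n x =
     \<phi> x \<bullet> (matrix_inv (A_hat \<phi> \<gamma> lam xs n) *v b_hat \<phi> r \<gamma> lam xs n)"

definition mu_norm :: "('s \<Rightarrow> real) \<Rightarrow> ('s \<Rightarrow> real) \<Rightarrow> real" where
  "mu_norm \<mu> f = sqrt (\<Sum>\<^sub>\<infinity>x. (f x)\<^sup>2 * \<mu> x)"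

definition Lam :: "real \<Rightarrow> nat \<Rightarrow> real \<Rightarrow> real" where
  "Lam \<beta>bar n \<delta> = ln (8 * (real n)\<^sup>2 / \<delta>) + ln (max (4 * exp 2) (real n * \<beta>bar))"

definition Ifun :: "real \<Rightarrow> real \<Rightarrow> real \<Rightarrow> nat \<Rightarrow> real \<Rightarrow> real" where
  "Ifun \<beta>bar b \<kappa> n \<delta> =
     32 * Lam \<beta>bar n \<delta> * (max (Lam \<beta>bar n \<delta> / b) 1) powr (1 / \<kappa>)"

definition mlen :: "real \<Rightarrow> real \<Rightarrow> nat \<Rightarrow> real" where
  "mlen \<gamma> lam n = real_of_int \<lceil>ln (real (n - 1)) / ln (1 / (lam * \<gamma>))\<rceil>"

definition n0_cond :: "nat \<Rightarrow> real \<Rightarrow> real \<Rightarrow> real \<Rightarrow> real \<Rightarrow> real \<Rightarrow> real \<Rightarrow> real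
    \<Rightarrow> nat \<Rightarrow> real \<Rightarrow> bool" where
  "n0_cond d L \<gamma> lam \<nu> \<beta>bar b \<kappa> n \<delta> \<longleftrightarrow>
     2 * real d * L\<^sup>2 / ((1 - \<gamma>) * \<nu>) *
       (2 / sqrt (real (n - 1)) * sqrt ((mlen \<gamma> lam n + 1) * Ifun \<beta>bar b \<kappa> (n - 1) \<delta>)
        + 1 / (real (n - 1) * (1 - lam * \<gamma>))
        + 2 / real (n - 1) * mlen \<gamma> lam n) < 1"

text \<open>n_0(delta): smallest integer (at least 2, so that n - 1 >= 1) from which on the
  condition holds.\<close>
definition n0 :: "nat \<Rightarrow> real \<Rightarrow> real \<Rightarrow> real \<Rightarrow> real \<Rightarrow> real \<Rightarrow> real \<Rightarrow> real \<Rightarrow> real \<Rightarrow> nat" where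
  "n0 d L \<gamma> lam \<nu> \<beta>bar b \<kappa> \<delta> =
     (LEAST m. 2 \<le> m \<and> (\<forall>n\<ge>m. n0_cond d L \<gamma> lam \<nu> \<beta>bar b \<kappa> n \<delta>))"

end

theory Submission
  imports Defs "HOL-Real_Asymp.Real_Asymp"
begin

text \<open>Write \<open>c = \<lambda>\<gamma>\<close>, \<open>w = (I - cP)\<^sup>-\<^sup>1 u\<close> and \<open>G = w - g P w\<close>. Summation by parts along the recursion
  \<open>z\<^sub>i = c z\<^sub>i\<^sub>-\<^sub>1 + f(X\<^sub>i)\<close> gives
  \<open>\<Sum>\<^sub>i z\<^sub>i (u(X\<^sub>i) - g u(X\<^sub>i\<^sub>+\<^sub>1)) = \<Sum>\<^sub>i f(X\<^sub>i) G(X\<^sub>i) - c z\<^sub>N G(X\<^sub>N\<^sub>+\<^sub>1) - (g - c) \<Sum>\<^sub>i z\<^sub>i (w(X\<^sub>i\<^sub>+\<^sub>1) - P w(X\<^sub>i))\<close>,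
  so each entry of \<open>A_hat\<close> and \<open>b_hat\<close> is an additive functional of the chain with the right mean, plus a bounded
  term, plus a martingale with bounded increments. With a lag \<open>a\<close> for which the mixing coefficient is at
  most \<open>\<beta>bar e\<^sup>-\<^sup>\<Lambda>\<close>, the additive functional splits into \<open>a\<close> martingales (one per residue class modulo \<open>a\<close>),
  which are sub-Gaussian, and the drift \<open>P\<^sup>a h - \<mu>(h)\<close>, whose mean absolute value is at most twice the mixing
  coefficient. A union bound over the entries and over all \<open>n \<ge> n\<^sub>0\<close> costs at most \<open>\<delta>\<close>.

  Since \<open>x \<bullet> A x \<ge> (1 - \<gamma>)/(1 - c) \<nu> |x|\<^sup>2\<close> and the entrywise deviation is, by the choice of \<open>n\<^sub>0\<close>, at most
  three quarters of what would destroy this, \<open>A_hat\<close> is invertible with bounded inverse. The resulting error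
  is smaller than the leading term by a factor of order \<open>sqrt (log n)\<close>.\<close>

section \<open>Bounded functions and the resolvent of a kernel\<close>

text \<open>The obstacle is that the trace at time i depends on the whole past, so mixing does not
  apply directly to the summands. Cutting the trace after order log n terms would cost the factor
  \<open>1 + mlen\<close> under the root. In the martingale form nothing is cut:
  \<open>(1 - c) z_i\<close> is bounded and known at time i, and mixing is spent only on functions
  of a single state. Two counts make the constants fit. \<open>Lam\<close> contains 8 n^2 / \<delta>
  but no dimension d, so a single entry fails at sample size N = n - 1 with probability at most
  \<delta> / (2 N^2), and there are d (d + 1) entries. The factor d^2 is recovered from
  \<open>n0\<close>, which forces N > 1024 d^2: the sum of 1 / N^2 from there on is below 1 / d^2.
  Next, with R = sqrt (N \<Lambda> a0), where \<Lambda> is \<open>Lam\<close> and a0 the real-valued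
  lag, every sum deviates by at most 12 R in its natural scale. That scale is at most 2 L^2 for
  entries of \<open>A_hat\<close>, which gives 24 R against the 32 R that \<open>n0\<close> affords;
  this is the origin of the three quarters. The order of h is required for each fixed \<delta> only,
  so h can be taken as the positive part of the gap between the two bounds.\<close>

definition bdd_by :: "('s \<Rightarrow> real) \<Rightarrow> real \<Rightarrow> bool" where
  "bdd_by f B \<longleftrightarrow> (\<forall>x. \<bar>f x\<bar> \<le> B)"

lemma bdd_byD: "bdd_by f B \<Longrightarrow> \<bar>f x\<bar> \<le> B"
  by (simp add: bdd_by_def)

lemma bdd_by_nonneg: "bdd_by f B \<Longrightarrow> 0 \<le> B"
  using bdd_byD[of f B undefined] by simp

lemma weighted_summable:
  fixes p f :: "'s \<Rightarrow> real"
  assumes "\<And>x. 0 \<le> p x" "p summable_on UNIV" "bdd_by f B"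
  shows "(\<lambda>x. p x * f x) summable_on UNIV"
proof -
  have "(\<lambda>x. norm (p x * f x)) summable_on UNIV"
  proof (rule Infinite_Sum.abs_summable_on_comparison_test)
    show "(\<lambda>x. norm (B * p x)) summable_on UNIV"
      using assms summable_on_cmult_right[of p UNIV "\<bar>B\<bar>"] by (simp add: abs_mult)
  next
    fix x show "norm (p x * f x) \<le> norm (B * p x)"
      using assms(1)[of x] bdd_byD[OF assms(3), of x] bdd_by_nonneg[OF assms(3)]
      using mult_left_mono[of "\<bar>f x\<bar>" B "p x"] by (simp add: abs_mult mult.commute)
  qed
  then show ?thesis by (rule abs_summable_summable)
qed

lemma weighted_bound:
  fixes p f :: "'s \<Rightarrow> real"
  assumes "\<And>x. 0 \<le> p x" "(p has_sum 1) UNIV" "bdd_by f B"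
  shows "\<bar>\<Sum>\<^sub>\<infinity>x. p x * f x\<bar> \<le> B"
proof -
  have s: "p summable_on UNIV" using assms(2) by (auto simp: summable_on_def)
  have s1: "(\<lambda>x. p x * f x) summable_on UNIV" by (rule weighted_summable[OF assms(1) s assms(3)])
  have B: "((\<lambda>x. p x * B) has_sum 1 * B) UNIV" "((\<lambda>x. p x * -B) has_sum 1 * -B) UNIV"
    using assms(2) by (rule has_sum_cmult_left)+
  have "p x * f x \<le> p x * B" "p x * -B \<le> p x * f x" for x
    using assms(1)[of x] bdd_byD[OF assms(3), of x] by (intro mult_left_mono; simp add: abs_le_iff)+
  then show ?thesis
    using has_sum_mono[OF has_sum_infsum[OF s1] B(1)] has_sum_mono[OF B(2) has_sum_infsum[OF s1]]
    by (simp add: abs_le_iff)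
qed

lemma Pop_summable:
  assumes "stochastic P" "bdd_by f B"
  shows "(\<lambda>y. P x y * f y) summable_on UNIV"
  using assms by (intro weighted_summable) (auto simp: stochastic_def summable_on_def)

lemma Pop_bdd:
  assumes "stochastic P" "bdd_by f B"
  shows "bdd_by (Pop P f) B"
  using assms weighted_bound[of "P x" f B for x] by (auto simp: stochastic_def bdd_by_def[of "Pop P f"] Pop_def)

text \<open>A family that is not summable has the sum 0, so additivity can fail without summability.
  This is why an explicit bound accompanies every function.\<close>

lemma Pop_add:
  assumes "stochastic P" "bdd_by f B" "bdd_by g C"
  shows "Pop P (\<lambda>x. f x + g x) x = Pop P f x + Pop P g x"
  unfolding Pop_def using infsum_add[OF Pop_summable[OF assms(1,2)] Pop_summable[OF assms(1,3)]]
  by (simp add: distrib_left)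

lemma Pop_cmult: "Pop P (\<lambda>x. c * f x) x = c * Pop P f x"
  unfolding Pop_def using infsum_cmult_right'[of c "\<lambda>y. P x y * f y" UNIV]
  by (simp add: mult.left_commute)

lemma Pop_diff:
  assumes "stochastic P" "bdd_by f B" "bdd_by g C"
  shows "Pop P (\<lambda>x. f x - g x) x = Pop P f x - Pop P g x"
proof -
  have "bdd_by (\<lambda>x. - 1 * g x) C" using assms(3) by (simp add: bdd_by_def)
  from Pop_add[OF assms(1,2) this, of x] show ?thesis using Pop_cmult[of P "-1" g x] by simp
qed

lemma bdd_by_sum:
  assumes "\<And>i. i \<in> I \<Longrightarrow> bdd_by (f i) (B i)"
  shows "bdd_by (\<lambda>x. \<Sum>i\<in>I. f i x) (\<Sum>i\<in>I. B i)"
  using assms by (auto simp: bdd_by_def intro!: order_trans[OF sum_abs] sum_mono)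

lemma bdd_by_cmult: "bdd_by f B \<Longrightarrow> bdd_by (\<lambda>x. c * f x) (\<bar>c\<bar> * B)"
  by (simp add: bdd_by_def abs_mult mult_left_mono)

lemma bdd_by_mult: "bdd_by f B \<Longrightarrow> bdd_by g C \<Longrightarrow> bdd_by (\<lambda>x. f x * g x) (B * C)"
  using bdd_by_nonneg[of f B] by (auto simp: bdd_by_def abs_mult intro!: mult_mono)

lemma bdd_by_add: "bdd_by f B \<Longrightarrow> bdd_by g C \<Longrightarrow> bdd_by (\<lambda>x. f x + g x) (B + C)"
  unfolding bdd_by_def by (auto intro: order_trans[OF abs_triangle_ineq add_mono])

lemma bdd_by_diff: "bdd_by f B \<Longrightarrow> bdd_by g C \<Longrightarrow> bdd_by (\<lambda>x. f x - g x) (B + C)"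
  unfolding bdd_by_def by (auto intro: order_trans[OF abs_triangle_ineq4 add_mono])

lemma Pop_sum:
  assumes "stochastic P" "finite I" "\<And>i. i \<in> I \<Longrightarrow> bdd_by (f i) (B i)"
  shows "Pop P (\<lambda>x. \<Sum>i\<in>I. f i x) x = (\<Sum>i\<in>I. Pop P (f i) x)"
  using assms(2,3)
proof (induction I rule: finite_induct)
  case empty then show ?case by (simp add: Pop_def)
next
  case (insert j I)
  have "Pop P (\<lambda>x. f j x + (\<Sum>i\<in>I. f i x)) x = Pop P (f j) x + Pop P (\<lambda>x. \<Sum>i\<in>I. f i x) x"
    by (rule Pop_add[OF assms(1) insert.prems bdd_by_sum[OF insert.prems]]) auto
  then show ?case using insert by simp
qed

lemma Pop_pow_bdd:
  assumes "stochastic P" "bdd_by f B"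
  shows "bdd_by ((Pop P ^^ k) f) B"
  by (induction k) (use assms Pop_bdd in auto)

text \<open>\<open>Pop\<close> does not increase sup bounds, so the series is dominated by the
  geometric one. The remainder estimate is uniform in x: n = 0 bounds the resolvent itself, and
  general n lets \<open>Pop\<close> pass through the series.\<close>

lemma resolvent_sums:
  assumes "stochastic P" "bdd_by f B" "0 \<le> c" "c < 1"
  shows "(\<lambda>k. c ^ k * ((Pop P ^^ k) f) x) sums resolvent P c f x"
    and "\<bar>resolvent P c f x - (\<Sum>k<n. c ^ k * ((Pop P ^^ k) f) x)\<bar> \<le> c ^ n * (B / (1 - c))"
proof -
  have b: "\<bar>c ^ k * ((Pop P ^^ k) f) x\<bar> \<le> c ^ k * B" for k
    using bdd_byD[OF Pop_pow_bdd[OF assms(1,2)], of k x] assms(3) by (simp add: abs_mult mult_left_mono)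
  have g: "summable (\<lambda>k. c ^ k * B)" using assms(3,4) by (intro summable_mult2 summable_geometric) simp
  have s: "summable (\<lambda>k. c ^ k * ((Pop P ^^ k) f) x)"
    by (rule summable_comparison_test[OF _ g]) (use b in auto)
  show "(\<lambda>k. c ^ k * ((Pop P ^^ k) f) x) sums resolvent P c f x"
    unfolding resolvent_def using s by (rule summable_sums)
  have "resolvent P c f x - (\<Sum>k<n. c ^ k * ((Pop P ^^ k) f) x) = (\<Sum>k. c ^ (k+n) * ((Pop P ^^ (k+n)) f) x)"
    unfolding resolvent_def using suminf_minus_initial_segment[OF s, of n] by simp
  also have "\<bar>\<dots>\<bar> \<le> (\<Sum>k. c ^ (k+n) * B)"
    using norm_suminf_le[of "\<lambda>k. c ^ (k+n) * ((Pop P ^^ (k+n)) f) x" "\<lambda>k. c ^ (k+n) * B"]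
      b g summable_ignore_initial_segment[of "\<lambda>k. c ^ k * B" n] by auto
  also have "\<dots> = c ^ n * (B / (1 - c))"
    using suminf_geometric[of c] assms(3,4)
      suminf_mult2[OF summable_geometric[of c], of "c ^ n * B"] by (simp add: power_add mult.assoc)
  finally show "\<bar>resolvent P c f x - (\<Sum>k<n. c ^ k * ((Pop P ^^ k) f) x)\<bar> \<le> c ^ n * (B / (1 - c))" .
qed

lemma resolvent_bdd:
  assumes "stochastic P" "bdd_by f B" "0 \<le> c" "c < 1"
  shows "bdd_by (resolvent P c f) (B / (1 - c))"
  using resolvent_sums(2)[OF assms, of _ 0] by (simp add: bdd_by_def)

text \<open>\<open>Pop\<close> maps the partial sums of the series to shifted partial sums. By
  uniform convergence and the sup contraction these converge to \<open>Pop\<close> of the limit;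
  multiplying by c and restoring the term k = 0 gives the series back.\<close>

lemma resolvent_eq:
  assumes "stochastic P" "bdd_by f B" "0 \<le> c" "c < 1"
  shows "resolvent P c f x = f x + c * Pop P (resolvent P c f) x"
proof -
  let ?w = "resolvent P c f"
  let ?s = "\<lambda>n x. \<Sum>k<n. c ^ k * ((Pop P ^^ k) f) x"
  have bt: "bdd_by (\<lambda>x. c ^ k * ((Pop P ^^ k) f) x) (\<bar>c^k\<bar> * B)" for k
    by (intro bdd_by_cmult Pop_pow_bdd assms)
  have bs: "bdd_by (?s n) (\<Sum>k<n. \<bar>c^k\<bar> * B)" for n
    by (intro bdd_by_sum bt)
  have Ps: "Pop P (?s n) x = (\<Sum>k<n. c ^ k * ((Pop P ^^ Suc k) f) x)" for n x
    using Pop_sum[OF assms(1), of "{..<n}" "\<lambda>k x. c ^ k * ((Pop P ^^ k) f) x" "\<lambda>k. \<bar>c^k\<bar> * B"] bt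
    by (simp add: Pop_cmult)
  have "\<bar>Pop P ?w x - Pop P (?s n) x\<bar> \<le> c ^ n * (B / (1 - c))" for n
  proof -
    have "bdd_by (\<lambda>x. ?w x - ?s n x) (c ^ n * (B / (1 - c)))"
      using resolvent_sums(2)[OF assms] by (simp add: bdd_by_def)
    from bdd_byD[OF Pop_bdd[OF assms(1) this], of x]
    show ?thesis using Pop_diff[OF assms(1) resolvent_bdd[OF assms] bs[of n], of x] by simp
  qed
  moreover have "(\<lambda>n. c ^ n * (B / (1 - c))) \<longlonglongrightarrow> 0"
    using tendsto_mult_right[OF LIMSEQ_power_zero[of c], of "B / (1 - c)"] assms(3,4) by simp
  ultimately have "(\<lambda>n. Pop P (?s n) x - Pop P ?w x) \<longlonglongrightarrow> 0"
    by (elim Lim_null_comparison[rotated]) (auto simp: abs_minus_commute)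
  then have "(\<lambda>n. Pop P (?s n) x) \<longlonglongrightarrow> Pop P ?w x" by (rule LIM_zero_cancel)
  then have "(\<lambda>k. c ^ k * ((Pop P ^^ Suc k) f) x) sums Pop P ?w x" by (simp add: Ps sums_def)
  from sums_mult[OF this, of c]
  have "(\<lambda>k. c ^ Suc k * ((Pop P ^^ Suc k) f) x) sums (c * Pop P ?w x)" by (simp add: mult.assoc)
  then have "(\<lambda>k. c ^ k * ((Pop P ^^ k) f) x) sums (c * Pop P ?w x + f x)"
    using sums_Suc_iff[of "\<lambda>k. c ^ k * ((Pop P ^^ k) f) x" "c * Pop P ?w x"] by simp
  from sums_unique2[OF this resolvent_sums(1)[OF assms]] show ?thesis by simp
qed

section \<open>The Markov property\<close>

text \<open>Stands in for conditional expectation: conditioning on a variable with countably many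
  values is a sum over its level sets. It holds by dominated convergence.\<close>

lemma integral_partition:
  fixes Y :: "'a \<Rightarrow> real" and V :: "'a \<Rightarrow> 'v::countable"
  assumes Y: "integrable M Y" and V: "V \<in> measurable M (count_space UNIV)"
  shows "((\<lambda>v. \<integral>\<omega>. Y \<omega> * of_bool (V \<omega> = v) \<partial>M) has_sum (\<integral>\<omega>. Y \<omega> \<partial>M)) UNIV"
proof -
  let ?f = "\<lambda>i \<omega>. Y \<omega> * of_bool (to_nat (V \<omega>) = i)"
  have [measurable]: "V \<in> measurable M (count_space UNIV)" "Y \<in> borel_measurable M" using V Y by auto
  have int: "integrable M (?f i)" for i
    by (rule Bochner_Integration.integrable_bound[OF Y]) (auto simp: abs_mult)
  have fin: "(\<lambda>i. ?f i \<omega>) sums Y \<omega>" for \<omega>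
    using sums_If_finite_set[of "{to_nat (V \<omega>)}" "\<lambda>i. Y \<omega>"]
    by (simp add: of_bool_def if_distrib eq_commute[of _ "to_nat (V \<omega>)"] cong: if_cong)
  have nfin: "(\<lambda>i. norm (?f i \<omega>)) sums \<bar>Y \<omega>\<bar>" for \<omega>
    using sums_If_finite_set[of "{to_nat (V \<omega>)}" "\<lambda>i. \<bar>Y \<omega>\<bar>"]
    by (simp add: of_bool_def if_distrib eq_commute[of _ "to_nat (V \<omega>)"] cong: if_cong)
  have sm: "summable (\<lambda>i. \<integral>\<omega>. norm (?f i \<omega>) \<partial>M)"
  proof (rule summableI_nonneg_bounded)
    fix n
    have "(\<Sum>i<n. \<integral>\<omega>. norm (?f i \<omega>) \<partial>M) = (\<integral>\<omega>. (\<Sum>i<n. norm (?f i \<omega>)) \<partial>M)"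
      using int by (subst Bochner_Integration.integral_sum) auto
    also have "\<dots> \<le> (\<integral>\<omega>. \<bar>Y \<omega>\<bar> \<partial>M)"
    proof (rule integral_mono)
      show "(\<Sum>i<n. norm (?f i \<omega>)) \<le> \<bar>Y \<omega>\<bar>" for \<omega>
        using sum_le_suminf[OF sums_summable[OF nfin[of \<omega>]], of "{..<n}"] sums_unique[OF nfin[of \<omega>]]
        by simp
    qed (use int Y in auto)
    finally show "(\<Sum>i<n. \<integral>\<omega>. norm (?f i \<omega>) \<partial>M) \<le> (\<integral>\<omega>. \<bar>Y \<omega>\<bar> \<partial>M)" .
  qed auto
  have "(\<lambda>i. integral\<^sup>L M (?f i)) sums (\<integral>\<omega>. (\<Sum>i. ?f i \<omega>) \<partial>M)"
    by (rule sums_integral) (use int sm sums_summable[OF nfin] in auto)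
  then have s: "(\<lambda>i. integral\<^sup>L M (?f i)) sums (\<integral>\<omega>. Y \<omega> \<partial>M)"
    using sums_unique[OF fin] by simp
  \<comment> \<open>Absolute convergence turns the ordered series over the naturals into an
    unordered sum, which can then be reindexed by \<open>to_nat\<close>.\<close>
  have "summable (\<lambda>i. norm (integral\<^sup>L M (?f i)))"
    by (rule summable_comparison_test[OF _ sm])
      (use integral_norm_bound[of M "?f i" for i] in \<open>auto intro!: exI[of _ 0]\<close>)
  from norm_summable_imp_has_sum[OF this s]
  have "((\<lambda>i. integral\<^sup>L M (?f i)) has_sum (\<integral>\<omega>. Y \<omega> \<partial>M)) UNIV" .
  also have "?this \<longleftrightarrow> ((\<lambda>i. integral\<^sup>L M (?f i)) has_sum (\<integral>\<omega>. Y \<omega> \<partial>M)) (range (to_nat :: 'v \<Rightarrow> nat))"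
  proof (rule has_sum_cong_neutral)
    fix i assume "i \<in> UNIV - range (to_nat :: 'v \<Rightarrow> nat)"
    then have "of_bool (to_nat (V \<omega>) = i) = (0::real)" for \<omega> by auto
    then show "integral\<^sup>L M (?f i) = 0" by simp
  qed auto
  finally show ?thesis
    by (subst (asm) has_sum_reindex) (auto simp: o_def)
qed


lemma (in prob_space) expectation_of_bool:
  assumes "Measurable.pred M Q"
  shows "(\<integral>\<omega>. of_bool (Q \<omega>) \<partial>M) = prob {\<omega> \<in> space M. Q \<omega>}"
proof -
  have [measurable]: "{\<omega> \<in> space M. Q \<omega>} \<in> events" using assms by (rule predE)
  have "(\<integral>\<omega>. of_bool (Q \<omega>) \<partial>M) = (\<integral>\<omega>. indicator {\<omega> \<in> space M. Q \<omega>} \<omega> \<partial>M)"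
    by (intro Bochner_Integration.integral_cong) auto
  also have "\<dots> = prob {\<omega> \<in> space M. Q \<omega>}" by simp
  finally show ?thesis .
qed

locale stationary_chain = prob_space M
  for M :: "'a measure" +
  fixes X :: "nat \<Rightarrow> 'a \<Rightarrow> 's::countable" and P :: "'s \<Rightarrow> 's \<Rightarrow> real" and \<mu> :: "'s \<Rightarrow> real"
  assumes stoch: "stochastic P" and stat: "stationary_dist P \<mu>"
    and chain: "markov_chain_from M X P \<mu>"
begin

lemma X_measurable [measurable]: "X k \<in> measurable M (count_space UNIV)"
  using chain by (simp add: markov_chain_from_def)

definition hist :: "nat \<Rightarrow> 'a \<Rightarrow> 's list" where
  "hist n \<omega> = map (\<lambda>k. X k \<omega>) [1..<Suc n]"

text \<open>Measurability with respect to the past, written as factorization through the list of the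
  first n states. With countably many states the past is generated by a countable partition, so
  nothing is lost, and every such function is measurable.\<close>

definition adapted :: "nat \<Rightarrow> ('a \<Rightarrow> 'b) \<Rightarrow> bool" where
  "adapted n Z \<longleftrightarrow> (\<exists>g. \<forall>\<omega>. Z \<omega> = g (hist n \<omega>))"

lemma length_hist [simp]: "length (hist n \<omega>) = n"
  by (simp add: hist_def)

lemma hist_nth: "k < n \<Longrightarrow> hist n \<omega> ! k = X (Suc k) \<omega>"
  by (simp add: hist_def del: upt_Suc)

lemma hist_Suc: "hist (Suc n) \<omega> = hist n \<omega> @ [X (Suc n) \<omega>]"
  by (simp add: hist_def)

lemma hist_eq_iff: "hist n \<omega> = xs \<longleftrightarrow> length xs = n \<and> (\<forall>k<n. X (Suc k) \<omega> = xs ! k)"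
  by (auto simp: list_eq_iff_nth_eq hist_nth)

lemma hist_measurable [measurable]: "hist n \<in> measurable M (count_space UNIV)"
proof (subst measurable_count_space_eq_countable)
  show "hist n \<in> space M \<rightarrow> UNIV \<and> (\<forall>xs\<in>UNIV. hist n -` {xs} \<inter> space M \<in> sets M)"
  proof (intro conjI ballI)
    fix xs :: "'s list"
    have "hist n -` {xs} \<inter> space M = {\<omega> \<in> space M. length xs = n \<and> (\<forall>k<n. X (Suc k) \<omega> = xs ! k)}"
      by (auto simp: hist_eq_iff hist_nth)
    also have "\<dots> \<in> sets M" by measurable
    finally show "hist n -` {xs} \<inter> space M \<in> sets M" .
  qed auto
qed auto

lemma adapted_borel: "adapted n (Z :: 'a \<Rightarrow> real) \<Longrightarrow> Z \<in> borel_measurable M"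
proof -
  assume "adapted n Z"
  then obtain g where "Z = (\<lambda>\<omega>. g (hist n \<omega>))" by (auto simp: adapted_def)
  then show ?thesis by simp
qed

lemma hist_take: "n \<le> m \<Longrightarrow> hist n \<omega> = take n (hist m \<omega>)"
  by (auto simp: list_eq_iff_nth_eq hist_nth)

lemma adapted_mono: "adapted n Z \<Longrightarrow> n \<le> m \<Longrightarrow> adapted m Z"
  unfolding adapted_def
proof -
  assume "\<exists>g. \<forall>\<omega>. Z \<omega> = g (hist n \<omega>)" and nm: "n \<le> m"
  then obtain g where "\<forall>\<omega>. Z \<omega> = g (hist n \<omega>)" by blast
  then have "\<forall>\<omega>. Z \<omega> = (g \<circ> take n) (hist m \<omega>)" using hist_take[OF nm] by simp
  then show "\<exists>g. \<forall>\<omega>. Z \<omega> = g (hist m \<omega>)" by blast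
qed

lemma adapted_const: "adapted n (\<lambda>\<omega>. c)"
  unfolding adapted_def by (rule exI[of _ "\<lambda>_. c"]) simp

lemma adapted_X: "1 \<le> k \<Longrightarrow> k \<le> n \<Longrightarrow> adapted n (X k)"
  unfolding adapted_def by (rule exI[of _ "\<lambda>xs. xs ! (k - 1)"]) (simp add: hist_nth)

lemma adapted_comp: "adapted n Z \<Longrightarrow> adapted n (\<lambda>\<omega>. f (Z \<omega>))"
proof -
  assume "adapted n Z"
  then obtain g where "\<forall>\<omega>. Z \<omega> = g (hist n \<omega>)" by (auto simp: adapted_def)
  then show ?thesis unfolding adapted_def by (intro exI[of _ "\<lambda>xs. f (g xs)"]) simp
qed

lemma adapted_comp2: "adapted n Z \<Longrightarrow> adapted n W \<Longrightarrow> adapted n (\<lambda>\<omega>. f (Z \<omega>) (W \<omega>))"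
proof -
  assume "adapted n Z" "adapted n W"
  then obtain g h where "\<forall>\<omega>. Z \<omega> = g (hist n \<omega>)" "\<forall>\<omega>. W \<omega> = h (hist n \<omega>)"
    by (auto simp: adapted_def)
  then show ?thesis unfolding adapted_def by (intro exI[of _ "\<lambda>xs. f (g xs) (h xs)"]) simp
qed

lemma adapted_sum:
  assumes "\<And>i. i \<in> I \<Longrightarrow> adapted n (Z i)"
  shows "adapted n (\<lambda>\<omega>. \<Sum>i\<in>I. Z i \<omega>)"
proof -
  have "\<forall>i. \<exists>g. i \<in> I \<longrightarrow> (\<forall>\<omega>. Z i \<omega> = g (hist n \<omega>))" using assms by (auto simp: adapted_def)
  then obtain g where "\<forall>i. i \<in> I \<longrightarrow> (\<forall>\<omega>. Z i \<omega> = g i (hist n \<omega>))" by metis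
  then show ?thesis unfolding adapted_def by (intro exI[of _ "\<lambda>xs. \<Sum>i\<in>I. g i xs"]) simp
qed

lemma bdd_integrable:
  assumes "Z \<in> borel_measurable M" "\<And>\<omega>. \<bar>Z \<omega>\<bar> \<le> (B::real)"
  shows "integrable M Z"
  using assms by (intro integrable_const_bound[of _ B]) auto

lemma prob_hist:
  assumes "1 \<le> n" "length xs = n"
  shows "prob {\<omega> \<in> space M. hist n \<omega> = xs} = \<mu> (xs ! 0) * (\<Prod>k\<in>{1..<n}. P (xs ! (k - 1)) (xs ! k))"
proof -
  have "{\<omega> \<in> space M. hist n \<omega> = xs} = {\<omega> \<in> space M. \<forall>k\<in>{1..n}. X k \<omega> = xs ! (k - 1)}"
  proof -
    have "(\<forall>k<n. X (Suc k) \<omega> = xs ! k) \<longleftrightarrow> (\<forall>k\<in>{1..n}. X k \<omega> = xs ! (k - 1))" for \<omega>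
    proof
      assume a: "\<forall>k<n. X (Suc k) \<omega> = xs ! k"
      show "\<forall>k\<in>{1..n}. X k \<omega> = xs ! (k - 1)"
      proof
        fix k assume "k \<in> {1..n}"
        then show "X k \<omega> = xs ! (k - 1)" using a[rule_format, of "k - 1"] by auto
      qed
    next
      assume "\<forall>k\<in>{1..n}. X k \<omega> = xs ! (k - 1)"
      then show "\<forall>k<n. X (Suc k) \<omega> = xs ! k" by fastforce
    qed
    then show ?thesis using assms(2) by (simp add: hist_eq_iff)
  qed
  moreover have "prob {\<omega> \<in> space M. \<forall>k\<in>{1..n}. X k \<omega> = ys k} = \<mu> (ys 1) * (\<Prod>k\<in>{1..<n}. P (ys k) (ys (Suc k)))" for ys
    using chain assms(1) unfolding markov_chain_from_def by blast
  from this[of "\<lambda>k. xs ! (k - 1)"] show ?thesis using calculation by simp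
qed

lemma prob_hist_Suc:
  assumes "1 \<le> n" "length xs = n"
  shows "prob {\<omega> \<in> space M. hist (Suc n) \<omega> = xs @ [y]} = prob {\<omega> \<in> space M. hist n \<omega> = xs} * P (last xs) y"
proof -
  have "(\<Prod>k\<in>{1..<Suc n}. P ((xs @ [y]) ! (k - 1)) ((xs @ [y]) ! k))
      = (\<Prod>k\<in>{1..<n}. P ((xs @ [y]) ! (k - 1)) ((xs @ [y]) ! k)) * P (last xs) y"
  proof -
    have "xs \<noteq> []" using assms by auto
    then have "P ((xs @ [y]) ! (n - 1)) ((xs @ [y]) ! n) = P (last xs) y"
      using assms by (simp add: nth_append last_conv_nth)
    then show ?thesis using prod.atLeastLessThan_Suc[of 1 n "\<lambda>k. P ((xs @ [y]) ! (k - 1)) ((xs @ [y]) ! k)"] assms(1)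
      by (simp del: One_nat_def)
  qed
  also have "(\<Prod>k\<in>{1..<n}. P ((xs @ [y]) ! (k - 1)) ((xs @ [y]) ! k)) = (\<Prod>k\<in>{1..<n}. P (xs ! (k - 1)) (xs ! k))"
    using assms by (intro prod.cong) (auto simp: nth_append)
  finally show ?thesis
    using assms by (subst (1 2) prob_hist) (auto simp: nth_append)
qed

lemma X_last_hist: "1 \<le> n \<Longrightarrow> X n \<omega> = last (hist n \<omega>)"
  by (cases n) (auto simp: hist_Suc)

text \<open>The Markov property in the form E[Z w(X_{n+1})] = E[Z (P w)(X_n)]. Both sides are split
  over the values of the history; on one value Z is constant, and both integrals equal that constant
  times the probability of the history times \<open>Pop P w\<close> at its last state.\<close>

lemma markov_step:
  assumes n: "1 \<le> n" and Z: "adapted n Z" and ZB: "\<And>\<omega>. \<bar>Z \<omega>\<bar> \<le> B" and w: "bdd_by w C"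
  shows "(\<integral>\<omega>. Z \<omega> * w (X (Suc n) \<omega>) \<partial>M) = (\<integral>\<omega>. Z \<omega> * Pop P w (X n \<omega>) \<partial>M)"
proof -
  obtain g where g: "\<And>\<omega>. Z \<omega> = g (hist n \<omega>)" using Z by (auto simp: adapted_def)
  have [measurable]: "Z \<in> borel_measurable M" using Z by (rule adapted_borel)
  have B0: "0 \<le> B" using ZB[of undefined] by simp
  have intw: "integrable M (\<lambda>\<omega>. Z \<omega> * v (X k \<omega>))" if "bdd_by v C" for v k
  proof (rule bdd_integrable[of _ "B * C"])
    show "(\<lambda>\<omega>. Z \<omega> * v (X k \<omega>)) \<in> borel_measurable M" by measurable
    show "\<bar>Z \<omega> * v (X k \<omega>)\<bar> \<le> B * C" for \<omega>
      using ZB[of \<omega>] bdd_byD[OF that, of "X k \<omega>"] B0 by (simp add: abs_mult mult_mono)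
  qed
  have eq: "(\<integral>\<omega>. Z \<omega> * w (X (Suc n) \<omega>) * of_bool (hist n \<omega> = xs) \<partial>M)
     = (\<integral>\<omega>. Z \<omega> * Pop P w (X n \<omega>) * of_bool (hist n \<omega> = xs) \<partial>M)" for xs
  proof (cases "length xs = n")
    case False
    then have "hist n \<omega> \<noteq> xs" for \<omega> using length_hist by blast
    then show ?thesis by simp
  next
    case len: True
    let ?p = "prob {\<omega> \<in> space M. hist n \<omega> = xs}"
    have int: "integrable M (\<lambda>\<omega>. w (X (Suc n) \<omega>) * of_bool (hist n \<omega> = xs))"
      by (rule bdd_integrable[of _ C])
        (use bdd_byD[OF w] bdd_by_nonneg[OF w] in \<open>auto simp: of_bool_def\<close>)
    \<comment> \<open>A second partition, over the next state, produces the sum that defines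
      \<open>Pop\<close>.\<close>
    have "((\<lambda>y. \<integral>\<omega>. w (X (Suc n) \<omega>) * of_bool (hist n \<omega> = xs) * of_bool (X (Suc n) \<omega> = y) \<partial>M)
        has_sum (\<integral>\<omega>. w (X (Suc n) \<omega>) * of_bool (hist n \<omega> = xs) \<partial>M)) UNIV"
      by (rule integral_partition[OF int]) measurable
    moreover have "(\<integral>\<omega>. w (X (Suc n) \<omega>) * of_bool (hist n \<omega> = xs) * of_bool (X (Suc n) \<omega> = y) \<partial>M)
        = ?p * (P (last xs) y * w y)" for y
    proof -
      have "(\<integral>\<omega>. w (X (Suc n) \<omega>) * of_bool (hist n \<omega> = xs) * of_bool (X (Suc n) \<omega> = y) \<partial>M)
        = (\<integral>\<omega>. w y * of_bool (hist (Suc n) \<omega> = xs @ [y]) \<partial>M)"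
        by (intro Bochner_Integration.integral_cong) (auto simp: hist_Suc)
      also have "\<dots> = w y * prob {\<omega> \<in> space M. hist (Suc n) \<omega> = xs @ [y]}"
        by (simp add: expectation_of_bool)
      also have "\<dots> = ?p * (P (last xs) y * w y)"
        using prob_hist_Suc[OF n len] by simp
      finally show ?thesis .
    qed
    ultimately have "((\<lambda>y. ?p * (P (last xs) y * w y)) has_sum
        (\<integral>\<omega>. w (X (Suc n) \<omega>) * of_bool (hist n \<omega> = xs) \<partial>M)) UNIV" by simp
    then have "(\<integral>\<omega>. w (X (Suc n) \<omega>) * of_bool (hist n \<omega> = xs) \<partial>M) = (\<Sum>\<^sub>\<infinity>y. ?p * (P (last xs) y * w y))"
      by (rule infsumI[symmetric])
    also have "\<dots> = ?p * Pop P w (last xs)" unfolding Pop_def by (rule infsum_cmult_right')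
    finally have l: "(\<integral>\<omega>. w (X (Suc n) \<omega>) * of_bool (hist n \<omega> = xs) \<partial>M) = ?p * Pop P w (last xs)" .
    have "(\<integral>\<omega>. Z \<omega> * w (X (Suc n) \<omega>) * of_bool (hist n \<omega> = xs) \<partial>M)
      = (\<integral>\<omega>. g xs * (w (X (Suc n) \<omega>) * of_bool (hist n \<omega> = xs)) \<partial>M)"
      by (intro Bochner_Integration.integral_cong) (auto simp: g)
    also have "\<dots> = g xs * (?p * Pop P w (last xs))" using l by simp
    also have "\<dots> = (\<integral>\<omega>. g xs * Pop P w (last xs) * of_bool (hist n \<omega> = xs) \<partial>M)"
      by (simp add: expectation_of_bool)
    also have "\<dots> = (\<integral>\<omega>. Z \<omega> * Pop P w (X n \<omega>) * of_bool (hist n \<omega> = xs) \<partial>M)"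
      using n by (intro Bochner_Integration.integral_cong) (auto simp: g X_last_hist)
    finally show ?thesis .
  qed
  show ?thesis
    using has_sum_unique[OF integral_partition[OF intw[OF w] hist_measurable[of n], of "Suc n"]]
      integral_partition[OF intw[OF Pop_bdd[OF stoch w]] hist_measurable[of n], of n]
    unfolding eq by blast
qed

text \<open>The last step is peeled off and moved onto w, so the induction generalizes over w while
  Z, known at time n, stays adapted at the later times.\<close>

lemma markov_steps:
  assumes n: "1 \<le> n" and Z: "adapted n Z" and ZB: "\<And>\<omega>. \<bar>Z \<omega>\<bar> \<le> B" and w: "bdd_by w C"
  shows "(\<integral>\<omega>. Z \<omega> * w (X (n + a) \<omega>) \<partial>M) = (\<integral>\<omega>. Z \<omega> * (Pop P ^^ a) w (X n \<omega>) \<partial>M)"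
  using w
proof (induction a arbitrary: w)
  case (Suc a)
  have "(\<integral>\<omega>. Z \<omega> * w (X (n + Suc a) \<omega>) \<partial>M) = (\<integral>\<omega>. Z \<omega> * Pop P w (X (n + a) \<omega>) \<partial>M)"
    using markov_step[of "n + a" Z B w C] n adapted_mono[OF Z, of "n + a"] ZB Suc.prems by simp
  also have "\<dots> = (\<integral>\<omega>. Z \<omega> * (Pop P ^^ a) (Pop P w) (X n \<omega>) \<partial>M)"
    by (rule Suc.IH[OF Pop_bdd[OF stoch Suc.prems]])
  finally show ?case by (simp add: funpow_swap1)
qed simp

lemma expectation_X:
  assumes "bdd_by g C"
  shows "((\<lambda>x. prob {\<omega> \<in> space M. X k \<omega> = x} * g x) has_sum (\<integral>\<omega>. g (X k \<omega>) \<partial>M)) UNIV"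
proof -
  have int: "integrable M (\<lambda>\<omega>. g (X k \<omega>))"
    by (rule bdd_integrable[of _ C]) (use bdd_byD[OF assms] in auto)
  have "(\<integral>\<omega>. g (X k \<omega>) * of_bool (X k \<omega> = x) \<partial>M) = prob {\<omega> \<in> space M. X k \<omega> = x} * g x" for x
  proof -
    have "(\<integral>\<omega>. g (X k \<omega>) * of_bool (X k \<omega> = x) \<partial>M) = (\<integral>\<omega>. g x * of_bool (X k \<omega> = x) \<partial>M)"
      by (intro Bochner_Integration.integral_cong) auto
    then show ?thesis by (simp add: expectation_of_bool)
  qed
  then show ?thesis using integral_partition[OF int X_measurable[of k]] by simp
qed

lemma Pop_indicator: "Pop P (\<lambda>z. of_bool (z = y)) x = P x y"
proof -
  have "((\<lambda>z. P x z * of_bool (z = y)) has_sum P x y) {y}" using has_sum_finite[of "{y}" "\<lambda>z. P x z * of_bool (z = y)"] by simp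
  then have "((\<lambda>z. P x z * of_bool (z = y)) has_sum P x y) UNIV"
    by (subst has_sum_cong_neutral[of "{y}" UNIV]) auto
  then show ?thesis unfolding Pop_def by (rule infsumI)
qed

lemma prob_X: "1 \<le> n \<Longrightarrow> prob {\<omega> \<in> space M. X n \<omega> = y} = \<mu> y"
proof (induction n arbitrary: y rule: nat_induct_at_least)
  case base
  have "{\<omega> \<in> space M. X 1 \<omega> = y} = {\<omega> \<in> space M. hist 1 \<omega> = [y]}" by (auto simp: hist_def)
  then show ?case using prob_hist[of 1 "[y]"] by simp
next
  case (Suc n)
  have b: "bdd_by (\<lambda>z. of_bool (z = y)) 1" by (simp add: bdd_by_def)
  have "prob {\<omega> \<in> space M. X (Suc n) \<omega> = y} = (\<integral>\<omega>. of_bool (X (Suc n) \<omega> = y) \<partial>M)"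
    by (simp add: expectation_of_bool)
  also have "\<dots> = (\<integral>\<omega>. Pop P (\<lambda>z. of_bool (z = y)) (X n \<omega>) \<partial>M)"
    using markov_step[OF Suc.hyps adapted_const[of _ 1] _ b, of 1] by simp
  also have "\<dots> = (\<Sum>\<^sub>\<infinity>x. \<mu> x * P x y)"
    using infsumI[OF expectation_X[OF Pop_bdd[OF stoch b], of n]] Suc.IH by (simp add: Pop_indicator)
  also have "\<dots> = \<mu> y" using stat by (simp add: stationary_dist_def)
  finally show ?case .
qed

lemma expectation_stat:
  assumes "bdd_by g C" "1 \<le> n"
  shows "(\<integral>\<omega>. g (X n \<omega>) \<partial>M) = (\<Sum>\<^sub>\<infinity>x. \<mu> x * g x)"
  using infsumI[OF expectation_X[OF assms(1), of n]] prob_X[OF assms(2)] by simp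

end

section \<open>Exponential martingale bounds\<close>

text \<open>Hoeffding's lemma for a fair sign: with h = 2|x| and p = 1/2 the exponent there is the
  logarithm of cosh x, and h^2 / 8 = x^2 / 2.\<close>

lemma cosh_le_exp_square: "cosh (x::real) \<le> exp (x\<^sup>2 / 2)"
proof -
  define h where "h = 2 * \<bar>x\<bar>"
  have "- h * (1/2) + ln (1 + (1/2) * (exp h - 1)) \<le> h\<^sup>2 / 8"
    using Hoeffdings_lemma_aux[of h "1/2"] by (simp add: h_def)
  then have "exp (- h * (1/2) + ln (1 + (1/2) * (exp h - 1))) \<le> exp (h\<^sup>2 / 8)" by simp
  also have "exp (- h * (1/2) + ln (1 + (1/2) * (exp h - 1))) = exp (- \<bar>x\<bar>) * ((1 + exp (2 * \<bar>x\<bar>)) / 2)"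
    by (subst exp_add, subst exp_ln) (auto simp: h_def field_simps add_pos_pos)
  also have "\<dots> = cosh \<bar>x\<bar>"
    by (simp add: cosh_def field_simps flip: exp_add)
  finally show ?thesis by (simp add: h_def power_mult_distrib)
qed

text \<open>By convexity the exponential lies below its chord over [-2, 2]. The chord is affine in
  y, so a centred y leaves only the cosh term after integration.\<close>

lemma exp_chord:
  fixes s y :: real
  assumes "\<bar>y\<bar> \<le> 2"
  shows "exp (s * y) \<le> cosh (2 * s) + y / 2 * sinh (2 * s)"
proof -
  let ?t = "(1 + y / 2) / 2"
  have "exp ((1 - ?t) *\<^sub>R (- 2 * s) + ?t *\<^sub>R (2 * s)) \<le> (1 - ?t) * exp (- 2 * s) + ?t * exp (2 * s)"
    using convex_onD[OF convex_on_exp[of 1], of ?t "- 2 * s" "2 * s"] assms by (simp add: abs_le_iff)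
  then show ?thesis by (simp add: cosh_def sinh_def field_simps)
qed

context stationary_chain begin

text \<open>The a-step martingale difference: given the history up to time n it has mean
  zero.\<close>

definition incr :: "nat \<Rightarrow> ('s \<Rightarrow> real) \<Rightarrow> nat \<Rightarrow> 'a \<Rightarrow> real" where
  "incr a w n \<omega> = w (X (n + a) \<omega>) - (Pop P ^^ a) w (X n \<omega>)"

lemma abs_incr: "bdd_by w 1 \<Longrightarrow> \<bar>incr a w n \<omega>\<bar> \<le> 2"
  using bdd_byD[of w 1 "X (n + a) \<omega>"] bdd_byD[OF Pop_pow_bdd[OF stoch, of w 1 a], of "X n \<omega>"]
  by (simp add: incr_def)

lemma incr_adapted: "1 \<le> n \<Longrightarrow> n + a \<le> m \<Longrightarrow> adapted m (incr a w n)"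
  unfolding incr_def by (intro adapted_comp2[where f = "\<lambda>x y. x - y"] adapted_comp[where f = w]
      adapted_comp[where f = "(Pop P ^^ a) w"] adapted_X) auto

text \<open>The chord bound replaces the exponential by an expression affine in the increment, with
  coefficients known at time n. The linear part integrates to zero by the Markov property, and
  cosh(2 \<theta> c) is at most exp(2 \<theta>^2). The weight c may be random, as long as it is
  adapted; this is what later admits the trace.\<close>

lemma mgf_step:
  assumes n: "1 \<le> n" and Z: "adapted n Z" and Z0: "\<And>\<omega>. 0 \<le> Z \<omega>" and ZB: "\<And>\<omega>. Z \<omega> \<le> B"
    and c: "adapted n c" and c1: "\<And>\<omega>. \<bar>c \<omega>\<bar> \<le> 1" and w: "bdd_by w 1"
  shows "(\<integral>\<omega>. Z \<omega> * exp (\<theta> * (c \<omega> * incr a w n \<omega>)) \<partial>M) \<le> exp (2 * \<theta>\<^sup>2) * (\<integral>\<omega>. Z \<omega> \<partial>M)"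
proof -
  let ?E = "exp (2 * \<theta>\<^sup>2)"
  have [measurable]: "Z \<in> borel_measurable M" "c \<in> borel_measurable M" using Z c by (auto intro: adapted_borel)
  have [measurable]: "incr a w n \<in> borel_measurable M" unfolding incr_def by measurable
  have B: "0 \<le> B" using Z0[of undefined] ZB[of undefined] by simp
  have ch: "cosh (2 * (\<theta> * c \<omega>)) \<le> ?E" for \<omega>
  proof -
    have "(c \<omega>)\<^sup>2 \<le> 1" using c1[of \<omega>] by (simp add: abs_square_le_1)
    then have "(2 * (\<theta> * c \<omega>))\<^sup>2 / 2 \<le> 2 * \<theta>\<^sup>2"
      using mult_left_mono[of "(c \<omega>)\<^sup>2" 1 "\<theta>\<^sup>2"] by (simp add: power_mult_distrib)
    then show ?thesis using cosh_le_exp_square[of "2 * (\<theta> * c \<omega>)"] by (meson exp_le_cancel_iff order_trans)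
  qed
  have sh: "\<bar>sinh (2 * (\<theta> * c \<omega>))\<bar> \<le> ?E" for \<omega>
    using ch[of \<omega>] sinh_le_cosh_real[of "2 * (\<theta> * c \<omega>)"] sinh_le_cosh_real[of "- (2 * (\<theta> * c \<omega>))"] by simp
  let ?Z = "\<lambda>\<omega>. Z \<omega> * sinh (2 * (\<theta> * c \<omega>))"
  have Zs: "adapted n ?Z" using adapted_comp2[OF Z c, of "\<lambda>z c. z * sinh (2 * (\<theta> * c))"] .
  have ZsB: "\<bar>?Z \<omega>\<bar> \<le> B * ?E" for \<omega>
    using sh[of \<omega>] Z0[of \<omega>] ZB[of \<omega>] B by (simp add: abs_mult mult_mono)
  have [measurable]: "?Z \<in> borel_measurable M" using Zs by (rule adapted_borel)
  have ii: "integrable M (\<lambda>\<omega>. ?Z \<omega> * v (X k \<omega>))" if "bdd_by v 1" for v k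
  proof (rule bdd_integrable[of _ "B * ?E * 1"])
    show "\<bar>?Z \<omega> * v (X k \<omega>)\<bar> \<le> B * ?E * 1" for \<omega>
      unfolding abs_mult[of "?Z \<omega>"] using ZsB[of \<omega>] bdd_byD[OF that, of "X k \<omega>"] B by (intro mult_mono) auto
  qed measurable
  have 0: "(\<integral>\<omega>. ?Z \<omega> * incr a w n \<omega> \<partial>M) = 0"
    using markov_steps[OF n Zs ZsB w, of a] ii[OF w] ii[OF Pop_pow_bdd[OF stoch w]]
    by (simp add: incr_def right_diff_distrib)
  have i1: "integrable M (\<lambda>\<omega>. ?Z \<omega> * incr a w n \<omega>)"
    unfolding incr_def right_diff_distrib using ii[OF w] ii[OF Pop_pow_bdd[OF stoch w]] by auto
  have i2: "integrable M Z" by (rule bdd_integrable[of _ B]) (use Z0 ZB in auto)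
  have "(\<integral>\<omega>. Z \<omega> * exp (\<theta> * (c \<omega> * incr a w n \<omega>)) \<partial>M)
      \<le> (\<integral>\<omega>. ?E * Z \<omega> + 1/2 * (?Z \<omega> * incr a w n \<omega>) \<partial>M)"
  proof (rule integral_mono')
    show "integrable M (\<lambda>\<omega>. ?E * Z \<omega> + 1/2 * (?Z \<omega> * incr a w n \<omega>))" using i1 i2 by auto
    fix \<omega>
    have "exp (\<theta> * (c \<omega> * incr a w n \<omega>)) \<le> ?E + incr a w n \<omega> / 2 * sinh (2 * (\<theta> * c \<omega>))"
      using exp_chord[OF abs_incr[OF w], of "\<theta> * c \<omega>" a n \<omega>] ch[of \<omega>] by (simp add: mult.assoc)
    from mult_left_mono[OF this Z0[of \<omega>]]
    show "Z \<omega> * exp (\<theta> * (c \<omega> * incr a w n \<omega>)) \<le> ?E * Z \<omega> + 1/2 * (?Z \<omega> * incr a w n \<omega>)"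
      by (simp add: algebra_simps)
    then show "0 \<le> ?E * Z \<omega> + 1/2 * (?Z \<omega> * incr a w n \<omega>)"
      using mult_nonneg_nonneg[OF Z0[of \<omega>] exp_ge_zero] order_trans by blast
  qed
  also have "\<dots> = ?E * (\<integral>\<omega>. Z \<omega> \<partial>M)"
    using i1 i2 0 by (subst Bochner_Integration.integral_add) auto
  finally show ?thesis .
qed

lemma mgf_sum:
  assumes s: "1 \<le> s" and c: "\<And>k. adapted (s + k * a) (c k)" and c1: "\<And>k \<omega>. \<bar>c k \<omega>\<bar> \<le> 1"
    and w: "bdd_by w 1"
  shows "(\<integral>\<omega>. exp (\<theta> * (\<Sum>k<K. c k \<omega> * incr a w (s + k * a) \<omega>)) \<partial>M) \<le> exp (2 * \<theta>\<^sup>2 * real K)"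
proof (induction K)
  case 0 then show ?case by (simp add: prob_space)
next
  case (Suc K)
  let ?S = "\<lambda>\<omega>. \<Sum>k<K. c k \<omega> * incr a w (s + k * a) \<omega>"
  have ad: "adapted (s + K * a) ?S"
  proof (rule adapted_sum)
    fix k assume k: "k \<in> {..<K}"
    \<comment> \<open>The increment started at s + k a reads the chain up to s + (k + 1) a, which is
      no later than the start s + K a of the next one. The stride a is what makes a-step increments
      a martingale.\<close>
    then have "k * a + a \<le> K * a" using mult_right_mono[of "Suc k" K a] by simp
    moreover have "k * a \<le> K * a" using k by (intro mult_right_mono) auto
    ultimately have "adapted (s + K * a) (c k)" "adapted (s + K * a) (incr a w (s + k * a))"
      using adapted_mono[OF c[of k], of "s + K * a"] incr_adapted[of "s + k * a" a "s + K * a" w] s by auto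
    then show "adapted (s + K * a) (\<lambda>\<omega>. c k \<omega> * incr a w (s + k * a) \<omega>)"
      by (rule adapted_comp2[where f = "(*)"])
  qed
  have SB: "\<bar>?S \<omega>\<bar> \<le> 2 * real K" for \<omega>
  proof -
    have "\<bar>?S \<omega>\<bar> \<le> (\<Sum>k<K. 1 * 2)"
      by (rule order_trans[OF sum_abs], rule sum_mono, subst abs_mult, rule mult_mono)
        (use c1 abs_incr[OF w] in auto)
    then show ?thesis by simp
  qed
  have Z: "adapted (s + K * a) (\<lambda>\<omega>. exp (\<theta> * ?S \<omega>))"
    using adapted_comp[OF ad, of "\<lambda>x. exp (\<theta> * x)"] .
  have ZB: "exp (\<theta> * ?S \<omega>) \<le> exp (\<bar>\<theta>\<bar> * (2 * real K))" for \<omega>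
    using mult_left_mono[OF SB[of \<omega>], of "\<bar>\<theta>\<bar>"] by (simp flip: abs_mult)
  have "(\<integral>\<omega>. exp (\<theta> * (\<Sum>k<Suc K. c k \<omega> * incr a w (s + k * a) \<omega>)) \<partial>M)
    = (\<integral>\<omega>. exp (\<theta> * ?S \<omega>) * exp (\<theta> * (c K \<omega> * incr a w (s + K * a) \<omega>)) \<partial>M)"
    by (simp add: distrib_left flip: exp_add)
  also have "\<dots> \<le> exp (2 * \<theta>\<^sup>2) * (\<integral>\<omega>. exp (\<theta> * ?S \<omega>) \<partial>M)"
    by (rule mgf_step[OF _ Z _ ZB c c1 w]) (use s in auto)
  also have "\<dots> \<le> exp (2 * \<theta>\<^sup>2) * exp (2 * \<theta>\<^sup>2 * real K)"
    using Suc.IH by (rule mult_left_mono) simp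
  also have "\<dots> = exp (2 * \<theta>\<^sup>2 * real (Suc K))" by (simp add: algebra_simps flip: exp_add)
  finally show ?case .
qed

lemma tail_one_sided:
  assumes s: "1 \<le> s" and c: "\<And>k. adapted (s + k * a) (c k)" and c1: "\<And>k \<omega>. \<bar>c k \<omega>\<bar> \<le> 1"
    and w: "bdd_by w 1" and \<tau>: "0 \<le> \<tau>" and K: "0 < K"
  shows "prob {\<omega> \<in> space M. \<tau> \<le> (\<Sum>k<K. c k \<omega> * incr a w (s + k * a) \<omega>)} \<le> exp (- \<tau>\<^sup>2 / (8 * real K))"
proof -
  let ?S = "\<lambda>\<omega>. \<Sum>k<K. c k \<omega> * incr a w (s + k * a) \<omega>"
  \<comment> \<open>The minimizer of 2 K \<theta>^2 - \<theta> \<tau>, with minimum - \<tau>^2 / (8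
    K).\<close>
  define \<theta> where "\<theta> = \<tau> / (4 * real K)"
  have \<theta>: "0 \<le> \<theta>" using \<tau> by (simp add: \<theta>_def)
  have [measurable]: "c k \<in> borel_measurable M" for k using c by (rule adapted_borel)
  have [measurable]: "incr a w n \<in> borel_measurable M" for n unfolding incr_def by measurable
  have SB: "\<bar>?S \<omega>\<bar> \<le> 2 * real K" for \<omega>
  proof -
    have "\<bar>?S \<omega>\<bar> \<le> (\<Sum>k<K. 1 * 2)"
      by (rule order_trans[OF sum_abs], rule sum_mono, subst abs_mult, rule mult_mono)
        (use c1 abs_incr[OF w] in auto)
    then show ?thesis by simp
  qed
  have int: "integrable M (\<lambda>\<omega>. exp (\<theta> * ?S \<omega>))"
  proof (rule bdd_integrable[of _ "exp (\<theta> * (2 * real K))"])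
    show "\<bar>exp (\<theta> * ?S \<omega>)\<bar> \<le> exp (\<theta> * (2 * real K))" for \<omega>
      using mult_left_mono[OF order_trans[OF abs_ge_self SB[of \<omega>]] \<theta>] by simp
  qed measurable
  have "prob {\<omega> \<in> space M. \<tau> \<le> ?S \<omega>} \<le> prob {\<omega> \<in> space M. exp (\<theta> * \<tau>) \<le> exp (\<theta> * ?S \<omega>)}"
    using \<theta> by (intro finite_measure_mono) (auto intro: mult_left_mono)
  also have "\<dots> \<le> (\<integral>\<omega>. exp (\<theta> * ?S \<omega>) \<partial>M) / exp (\<theta> * \<tau>)"
    by (rule integral_Markov_inequality_measure[where A = "{}", OF int]) auto
  also have "\<dots> \<le> exp (2 * \<theta>\<^sup>2 * real K) / exp (\<theta> * \<tau>)"
    by (intro divide_right_mono mgf_sum assms) auto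
  also have "\<dots> = exp (- \<tau>\<^sup>2 / (8 * real K))"
    using K by (simp add: \<theta>_def field_simps power2_eq_square flip: exp_diff)
  finally show ?thesis .
qed

lemma tail_two_sided:
  assumes s: "1 \<le> s" and c: "\<And>k. adapted (s + k * a) (c k)" and c1: "\<And>k \<omega>. \<bar>c k \<omega>\<bar> \<le> 1"
    and w: "bdd_by w 1" and \<tau>: "0 \<le> \<tau>" and K: "0 < K"
  shows "prob {\<omega> \<in> space M. \<tau> \<le> \<bar>\<Sum>k<K. c k \<omega> * incr a w (s + k * a) \<omega>\<bar>} \<le> 2 * exp (- \<tau>\<^sup>2 / (8 * real K))"
proof -
  let ?S = "\<lambda>c \<omega>. \<Sum>k<K. c k \<omega> * incr a w (s + k * a) \<omega>"
  have [measurable]: "c k \<in> borel_measurable M" for k using c by (rule adapted_borel)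
  have [measurable]: "incr a w n \<in> borel_measurable M" for n unfolding incr_def by measurable
  have neg: "?S (\<lambda>k \<omega>. - c k \<omega>) \<omega> = - ?S c \<omega>" for \<omega> by (simp add: sum_negf)
  have eq: "{\<omega> \<in> space M. \<tau> \<le> \<bar>?S c \<omega>\<bar>} = {\<omega> \<in> space M. \<tau> \<le> ?S c \<omega>} \<union> {\<omega> \<in> space M. \<tau> \<le> ?S (\<lambda>k \<omega>. - c k \<omega>) \<omega>}"
    unfolding neg by auto
  have "prob {\<omega> \<in> space M. \<tau> \<le> \<bar>?S c \<omega>\<bar>} \<le> prob {\<omega> \<in> space M. \<tau> \<le> ?S c \<omega>} + prob {\<omega> \<in> space M. \<tau> \<le> ?S (\<lambda>k \<omega>. - c k \<omega>) \<omega>}"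
    unfolding eq
  proof (rule measure_Un_le)
    have [measurable]: "?S c \<in> borel_measurable M" by measurable
    show "{\<omega> \<in> space M. \<tau> \<le> ?S c \<omega>} \<in> events" by measurable
    show "{\<omega> \<in> space M. \<tau> \<le> ?S (\<lambda>k \<omega>. - c k \<omega>) \<omega>} \<in> events" unfolding neg by measurable
  qed
  also have "\<dots> \<le> exp (- \<tau>\<^sup>2 / (8 * real K)) + exp (- \<tau>\<^sup>2 / (8 * real K))"
  proof (rule add_mono)
    have c': "adapted (s + k * a) (\<lambda>\<omega>. - c k \<omega>)" for k using adapted_comp[OF c[of k], of uminus] .
    show "prob {\<omega> \<in> space M. \<tau> \<le> ?S (\<lambda>k \<omega>. - c k \<omega>) \<omega>} \<le> exp (- \<tau>\<^sup>2 / (8 * real K))"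
      by (rule tail_one_sided[OF s c' _ w \<tau> K]) (simp add: c1)
  qed (rule tail_one_sided[OF s c c1 w \<tau> K])
  finally show ?thesis by simp
qed

end

section \<open>Mixing and additive functionals\<close>

text \<open>The tail bounds are stated for functions bounded by 1. The case B = 0 is included: f
  then vanishes, and so does the quotient by zero.\<close>

lemma bdd_by_normalize:
  assumes "bdd_by f B"
  obtains f' where "bdd_by f' 1" "\<And>x. f x = B * f' x"
proof
  show "bdd_by (\<lambda>x. f x / B) 1"
    using bdd_byD[OF assms] bdd_by_nonneg[OF assms] by (cases "B = 0") (auto simp: bdd_by_def field_simps)
  show "f x = B * (f x / B)" for x
    using bdd_byD[OF assms, of x] by (cases "B = 0") auto
qed

context stationary_chain begin

lemma mu_nonneg: "0 \<le> \<mu> x" and mu_has_sum: "(\<mu> has_sum 1) UNIV"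
  using stat by (auto simp: stationary_dist_def)

lemma mu_summable: "\<mu> summable_on UNIV"
  using mu_has_sum by (auto simp: summable_on_def)

definition mean :: "('s \<Rightarrow> real) \<Rightarrow> real" where
  "mean h = (\<Sum>\<^sub>\<infinity>x. \<mu> x * h x)"

lemma mean_bound: "bdd_by h B \<Longrightarrow> \<bar>mean h\<bar> \<le> B"
  unfolding mean_def by (rule weighted_bound[OF mu_nonneg mu_has_sum])

lemma past_atom_eq: "past_atom M X xs = {\<omega> \<in> space M. hist (length xs) \<omega> = xs}"
  by (auto simp: past_atom_def hist_eq_iff hist_nth)

lemma past_atom_events [measurable]: "past_atom M X xs \<in> events"
  unfolding past_atom_eq by measurable

text \<open>The inner supremum of \<open>beta_coef\<close> for one atom: how far the law of the
  future moves when the atom is observed. For null atoms the quotient is 0, so the value stays in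
  [0, 1], and their weight is 0.\<close>

definition atom_dep :: "nat \<Rightarrow> 's list \<Rightarrow> real" where
  "atom_dep m xs = (SUP B\<in>future_sigma M X m.
     \<bar>prob (B \<inter> past_atom M X xs) / prob (past_atom M X xs) - prob B\<bar>)"

lemma dep_le_1: "\<bar>prob (B \<inter> past_atom M X xs) / prob (past_atom M X xs) - prob B\<bar> \<le> 1"
proof -
  have "prob (B \<inter> past_atom M X xs) \<le> prob (past_atom M X xs)"
    by (intro finite_measure_mono) auto
  then have "prob (B \<inter> past_atom M X xs) / prob (past_atom M X xs) \<le> 1"
    by (simp add: divide_le_eq_1 less_le)
  moreover have "0 \<le> prob (B \<inter> past_atom M X xs) / prob (past_atom M X xs)" by simp
  ultimately show ?thesis using prob_le_1[of B] measure_nonneg[of M B] by linarith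
qed

lemma atom_dep_upper:
  "B \<in> future_sigma M X m \<Longrightarrow>
    \<bar>prob (B \<inter> past_atom M X xs) / prob (past_atom M X xs) - prob B\<bar> \<le> atom_dep m xs"
  unfolding atom_dep_def by (rule cSUP_upper) (auto intro!: bdd_aboveI[of _ 1] dep_le_1)

lemma atom_dep_bounds: "0 \<le> atom_dep m xs" "atom_dep m xs \<le> 1"
proof -
  have "{} \<in> future_sigma M X m" by (simp add: future_sigma_def sigma_sets.Empty)
  from atom_dep_upper[OF this, of xs] show "0 \<le> atom_dep m xs" by simp
  show "atom_dep m xs \<le> 1" unfolding atom_dep_def
    using \<open>{} \<in> future_sigma M X m\<close> by (intro cSUP_least dep_le_1) auto
qed

lemma atoms_has_sum: "((\<lambda>xs. prob (past_atom M X xs)) has_sum 1) {xs. length xs = t}"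
proof -
  have "((\<lambda>xs. \<integral>\<omega>. (1::real) * of_bool (hist t \<omega> = xs) \<partial>M) has_sum (\<integral>\<omega>. 1 \<partial>M)) UNIV"
    by (rule integral_partition[of M "\<lambda>_. 1" "hist t"]) auto
  then have "((\<lambda>xs. prob {\<omega> \<in> space M. hist t \<omega> = xs}) has_sum 1) UNIV"
    by (simp add: expectation_of_bool prob_space)
  then show ?thesis
  proof (subst has_sum_cong_neutral[of UNIV])
    fix xs :: "'s list" assume "xs \<in> UNIV - {xs. length xs = t}"
    then have "{\<omega> \<in> space M. hist t \<omega> = xs} = {}" by auto
    then show "prob {\<omega> \<in> space M. hist t \<omega> = xs} = 0" by (simp only: measure_empty)
  qed (auto simp: past_atom_eq)
qed

text \<open>A supremum of reals dominates its members only if they are bounded above. Here each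
  member is an average of numbers in [0, 1], hence at most 1.\<close>

lemma beta_ge:
  assumes "1 \<le> t"
  shows "(\<Sum>\<^sub>\<infinity>xs\<in>{xs. length xs = t}. prob (past_atom M X xs) * atom_dep (t + i) xs) \<le> beta_coef M X i"
proof -
  have le1: "(\<Sum>\<^sub>\<infinity>xs\<in>{xs. length xs = t}. prob (past_atom M X xs) * atom_dep (t + i) xs) \<le> 1" for t
  proof -
    note hs = atoms_has_sum[of t]
    have s: "(\<lambda>xs. prob (past_atom M X xs) * atom_dep (t + i) xs) summable_on {xs. length xs = t}"
      by (rule summable_on_comparison_test[OF has_sum_imp_summable[OF hs]])
        (auto simp: atom_dep_bounds mult_left_le)
    show ?thesis
      by (rule has_sum_mono[OF has_sum_infsum[OF s] hs]) (auto simp: atom_dep_bounds mult_left_le)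
  qed
  show ?thesis
    unfolding beta_coef_def atom_dep_def[symmetric]
    by (rule cSUP_upper[of t]) (use assms le1 in \<open>auto intro!: bdd_aboveI[of _ 1]\<close>)
qed

text \<open>A Hahn decomposition. The left side is the integral of h against a signed measure v, so
  it is at most the total mass of |v|, which is v on its nonnegative set minus v on the complement.
  Each of the two is controlled by an event about the single state X_{1+a}; hence the factor
  2.\<close>

lemma dependence_bound:
  assumes h: "bdd_by h 1"
  shows "\<mu> x * \<bar>(Pop P ^^ a) h x - mean h\<bar> \<le> 2 * (\<mu> x * atom_dep (1 + a) [x])"
proof -
  let ?Z = "\<lambda>\<omega>. of_bool (X 1 \<omega> = x) - \<mu> x"
  have mu1: "\<mu> x \<le> 1" using prob_X[of 1 x] prob_le_1 by (metis order_refl)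
  have Z: "adapted 1 ?Z" by (rule adapted_comp[OF adapted_X, of 1 1 "\<lambda>z. of_bool (z = x) - \<mu> x"]) auto
  have ZB: "\<bar>?Z \<omega>\<bar> \<le> 1" for \<omega> using mu1 mu_nonneg[of x] by auto
  have at: "past_atom M X [x] = {\<omega> \<in> space M. X 1 \<omega> = x}" by (auto simp: past_atom_def)
  have patom: "prob (past_atom M X [x]) = \<mu> x" unfolding at by (rule prob_X) simp
  have int: "integrable M (\<lambda>\<omega>. ?Z \<omega> * k (X (1 + a) \<omega>))" if "bdd_by k 1" for k :: "'s \<Rightarrow> real"
  proof (rule bdd_integrable[of _ "1 * 1"])
    show "\<bar>?Z \<omega> * k (X (1 + a) \<omega>)\<bar> \<le> 1 * 1" for \<omega>
      unfolding abs_mult[of "?Z \<omega>"] using ZB[of \<omega>] bdd_byD[OF that, of "X (1 + a) \<omega>"] by (intro mult_mono) auto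
  qed measurable
  have val: "(\<integral>\<omega>. ?Z \<omega> * k (X (1 + a) \<omega>) \<partial>M) = \<mu> x * ((Pop P ^^ a) k x - mean k)" if k: "bdd_by k 1" for k
  proof -
    have i1: "integrable M (\<lambda>\<omega>. of_bool (X 1 \<omega> = x) * k (X (1 + a) \<omega>))"
      by (rule bdd_integrable[of _ 1]) (use bdd_byD[OF k] in \<open>auto simp: of_bool_def\<close>)
    have i2: "integrable M (\<lambda>\<omega>. k (X (1 + a) \<omega>))"
      by (rule bdd_integrable[of _ 1]) (use bdd_byD[OF k] in auto)
    have "(\<integral>\<omega>. of_bool (X 1 \<omega> = x) * k (X (1 + a) \<omega>) \<partial>M) = (\<integral>\<omega>. of_bool (X 1 \<omega> = x) * (Pop P ^^ a) k (X 1 \<omega>) \<partial>M)"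
      by (rule markov_steps[OF _ adapted_comp[OF adapted_X, of 1 1 "\<lambda>z. of_bool (z = x)"] _ k, of 1]) auto
    also have "\<dots> = (\<integral>\<omega>. (Pop P ^^ a) k x * of_bool (X 1 \<omega> = x) \<partial>M)"
      by (intro Bochner_Integration.integral_cong) auto
    also have "\<dots> = (Pop P ^^ a) k x * \<mu> x" using prob_X[of 1 x] by (simp add: expectation_of_bool)
    finally have "(\<integral>\<omega>. of_bool (X 1 \<omega> = x) * k (X (1 + a) \<omega>) \<partial>M) = (Pop P ^^ a) k x * \<mu> x" .
    moreover have "(\<integral>\<omega>. k (X (1 + a) \<omega>) \<partial>M) = mean k"
      unfolding mean_def by (rule expectation_stat[OF k]) simp
    ultimately show ?thesis using i1 i2 by (simp add: left_diff_distrib algebra_simps)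
  qed
  have ind: "\<bar>\<mu> x * ((Pop P ^^ a) (indicator S) x - mean (indicator S))\<bar> \<le> \<mu> x * atom_dep (1 + a) [x]" for S
  proof -
    let ?B = "X (1 + a) -` S \<inter> space M"
    have B: "?B \<in> future_sigma M X (1 + a)"
      unfolding future_sigma_def by (rule sigma_sets.Basic) auto
    have ib: "bdd_by (indicator S :: 's \<Rightarrow> real) 1" by (auto simp: bdd_by_def indicator_def)
    have BM [measurable]: "?B \<in> events" by measurable
    have "mean (indicator S) = prob ?B"
    proof -
      have "mean (indicator S) = (\<integral>\<omega>. indicator S (X (1 + a) \<omega>) \<partial>M)"
        unfolding mean_def by (rule expectation_stat[OF ib, symmetric]) simp
      also have "\<dots> = (\<integral>\<omega>. indicator ?B \<omega> \<partial>M)"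
        by (intro Bochner_Integration.integral_cong) (auto simp: indicator_def)
      finally show ?thesis by simp
    qed
    moreover have "\<mu> x * (Pop P ^^ a) (indicator S) x = prob (?B \<inter> past_atom M X [x])"
    proof -
      have "prob (?B \<inter> past_atom M X [x]) = (\<integral>\<omega>. indicator (?B \<inter> past_atom M X [x]) \<omega> \<partial>M)" by simp
      also have "\<dots> = (\<integral>\<omega>. of_bool (X 1 \<omega> = x) * indicator S (X (1 + a) \<omega>) \<partial>M)"
        unfolding at by (intro Bochner_Integration.integral_cong) (auto simp: indicator_def)
      also have "\<dots> = (\<integral>\<omega>. of_bool (X 1 \<omega> = x) * (Pop P ^^ a) (indicator S) (X 1 \<omega>) \<partial>M)"
        by (rule markov_steps[OF _ adapted_comp[OF adapted_X, of 1 1 "\<lambda>z. of_bool (z = x)"] _ ib, of 1]) auto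
      also have "\<dots> = (\<integral>\<omega>. (Pop P ^^ a) (indicator S) x * of_bool (X 1 \<omega> = x) \<partial>M)"
        by (intro Bochner_Integration.integral_cong) auto
      also have "\<dots> = \<mu> x * (Pop P ^^ a) (indicator S) x" using prob_X[of 1 x] by (simp add: expectation_of_bool)
      finally show ?thesis by simp
    qed
    moreover have "\<bar>prob (?B \<inter> past_atom M X [x]) - \<mu> x * prob ?B\<bar> \<le> \<mu> x * atom_dep (1 + a) [x]"
    \<comment> \<open>On a null atom the conditional probability is a quotient 0 / 0 and cannot be
      multiplied out; there both terms on the left vanish.\<close>
    proof (cases "\<mu> x = 0")
      case True
      have "prob (?B \<inter> past_atom M X [x]) \<le> prob (past_atom M X [x])"
        by (intro finite_measure_mono) auto
      then show ?thesis using True patom measure_nonneg[of M "?B \<inter> past_atom M X [x]"] by simp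
    next
      case False
      then have "prob (?B \<inter> past_atom M X [x]) - \<mu> x * prob ?B
          = \<mu> x * (prob (?B \<inter> past_atom M X [x]) / prob (past_atom M X [x]) - prob ?B)"
        unfolding patom by (simp add: right_diff_distrib)
      then have "\<bar>prob (?B \<inter> past_atom M X [x]) - \<mu> x * prob ?B\<bar>
        = \<mu> x * \<bar>prob (?B \<inter> past_atom M X [x]) / prob (past_atom M X [x]) - prob ?B\<bar>"
        using mu_nonneg[of x] by (simp only: abs_mult abs_of_nonneg)
      then show ?thesis using mult_left_mono[OF atom_dep_upper[OF B, of "[x]"] mu_nonneg[of x]] by simp
    qed
    ultimately show ?thesis by (simp add: right_diff_distrib)
  qed
  \<comment> \<open>The covariance of the events X_1 = x and X_{1+a} = y, as a function of
    y.\<close>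
  define v where "v y = (\<integral>\<omega>. ?Z \<omega> * of_bool (X (1 + a) \<omega> = y) \<partial>M)" for y
  have hs: "((\<lambda>y. v y * k y) has_sum (\<mu> x * ((Pop P ^^ a) k x - mean k))) UNIV" if k: "bdd_by k 1" for k
  proof -
    have "(\<integral>\<omega>. ?Z \<omega> * k (X (1 + a) \<omega>) * of_bool (X (1 + a) \<omega> = y) \<partial>M) = v y * k y" for y
    proof -
      have "(\<integral>\<omega>. ?Z \<omega> * k (X (1 + a) \<omega>) * of_bool (X (1 + a) \<omega> = y) \<partial>M)
        = (\<integral>\<omega>. (?Z \<omega> * of_bool (X (1 + a) \<omega> = y)) * k y \<partial>M)"
        by (intro Bochner_Integration.integral_cong) auto
      then show ?thesis by (simp add: v_def)
    qed
    then show ?thesis using integral_partition[OF int[OF k] X_measurable[of "1 + a"]] val[OF k] by simp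
  qed
  define S where "S = {y. 0 \<le> v y}"
  have "\<bar>\<mu> x * ((Pop P ^^ a) h x - mean h)\<bar> \<le>
     \<mu> x * ((Pop P ^^ a) (indicator S) x - mean (indicator S)) - \<mu> x * ((Pop P ^^ a) (indicator (-S)) x - mean (indicator (-S)))"
    (is "_ \<le> ?R")
  proof -
    have hS: "((\<lambda>y. v y * indicator S y - v y * indicator (- S) y) has_sum ?R) UNIV"
      using has_sum_add[OF hs[of "indicator S"] has_sum_uminusI[OF hs[of "indicator (- S)"]]]
      by (simp add: bdd_by_def indicator_def)
    have abs: "v y * indicator S y - v y * indicator (- S) y = \<bar>v y\<bar>" for y
      by (auto simp: S_def indicator_def)
    have "\<bar>v y * h y\<bar> \<le> \<bar>v y\<bar>" for y using bdd_byD[OF h, of y] by (simp add: abs_mult mult_left_le)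
    then have "v y * h y \<le> \<bar>v y\<bar>" "- (v y * h y) \<le> \<bar>v y\<bar>" for y by (smt (verit))+
    then show ?thesis
      using has_sum_mono[OF hs[OF h] hS] has_sum_mono[OF has_sum_uminusI[OF hs[OF h]] hS] unfolding abs
      by (simp add: abs_le_iff)
  qed
  then have "\<bar>\<mu> x * ((Pop P ^^ a) h x - mean h)\<bar> \<le> 2 * (\<mu> x * atom_dep (1 + a) [x])"
    using ind[of S] ind[of "- S"] by linarith
  then show ?thesis using mu_nonneg[of x] by (simp only: abs_mult abs_of_nonneg)
qed

text \<open>By stationarity the law of X_n is \<mu>, so summing the preceding bound over x yields
  twice the member t = 1 of the supremum in \<open>beta_coef\<close>; lists of length 1 stand for
  states.\<close>

lemma expected_dependence:
  assumes h: "bdd_by h 1" and n: "1 \<le> n"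
  shows "(\<integral>\<omega>. \<bar>(Pop P ^^ a) h (X n \<omega>) - mean h\<bar> \<partial>M) \<le> 2 * beta_coef M X a"
proof -
  let ?k = "\<lambda>x. \<bar>(Pop P ^^ a) h x - mean h\<bar>"
  have kb: "bdd_by ?k 2"
    unfolding bdd_by_def
  proof
    fix x show "\<bar>?k x\<bar> \<le> 2" using bdd_byD[OF Pop_pow_bdd[OF stoch h], of a x] mean_bound[OF h] by linarith
  qed
  have sk: "(\<lambda>x. \<mu> x * ?k x) summable_on UNIV"
    by (rule weighted_summable[OF mu_nonneg mu_summable kb])
  have sd: "(\<lambda>x. \<mu> x * atom_dep (1 + a) [x]) summable_on UNIV"
    by (rule weighted_summable[OF mu_nonneg mu_summable, of _ 1]) (auto simp: bdd_by_def atom_dep_bounds)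
  have "(\<integral>\<omega>. ?k (X n \<omega>) \<partial>M) = (\<Sum>\<^sub>\<infinity>x. \<mu> x * ?k x)" by (rule expectation_stat[OF kb n])
  also have "\<dots> \<le> (\<Sum>\<^sub>\<infinity>x. 2 * (\<mu> x * atom_dep (1 + a) [x]))"
    by (rule infsum_mono[OF sk summable_on_cmult_right[OF sd] dependence_bound[OF h]])
  also have "\<dots> = 2 * (\<Sum>\<^sub>\<infinity>x. \<mu> x * atom_dep (1 + a) [x])" by (rule infsum_cmult_right')
  also have "(\<Sum>\<^sub>\<infinity>x. \<mu> x * atom_dep (1 + a) [x])
      = (\<Sum>\<^sub>\<infinity>xs\<in>{xs. length xs = 1}. prob (past_atom M X xs) * atom_dep (1 + a) xs)"
  proof (rule infsum_reindex_bij_witness[of _ hd "\<lambda>x. [x]"])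
    fix x :: 's
    have "past_atom M X [x] = {\<omega> \<in> space M. X 1 \<omega> = x}" by (auto simp: past_atom_def)
    then show "prob (past_atom M X [x]) * atom_dep (1 + a) [x] = \<mu> x * atom_dep (1 + a) [x]"
      using prob_X[of 1 x] by simp
  qed (auto simp: length_Suc_conv)
  also have "\<dots> \<le> beta_coef M X a" by (rule beta_ge) simp
  finally show ?thesis by simp
qed

lemma sum_residues:
  fixes g :: "nat \<Rightarrow> real"
  shows "(\<Sum>n=1..K * a. g n) = (\<Sum>s<a. \<Sum>k<K. g (Suc s + k * a))"
proof -
  have "(\<Sum>n=1..K * a. g n) = (\<Sum>n<K * a. g (Suc n))"
    using sum.shift_bounds_cl_Suc_ivl by (simp add: sum.atLeast1_atMost_eq)
  also have "\<dots> = (\<Sum>k<K. \<Sum>j\<in>{k * a..<k * a + a}. g (Suc j))"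
    by (rule sum.nat_group[symmetric])
  also have "\<dots> = (\<Sum>k<K. \<Sum>s<a. g (Suc s + k * a))"
  proof (rule sum.cong[OF refl])
    fix k
    show "(\<Sum>j\<in>{k * a..<k * a + a}. g (Suc j)) = (\<Sum>s<a. g (Suc s + k * a))"
      by (rule sum.reindex_bij_witness[of _ "\<lambda>s. s + k * a" "\<lambda>j. j - k * a"]) auto
  qed
  also have "\<dots> = (\<Sum>s<a. \<Sum>k<K. g (Suc s + k * a))" by (rule sum.swap)
  finally show ?thesis .
qed

text \<open>For i > a the summand is the a-step increment started at i - a plus the drift
  \<open>P^a h - mean h\<close> at that time. In the threshold, each of the a residue classes
  contributes \<tau>, each of the first a summands 2, and the accumulated drift 1.\<close>

lemma additive_tail:
  assumes h: "bdd_by h 1" and a: "1 \<le> a" "a \<le> N" and \<tau>: "0 \<le> \<tau>"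
  shows "prob {\<omega> \<in> space M. real a * \<tau> + 2 * real a + 1 \<le> \<bar>\<Sum>i=1..N. h (X i \<omega>) - mean h\<bar>}
    \<le> 2 * real a * exp (- \<tau>\<^sup>2 / (8 * real (N div a + 1))) + 2 * real N * beta_coef M X a"
    (is "prob ?E \<le> _")
proof -
  define K where "K = N div a + 1"
  \<comment> \<open>The residue classes are padded to a common length K, so the grid may run past N
    - a. These deterministic 0/1 weights remove the excess and are trivially adapted.\<close>
  define c :: "nat \<Rightarrow> nat \<Rightarrow> 'a \<Rightarrow> real" where "c s k \<omega> = of_bool (Suc s + k * a \<le> N - a)" for s k \<omega>
  let ?S = "\<lambda>s \<omega>. \<Sum>k<K. c s k \<omega> * incr a h (Suc s + k * a) \<omega>"
  let ?k = "\<lambda>x. \<bar>(Pop P ^^ a) h x - mean h\<bar>"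
  let ?T = "\<lambda>\<omega>. \<Sum>n=1..N-a. ?k (X n \<omega>)"
  have kb: "\<bar>?k x\<bar> \<le> 2" for x
    using bdd_byD[OF Pop_pow_bdd[OF stoch h], of a x] mean_bound[OF h] by linarith
  have [measurable]: "incr a h n \<in> borel_measurable M" for n unfolding incr_def by measurable
  have [measurable]: "c s k \<in> borel_measurable M" for s k unfolding c_def by measurable
  have KN: "N - a \<le> K * a"
    using dividend_less_div_times[of a N] a by (simp add: K_def)
  have split: "(\<Sum>i=1..N. h (X i \<omega>) - mean h) = (\<Sum>i=1..a. h (X i \<omega>) - mean h)
      + (\<Sum>s<a. ?S s \<omega>) + (\<Sum>n=1..N-a. (Pop P ^^ a) h (X n \<omega>) - mean h)" for \<omega>
  proof -
    have "(\<Sum>i=1..N. h (X i \<omega>) - mean h) = (\<Sum>i=1..a. h (X i \<omega>) - mean h) + (\<Sum>i=a+1..N. h (X i \<omega>) - mean h)"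
      using sum.ub_add_nat[of 1 a "\<lambda>i. h (X i \<omega>) - mean h" "N - a"] a by simp
    also have "(\<Sum>i=a+1..N. h (X i \<omega>) - mean h) = (\<Sum>n=1..N-a. h (X (n + a) \<omega>) - mean h)"
      by (rule sum.reindex_bij_witness[of _ "\<lambda>n. n + a" "\<lambda>i. i - a"]) (use a in auto)
    also have "\<dots> = (\<Sum>n=1..N-a. incr a h n \<omega>) + (\<Sum>n=1..N-a. (Pop P ^^ a) h (X n \<omega>) - mean h)"
      by (simp add: incr_def flip: sum.distrib)
    also have "(\<Sum>n=1..N-a. incr a h n \<omega>) = (\<Sum>n=1..K * a. of_bool (n \<le> N - a) * incr a h n \<omega>)"
      using KN by (intro sum.mono_neutral_cong_left) auto
    also have "\<dots> = (\<Sum>s<a. ?S s \<omega>)" unfolding c_def by (rule sum_residues)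
    finally show ?thesis by (simp add: add_ac)
  qed
  have sub: "?E \<subseteq> (\<Union>s<a. {\<omega> \<in> space M. \<tau> \<le> \<bar>?S s \<omega>\<bar>}) \<union> {\<omega> \<in> space M. 1 \<le> ?T \<omega>}"
  proof (rule subsetI, rule ccontr)
    fix \<omega> assume E: "\<omega> \<in> ?E" and n: "\<omega> \<notin> (\<Union>s<a. {\<omega> \<in> space M. \<tau> \<le> \<bar>?S s \<omega>\<bar>}) \<union> {\<omega> \<in> space M. 1 \<le> ?T \<omega>}"
    then have S: "\<bar>?S s \<omega>\<bar> \<le> \<tau>" if "s < a" for s using that by force
    have T: "?T \<omega> < 1" using E n by auto
    have "\<bar>\<Sum>i=1..a. h (X i \<omega>) - mean h\<bar> \<le> (\<Sum>i=1..a. 2)"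
    proof (rule order_trans[OF sum_abs], rule sum_mono)
      show "\<bar>h (X i \<omega>) - mean h\<bar> \<le> 2" for i using bdd_byD[OF h, of "X i \<omega>"] mean_bound[OF h] by linarith
    qed
    moreover have "\<bar>\<Sum>s<a. ?S s \<omega>\<bar> \<le> (\<Sum>s<a. \<tau>)"
      by (rule order_trans[OF sum_abs], rule sum_mono) (use S in auto)
    moreover have "\<bar>\<Sum>n=1..N-a. (Pop P ^^ a) h (X n \<omega>) - mean h\<bar> \<le> ?T \<omega>" by (rule sum_abs)
    moreover have "(\<Sum>i=1..a. 2) = 2 * real a" "(\<Sum>s<a. \<tau>) = real a * \<tau>" by simp_all
    ultimately have "\<bar>\<Sum>i=1..N. h (X i \<omega>) - mean h\<bar> < real a * \<tau> + 2 * real a + 1"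
      unfolding split using T by linarith
    then show False using E by simp
  qed
  have tail: "prob {\<omega> \<in> space M. \<tau> \<le> \<bar>?S s \<omega>\<bar>} \<le> 2 * exp (- \<tau>\<^sup>2 / (8 * real K))" for s
    by (rule tail_two_sided[OF _ _ _ h \<tau>]) (auto simp: K_def c_def intro: adapted_const)
  have intk: "integrable M (\<lambda>\<omega>. ?k (X n \<omega>))" for n
    by (rule bdd_integrable[of _ 2]) (use kb in auto)
  \<comment> \<open>Markov's inequality at level 1 suffices: the expected total drift is already
    exponentially small in the lag, so no exponential moment is needed.\<close>
  have "prob {\<omega> \<in> space M. 1 \<le> ?T \<omega>} \<le> (\<integral>\<omega>. ?T \<omega> \<partial>M) / 1"
    by (rule integral_Markov_inequality_measure[where A = "{}"]) (use intk in \<open>auto intro!: sum_nonneg\<close>)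
  also have "(\<integral>\<omega>. ?T \<omega> \<partial>M) = (\<Sum>n=1..N-a. \<integral>\<omega>. ?k (X n \<omega>) \<partial>M)"
    by (intro Bochner_Integration.integral_sum intk)
  also have "\<dots> \<le> (\<Sum>n=1..N-a. 2 * beta_coef M X a)"
    by (intro sum_mono expected_dependence h) auto
  also have "\<dots> \<le> 2 * real N * beta_coef M X a"
  proof -
    have "0 \<le> 2 * beta_coef M X a"
      by (rule order_trans[OF _ expected_dependence[OF h order_refl]]) simp
    then show ?thesis using mult_right_mono[of "real (N - a)" "real N" "2 * beta_coef M X a"] by simp
  qed
  finally have T: "prob {\<omega> \<in> space M. 1 \<le> ?T \<omega>} \<le> 2 * real N * beta_coef M X a" by simp
  have "prob ?E \<le> prob ((\<Union>s<a. {\<omega> \<in> space M. \<tau> \<le> \<bar>?S s \<omega>\<bar>}) \<union> {\<omega> \<in> space M. 1 \<le> ?T \<omega>})"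
    by (rule finite_measure_mono[OF sub]) measurable
  also have "\<dots> \<le> prob (\<Union>s<a. {\<omega> \<in> space M. \<tau> \<le> \<bar>?S s \<omega>\<bar>}) + prob {\<omega> \<in> space M. 1 \<le> ?T \<omega>}"
    by (rule measure_Un_le) measurable
  also have "prob (\<Union>s<a. {\<omega> \<in> space M. \<tau> \<le> \<bar>?S s \<omega>\<bar>}) \<le> (\<Sum>s<a. prob {\<omega> \<in> space M. \<tau> \<le> \<bar>?S s \<omega>\<bar>})"
    by (rule measure_UNION_le) auto
  also have "\<dots> \<le> (\<Sum>s<a. 2 * exp (- \<tau>\<^sup>2 / (8 * real K)))" by (intro sum_mono tail)
  finally show ?thesis using T by (simp add: K_def)
qed

end

section \<open>Sums with eligibility traces\<close>

context stationary_chain begin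

definition etrace :: "real \<Rightarrow> ('s \<Rightarrow> real) \<Rightarrow> nat \<Rightarrow> 'a \<Rightarrow> real" where
  "etrace c f i \<omega> = (\<Sum>k=1..i. c ^ (i - k) * f (X k \<omega>))"

lemma trace_Suc: "etrace c f (Suc i) \<omega> = c * etrace c f i \<omega> + f (X (Suc i) \<omega>)"
proof -
  have "(\<Sum>k=1..i. c ^ (Suc i - k) * f (X k \<omega>)) = (\<Sum>k=1..i. c * (c ^ (i - k) * f (X k \<omega>)))"
    by (intro sum.cong refl) (simp add: Suc_diff_le)
  then show ?thesis by (simp add: etrace_def sum_distrib_left)
qed

lemma trace_0: "etrace c f 0 \<omega> = 0"
  by (simp add: etrace_def)

lemma trace_cmult: "etrace c (\<lambda>x. F * f x) i \<omega> = F * etrace c f i \<omega>"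
  by (simp add: etrace_def sum_distrib_left mult_ac)

text \<open>\<open>(1 - c) z_{i+1}\<close> is the convex combination of \<open>(1 - c) z_i\<close>
  and f(X_{i+1}) with weights c and 1 - c. The bound is uniform in i.\<close>

lemma trace_bound:
  assumes "bdd_by f F" "0 \<le> c" "c < 1"
  shows "\<bar>(1 - c) * etrace c f i \<omega>\<bar> \<le> F"
proof (induction i)
  case 0 then show ?case using bdd_by_nonneg[OF assms(1)] by (simp add: trace_0)
next
  case (Suc i)
  have "\<bar>(1 - c) * etrace c f (Suc i) \<omega>\<bar> = \<bar>c * ((1 - c) * etrace c f i \<omega>) + (1 - c) * f (X (Suc i) \<omega>)\<bar>"
    by (simp add: trace_Suc algebra_simps)
  also have "\<dots> \<le> c * \<bar>(1 - c) * etrace c f i \<omega>\<bar> + (1 - c) * \<bar>f (X (Suc i) \<omega>)\<bar>"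
    using assms(2,3) by (intro order_trans[OF abs_triangle_ineq]) (simp add: abs_mult)
  also have "\<dots> \<le> c * F + (1 - c) * F"
    using Suc.IH bdd_byD[OF assms(1), of "X (Suc i) \<omega>"] assms(2,3) by (intro add_mono mult_left_mono) auto
  finally show ?case by (simp add: algebra_simps)
qed

lemma trace_adapted: "adapted i (etrace c f i)"
  unfolding etrace_def
proof (rule adapted_sum)
  fix k assume "k \<in> {1..i}"
  then have "adapted i (X k)" by (intro adapted_X) auto
  from adapted_comp[OF this, of "\<lambda>x. c ^ (i - k) * f x"]
  show "adapted i (\<lambda>\<omega>. c ^ (i - k) * f (X k \<omega>))" .
qed

text \<open>In the induction step f(X_{N+1}) = z_{N+1} - c z_N cancels the old boundary term. All
  that remains carries the factor z_{N+1} and is a linear identity in w and P w at two consecutive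
  states.\<close>

lemma trace_decomposition:
  fixes u w f :: "'s \<Rightarrow> real" and c g :: real
  assumes u: "\<And>x. u x = w x - c * Pop P w x"
  defines "G \<equiv> \<lambda>x. w x - g * Pop P w x"
  shows "(\<Sum>i=1..N. etrace c f i \<omega> * (u (X i \<omega>) - g * u (X (Suc i) \<omega>)))
    = (\<Sum>i=1..N. f (X i \<omega>) * G (X i \<omega>)) - c * etrace c f N \<omega> * G (X (Suc N) \<omega>)
      - (g - c) * (\<Sum>i=1..N. etrace c f i \<omega> * (w (X (Suc i) \<omega>) - Pop P w (X i \<omega>)))"
proof (induction N)
  case 0 then show ?case by (simp add: trace_0)
next
  case (Suc N)
  let ?z = "etrace c f (Suc N) \<omega>"
  have f: "f (X (Suc N) \<omega>) = ?z - c * etrace c f N \<omega>" by (simp add: trace_Suc)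
  show ?case
    using Suc.IH by (simp add: f u G_def algebra_simps)
qed

text \<open>Origin of the threshold: the additive functional, with summands of size at most F U D,
  contributes a \<tau> + 2 a + 1, the boundary term 1 and the martingale \<tau>'. The factor 1 - c
  on the deviation normalizes the trace; the second factor 1 / (1 - c) of the martingale part, from
  the size of w, is absorbed together with |g - c| into D.\<close>

lemma trace_tail:
  fixes u f :: "'s \<Rightarrow> real" and c g F U \<tau> \<tau>' :: real
  assumes f: "bdd_by f F" and u: "bdd_by u U" and c: "0 \<le> c" "c < 1"
    and a: "1 \<le> a" "a \<le> N" and \<tau>: "0 \<le> \<tau>" "0 \<le> \<tau>'"
  defines "w \<equiv> resolvent P c u"
  defines "m \<equiv> mean (\<lambda>x. f x * (w x - g * Pop P w x))"
  defines "D \<equiv> 1 + \<bar>g - c\<bar> / (1 - c)"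
  shows "prob {\<omega> \<in> space M. F * U * D * (real a * \<tau> + 2 * real a + 2 + \<tau>')
      < (1 - c) * \<bar>(\<Sum>i=1..N. etrace c f i \<omega> * (u (X i \<omega>) - g * u (X (Suc i) \<omega>))) - real N * m\<bar>}
    \<le> 2 * real a * exp (- \<tau>\<^sup>2 / (8 * real (N div a + 1))) + 2 * real N * beta_coef M X a
      + 2 * exp (- \<tau>'\<^sup>2 / (8 * real N))" (is "prob ?E \<le> _")
proof -
  define G where "G = (\<lambda>x. w x - g * Pop P w x)"
  have D: "1 \<le> D" "\<bar>g - c\<bar> / (1 - c) \<le> D" using c by (simp_all add: D_def)
  have F0: "0 \<le> F" "0 \<le> U" using f u by (auto intro: bdd_by_nonneg)
  have ueq: "u x = w x - c * Pop P w x" for x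
    using resolvent_eq[OF stoch u c, of x] by (simp add: w_def)
  have wb: "bdd_by w (U / (1 - c))" unfolding w_def by (rule resolvent_bdd[OF stoch u c])
  \<comment> \<open>Writing G as u + (c - g) P w keeps its bound at 2 U when c \<le> g \<le> 1.
    Bounding w and g P w separately would lose a factor of order 1 / (1 - c).\<close>
  have "bdd_by (\<lambda>x. u x + (c - g) * Pop P w x) (U + \<bar>c - g\<bar> * (U / (1 - c)))"
    by (intro bdd_by_add u bdd_by_cmult Pop_bdd[OF stoch wb])
  then have Gb: "bdd_by G (U * D)"
    unfolding G_def ueq D_def by (simp add: algebra_simps abs_minus_commute)
  obtain h where h: "bdd_by h 1" "\<And>x. f x * G x = F * (U * D) * h x"
    using bdd_by_normalize[OF bdd_by_mult[OF f Gb]] by blast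
  obtain v where v: "bdd_by v 1" "\<And>x. w x = U / (1 - c) * v x"
    using bdd_by_normalize[OF wb] by blast
  obtain e where e: "bdd_by e 1" "\<And>x. f x = F * e x"
    using bdd_by_normalize[OF f] by blast
  \<comment> \<open>The trace at time k + 1, scaled to size 1, is the predictable weight of the
    one-step increment from time k + 1; the martingale has stride 1 here.\<close>
  define b where "b k \<omega> = (1 - c) * etrace c e (1 + k) \<omega>" for k \<omega>
  have bad: "adapted (1 + k * 1) (b k)" for k
    unfolding b_def using adapted_comp[OF trace_adapted[of "1 + k" c e], of "\<lambda>z. (1 - c) * z"] by simp
  have b1: "\<bar>b k \<omega>\<bar> \<le> 1" for k \<omega>
    unfolding b_def by (rule trace_bound[OF e(1) c])
  let ?A = "{\<omega> \<in> space M. real a * \<tau> + 2 * real a + 1 \<le> \<bar>\<Sum>i=1..N. h (X i \<omega>) - mean h\<bar>}"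
  let ?B = "{\<omega> \<in> space M. \<tau>' \<le> \<bar>\<Sum>k<N. b k \<omega> * incr 1 v (1 + k * 1) \<omega>\<bar>}"
  have [measurable]: "b k \<in> borel_measurable M" for k using bad by (rule adapted_borel)
  have [measurable]: "incr a' v n \<in> borel_measurable M" for a' n unfolding incr_def by measurable
  have m: "m = F * U * D * mean h"
    using infsum_cmult_right'[of "F * (U * D)" "\<lambda>x. \<mu> x * h x" UNIV] h(2)
    by (simp add: m_def mean_def mult_ac flip: G_def[THEN fun_cong])
  have sub: "?E \<subseteq> ?A \<union> ?B"
  proof (rule subsetI, rule ccontr)
    fix \<omega> assume E: "\<omega> \<in> ?E" and n: "\<omega> \<notin> ?A \<union> ?B"
    let ?H = "\<Sum>i=1..N. h (X i \<omega>) - mean h"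
    let ?I = "\<Sum>k<N. b k \<omega> * incr 1 v (1 + k * 1) \<omega>"
    have A: "\<bar>?H\<bar> \<le> real a * \<tau> + 2 * real a + 1" and B: "\<bar>?I\<bar> \<le> \<tau>'"
      using E n by auto
    have t1: "(\<Sum>i=1..N. f (X i \<omega>) * G (X i \<omega>)) - real N * m = F * U * D * ?H"
    proof -
      have "f x * G x = F * U * D * h x" for x using h(2)[of x] by (simp add: mult.assoc)
      then have "(\<Sum>i=1..N. f (X i \<omega>) * G (X i \<omega>)) = F * U * D * (\<Sum>i=1..N. h (X i \<omega>))"
        by (simp add: sum_distrib_left)
      then show ?thesis by (simp add: m sum_subtractf right_diff_distrib)
    qed
    have t3: "(1 - c) * ((1 - c) * (\<Sum>i=1..N. etrace c f i \<omega> * (w (X (Suc i) \<omega>) - Pop P w (X i \<omega>)))) = F * U * ?I"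
    proof -
      have "(\<Sum>i=1..N. etrace c f i \<omega> * (w (X (Suc i) \<omega>) - Pop P w (X i \<omega>)))
          = (\<Sum>k<N. etrace c f (Suc k) \<omega> * (w (X (Suc (Suc k)) \<omega>) - Pop P w (X (Suc k) \<omega>)))"
        by (simp add: sum.atLeast1_atMost_eq)
      moreover have "(1 - c) * ((1 - c) * (etrace c f (Suc k) \<omega> * (w (X (Suc (Suc k)) \<omega>) - Pop P w (X (Suc k) \<omega>))))
          = F * U * (b k \<omega> * incr 1 v (1 + k * 1) \<omega>)" for k
      proof -
        have fe: "f = (\<lambda>x. F * e x)" and wv: "w = (\<lambda>x. U / (1 - c) * v x)" using e(2) v(2) by auto
        have tr: "etrace c f (Suc k) \<omega> = F * etrace c e (Suc k) \<omega>" by (simp only: fe trace_cmult)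
        have w1: "(1 - c) * w x = U * v x" for x using v(2)[of x] c by simp
        have "Pop P w x = U / (1 - c) * Pop P v x" for x by (simp only: wv Pop_cmult)
        then have p1: "(1 - c) * Pop P w x = U * Pop P v x" for x using c by simp
        have "(1 - c) * ((1 - c) * (etrace c f (Suc k) \<omega> * (w (X (Suc (Suc k)) \<omega>) - Pop P w (X (Suc k) \<omega>))))
          = ((1 - c) * etrace c f (Suc k) \<omega>) * ((1 - c) * w (X (Suc (Suc k)) \<omega>) - (1 - c) * Pop P w (X (Suc k) \<omega>))"
          by (simp add: algebra_simps)
        also have "\<dots> = ((1 - c) * (F * etrace c e (Suc k) \<omega>)) * (U * v (X (Suc (Suc k)) \<omega>) - U * Pop P v (X (Suc k) \<omega>))"
          by (simp only: tr w1 p1)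
        also have "\<dots> = F * U * (b k \<omega> * incr 1 v (1 + k * 1) \<omega>)"
          by (simp add: b_def incr_def algebra_simps)
        finally show ?thesis .
      qed
      ultimately show ?thesis by (simp only: sum_distrib_left)
    qed
    let ?S = "\<Sum>i=1..N. etrace c f i \<omega> * (u (X i \<omega>) - g * u (X (Suc i) \<omega>))"
    have S: "?S = (\<Sum>i=1..N. f (X i \<omega>) * G (X i \<omega>)) - c * etrace c f N \<omega> * G (X (Suc N) \<omega>)
      - (g - c) * (\<Sum>i=1..N. etrace c f i \<omega> * (w (X (Suc i) \<omega>) - Pop P w (X i \<omega>)))"
      unfolding G_def by (rule trace_decomposition[OF ueq])
    have "(1 - c) * (?S - real N * m) = (1 - c) * (F * U * D * ?H)
        - c * ((1 - c) * etrace c f N \<omega>) * G (X (Suc N) \<omega>) - (g - c) / (1 - c) * (F * U * ?I)"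
      unfolding S t1[symmetric] t3[symmetric] using c by (simp add: field_simps)
    moreover have "\<bar>(1 - c) * (F * U * D * ?H)\<bar> \<le> F * U * D * (real a * \<tau> + 2 * real a + 1)"
    proof -
      have "\<bar>(1 - c) * (F * U * D * ?H)\<bar> \<le> \<bar>F * U * D * ?H\<bar>" using c by (simp add: abs_mult mult_left_le_one_le)
      also have "\<dots> = F * U * D * \<bar>?H\<bar>" using F0 D by (simp add: abs_mult)
      also have "\<dots> \<le> F * U * D * (real a * \<tau> + 2 * real a + 1)" using A F0 D by (intro mult_left_mono) auto
      finally show ?thesis .
    qed
    moreover have "\<bar>c * ((1 - c) * etrace c f N \<omega>) * G (X (Suc N) \<omega>)\<bar> \<le> 1 * F * (U * D)"
      unfolding abs_mult[of _ "G _"] abs_mult[of c]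
      using trace_bound[OF f c, of N \<omega>] bdd_byD[OF Gb, of "X (Suc N) \<omega>"] c F0 by (intro mult_mono) auto
    moreover have "\<bar>(g - c) / (1 - c) * (F * U * ?I)\<bar> \<le> D * (F * U * \<tau>')"
    proof -
      have "\<bar>(g - c) / (1 - c) * (F * U * ?I)\<bar> = \<bar>g - c\<bar> / (1 - c) * (F * U * \<bar>?I\<bar>)"
        using c F0 by (simp add: abs_mult)
      also have "\<dots> \<le> D * (F * U * \<tau>')"
        using D(2) B F0 D(1) by (intro mult_mono mult_left_mono) auto
      finally show ?thesis .
    qed
    moreover have "p = x - y - z \<Longrightarrow> \<bar>x\<bar> \<le> x' \<Longrightarrow> \<bar>y\<bar> \<le> y' \<Longrightarrow> \<bar>z\<bar> \<le> z' \<Longrightarrow> \<bar>p\<bar> \<le> x' + y' + z'"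
      for p x y z x' y' z' :: real by linarith
    ultimately have "\<bar>(1 - c) * (?S - real N * m)\<bar> \<le> F * U * D * (real a * \<tau> + 2 * real a + 1) + 1 * F * (U * D) + D * (F * U * \<tau>')"
      by blast
    also have "\<dots> = F * U * D * (real a * \<tau> + 2 * real a + 2 + \<tau>')" by (simp add: algebra_simps)
    finally show False using E c by (simp add: abs_mult)
  qed
  have "prob ?E \<le> prob (?A \<union> ?B)"
    by (rule finite_measure_mono[OF sub]) measurable
  also have "\<dots> \<le> prob ?A + prob ?B" by (rule measure_Un_le) measurable
  also have "prob ?A \<le> 2 * real a * exp (- \<tau>\<^sup>2 / (8 * real (N div a + 1))) + 2 * real N * beta_coef M X a"
    by (rule additive_tail[OF h(1) a \<tau>(1)])
  also have "prob ?B \<le> 2 * exp (- \<tau>'\<^sup>2 / (8 * real N))"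
    by (rule tail_two_sided[OF _ bad b1 v(1) \<tau>(2)]) (use a in auto)
  finally show ?thesis by simp
qed

end

section \<open>Coercive matrices\<close>

lemma symmetric_inner:
  fixes G :: "real ^ 'd ^ 'd"
  assumes "transpose G = G"
  shows "x \<bullet> (G *v y) = (G *v x) \<bullet> y"
  by (metis assms dot_lmul_matrix transpose_matrix_vector)

text \<open>Eigenvectors of distinct eigenvalues of a symmetric matrix are orthogonal, hence
  independent. Finiteness gives the \<open>Min\<close> in \<open>min_eigenvalue\<close> its
  meaning.\<close>

lemma finite_eigenvalues:
  fixes G :: "real ^ 'd ^ 'd"
  assumes "transpose G = G"
  shows "finite {e. is_eigenvalue G e}"
proof -
  obtain v where v: "\<And>e. is_eigenvalue G e \<Longrightarrow> v e \<noteq> 0 \<and> G *v v e = e *\<^sub>R v e"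
  proof -
    have "\<forall>e. \<exists>v. is_eigenvalue G e \<longrightarrow> v \<noteq> 0 \<and> G *v v = e *\<^sub>R v"
      by (auto simp: is_eigenvalue_def scalar_mult_eq_scaleR)
    then show thesis using that by metis
  qed
  let ?E = "{e. is_eigenvalue G e}"
  have orth: "v e \<bullet> v e' = 0" if "e \<in> ?E" "e' \<in> ?E" "e \<noteq> e'" for e e'
  proof -
    have "e' * (v e \<bullet> v e') = e * (v e \<bullet> v e')"
      using symmetric_inner[OF assms, of "v e" "v e'"] v that by simp
    then show ?thesis using that(3) by simp
  qed
  have inj: "inj_on v ?E"
  proof (rule inj_onI, rule ccontr)
    fix e e' assume "e \<in> ?E" "e' \<in> ?E" "v e = v e'" "e \<noteq> e'"
    then show False using orth[of e e'] v[of e] by auto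
  qed
  have "pairwise orthogonal (v ` ?E)"
    by (auto simp: pairwise_def orthogonal_def intro!: orth)
  moreover have "0 \<notin> v ` ?E" using v by force
  ultimately have "independent (v ` ?E)" by (rule pairwise_orthogonal_independent)
  then have "finite (v ` ?E)" by (rule independent_imp_finite)
  then show ?thesis using inj finite_imageD by blast
qed

text \<open>If \<open>v\<close> minimizes the Rayleigh quotient with value \<open>m\<close>, varying \<open>v\<close> in the direction
  \<open>p = G v - m v\<close> shows \<open>p = 0\<close>; hence the Min over eigenvalues is taken over a nonempty set
  and is at most \<open>m\<close>.\<close>

lemma min_eigenvalue_rayleigh:
  fixes G :: "real ^ 'd ^ 'd"
  assumes sym: "transpose G = G"
  shows "is_eigenvalue G (min_eigenvalue G)"
    and "min_eigenvalue G * (x \<bullet> x) \<le> x \<bullet> (G *v x)"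
proof -
  let ?q = "\<lambda>x. x \<bullet> (G *v x)"
  have "continuous_on (sphere 0 1) ?q"
    by (intro continuous_intros matrix_vector_mult_linear_continuous_on)
  then obtain v where v: "v \<in> sphere 0 1" "\<And>y. y \<in> sphere 0 1 \<Longrightarrow> ?q v \<le> ?q y"
    using continuous_attains_inf[OF compact_sphere, of 0 1 ?q] by (auto simp: sphere_eq_empty)
  define m where "m = ?q v"
  have nv: "v \<bullet> v = 1" using v(1) by (simp add: norm_eq_1 flip: norm_eq_1)
  have m: "m * (y \<bullet> y) \<le> ?q y" for y
  proof (cases "y = 0")
    case False
    let ?u = "y /\<^sub>R norm y"
    have "m \<le> ?q ?u" unfolding m_def by (rule v(2)) (use False in simp)
    also have "?q ?u = ?q y / (y \<bullet> y)"
      by (simp add: matrix_vector_mult_scaleR dot_square_norm power2_eq_square field_simps)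
    finally show ?thesis using False by (simp add: field_simps)
  qed simp
  have eig: "G *v v = m *\<^sub>R v"
  proof -
    define p where "p = G *v v - m *\<^sub>R v"
    have quad: "0 \<le> 2 * t * (p \<bullet> p) + t\<^sup>2 * (?q p - m * (p \<bullet> p))" for t
    proof -
      have "m * ((v + t *\<^sub>R p) \<bullet> (v + t *\<^sub>R p)) \<le> ?q (v + t *\<^sub>R p)" by (rule m)
      also have "?q (v + t *\<^sub>R p) = m + 2 * t * (p \<bullet> (G *v v)) + t\<^sup>2 * ?q p"
        using symmetric_inner[OF sym, of v p]
        by (simp add: m_def matrix_vector_right_distrib matrix_vector_mult_scaleR inner_add inner_commute power2_eq_square algebra_simps)
      finally show ?thesis
        using nv by (simp add: p_def inner_add inner_diff inner_commute power2_eq_square algebra_simps)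
    qed
    have "p \<bullet> p = 0"
    proof (rule ccontr)
      assume "p \<bullet> p \<noteq> 0"
      then have pp: "0 < p \<bullet> p" by (simp add: less_le)
      define C where "C = \<bar>?q p - m * (p \<bullet> p)\<bar> + 1"
      have C: "0 < C" by (simp add: C_def)
      \<comment> \<open>For this t the linear term - 2 (p p)^2 / C outweighs the quadratic one, at
        most (p p)^2 / C.\<close>
      define t where "t = - (p \<bullet> p) / C"
      have "t\<^sup>2 * (?q p - m * (p \<bullet> p)) \<le> t\<^sup>2 * C" by (intro mult_left_mono) (auto simp: C_def)
      then have "0 \<le> 2 * t * (p \<bullet> p) + t\<^sup>2 * C" using quad[of t] by linarith
      also have "\<dots> = - (p \<bullet> p)\<^sup>2 / C" using C by (simp add: t_def power2_eq_square field_simps)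
      also have "\<dots> < 0" using C pp by simp
      finally show False by simp
    qed
    then show ?thesis by (simp add: p_def)
  qed
  have em: "is_eigenvalue G m"
    unfolding is_eigenvalue_def using eig nv by (intro exI[of _ v]) (auto simp: scalar_mult_eq_scaleR)
  have fin: "finite {e. is_eigenvalue G e}" by (rule finite_eigenvalues[OF sym])
  have "min_eigenvalue G \<in> {e. is_eigenvalue G e}"
    unfolding min_eigenvalue_def using fin em by (intro Min_in) auto
  then show "is_eigenvalue G (min_eigenvalue G)" by simp
  have "min_eigenvalue G \<le> m"
    unfolding min_eigenvalue_def using fin em by (intro Min_le) auto
  then show "min_eigenvalue G * (x \<bullet> x) \<le> ?q x"
    using m[of x] mult_right_mono[of "min_eigenvalue G" m "x \<bullet> x"] by simp
qed

text \<open>Cauchy-Schwarz costs sqrt d in each coordinate, and collecting the d coordinates costs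
  another sqrt d.\<close>

lemma matrix_vector_bound:
  fixes E :: "real ^ 'd ^ 'd"
  assumes "\<And>j l. \<bar>E $ j $ l\<bar> \<le> e"
  shows "norm (E *v x) \<le> real CARD('d) * e * norm x"
proof -
  have e: "0 \<le> e" using assms[of undefined undefined] by linarith
  have s: "(\<Sum>l\<in>UNIV. \<bar>x $ l\<bar>) \<le> sqrt (real CARD('d)) * norm x"
    using L2_set_mult_ineq[of "\<lambda>_. 1" "\<lambda>l. x $ l" "UNIV :: 'd set"]
    by (simp add: L2_set_def norm_vec_def)
  have c: "\<bar>(E *v x) $ j\<bar> \<le> e * (sqrt (real CARD('d)) * norm x)" for j
  proof -
    have "\<bar>(E *v x) $ j\<bar> \<le> (\<Sum>l\<in>UNIV. e * \<bar>x $ l\<bar>)"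
      unfolding matrix_vector_mult_def
      by (simp, rule order_trans[OF sum_abs], rule sum_mono) (simp add: abs_mult assms mult_right_mono)
    also have "\<dots> \<le> e * (sqrt (real CARD('d)) * norm x)"
      using mult_left_mono[OF s e] by (simp add: sum_distrib_left)
    finally show ?thesis .
  qed
  have "norm (E *v x) \<le> L2_set (\<lambda>_::'d. e * (sqrt (real CARD('d)) * norm x)) UNIV"
    by (subst norm_vec_def, rule L2_set_mono) (use c in auto)
  also have "\<dots> = sqrt (real CARD('d)) * (e * (sqrt (real CARD('d)) * norm x))"
    using e by (simp add: L2_set_def real_sqrt_mult)
  also have "\<dots> = (sqrt (real CARD('d)) * sqrt (real CARD('d))) * e * norm x" by (simp only: mult_ac)
  also have "\<dots> = real CARD('d) * e * norm x" by simp
  finally show ?thesis .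
qed

lemma vector_bound:
  fixes x :: "real ^ 'd"
  assumes "\<And>j. \<bar>x $ j\<bar> \<le> e"
  shows "norm x \<le> real CARD('d) * e"
proof -
  have "norm x \<le> (\<Sum>j\<in>UNIV. \<bar>x $ j\<bar>)" by (rule norm_le_l1_cart)
  also have "\<dots> \<le> (\<Sum>j::'d\<in>UNIV. e)" by (intro sum_mono assms)
  finally show ?thesis by simp
qed

text \<open>The Lax-Milgram condition. It asks for no symmetry, which the LSTD matrix lacks in
  general, is stable under small perturbations, and for k > 0 gives invertibility together with the
  bound 1 / k on the inverse.\<close>

definition coercive :: "real ^ 'd ^ 'd \<Rightarrow> real \<Rightarrow> bool" where
  "coercive A k \<longleftrightarrow> (\<forall>x. k * (x \<bullet> x) \<le> x \<bullet> (A *v x))"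

lemma coercive_norm:
  assumes "coercive A k"
  shows "k * norm x \<le> norm (A *v x)"
proof (cases "x = 0")
  case False
  have "k * (norm x * norm x) \<le> norm x * norm (A *v x)"
    using assms norm_cauchy_schwarz[of x "A *v x"] unfolding coercive_def
    by (metis dot_square_norm order_trans power2_eq_square)
  then show ?thesis using False by (simp add: mult.left_commute)
qed simp

lemma coercive_invertible:
  assumes "coercive A k" "0 < k"
  shows "invertible A"
proof -
  have "x = 0" if "A *v x = 0" for x
    using coercive_norm[OF assms(1), of x] assms(2) that by (simp add: mult_le_0_iff)
  then show ?thesis unfolding invertible_left_inverse matrix_left_invertible_ker by blast
qed

lemma coercive_perturb:
  fixes A B :: "real ^ 'd ^ 'd"
  assumes "coercive A k" "\<And>j l. \<bar>(B - A) $ j $ l\<bar> \<le> e"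
  shows "coercive B (k - real CARD('d) * e)"
  unfolding coercive_def
proof
  fix x :: "real ^ 'd"
  have "\<bar>x \<bullet> ((B - A) *v x)\<bar> \<le> norm x * (real CARD('d) * e * norm x)"
    using Cauchy_Schwarz_ineq2[of x "(B - A) *v x"] mult_left_mono[OF matrix_vector_bound[of "B - A" e x] norm_ge_zero[of x]] assms(2)
    by fastforce
  also have "\<dots> = real CARD('d) * e * (x \<bullet> x)" by (simp add: dot_square_norm power2_eq_square)
  finally show "(k - real CARD('d) * e) * (x \<bullet> x) \<le> x \<bullet> (B *v x)"
    using assms(1)[unfolded coercive_def, rule_format, of x]
    by (simp add: matrix_vector_mult_diff_rdistrib inner_diff_right left_diff_distrib)
qed

text \<open>The perturbation B - A is made to act on the exact solution, whose norm does not depend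
  on the sample; of the perturbed system only the coercivity constant enters.\<close>

lemma solution_perturb:
  fixes A B :: "real ^ 'd ^ 'd" and a b :: "real ^ 'd"
  assumes B: "coercive B k" "0 < k" and A: "invertible A"
    and AB: "\<And>j l. \<bar>(B - A) $ j $ l\<bar> \<le> e" and ab: "\<And>j. \<bar>(b - a) $ j\<bar> \<le> e'"
  shows "norm (matrix_inv A *v a - matrix_inv B *v b)
     \<le> real CARD('d) * (e' + e * norm (matrix_inv A *v a)) / k"
proof -
  let ?x = "matrix_inv A *v a" and ?y = "matrix_inv B *v b"
  have Bi: "invertible B" by (rule coercive_invertible[OF B])
  have inv: "C *v (matrix_inv C *v z) = z" if "invertible C" for C :: "real ^ 'd ^ 'd" and z
  proof -
    have "C ** matrix_inv C = mat 1"
      using someI_ex[OF that[unfolded invertible_def]] unfolding matrix_inv_def by blast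
    then show ?thesis by (simp add: matrix_vector_mul_assoc)
  qed
  have "B *v (?x - ?y) = (a - b) + (B - A) *v ?x"
    using inv[OF A, of a] inv[OF Bi, of b]
    by (simp add: matrix_vector_mult_diff_distrib matrix_vector_mult_diff_rdistrib)
  then have "k * norm (?x - ?y) \<le> norm ((a - b) + (B - A) *v ?x)"
    using coercive_norm[OF B(1), of "?x - ?y"] by simp
  also have "\<dots> \<le> norm (b - a) + norm ((B - A) *v ?x)"
    by (metis norm_minus_commute norm_triangle_ineq)
  also have "\<dots> \<le> real CARD('d) * e' + real CARD('d) * e * norm ?x"
    by (intro add_mono vector_bound[OF ab] matrix_vector_bound[OF AB])
  finally show ?thesis using B(2) by (simp add: field_simps)
qed

section \<open>Logarithmic factors\<close>

text \<open>The real a with b a^\<kappa> = max \<Lambda> b, where \<Lambda> is \<open>Lam\<close>.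
  Any integer lag above it brings the assumed mixing bound down to \<beta>bar
  exp(-\<Lambda>).\<close>

definition lag :: "real \<Rightarrow> real \<Rightarrow> real \<Rightarrow> nat \<Rightarrow> real \<Rightarrow> real" where
  "lag \<beta>bar b \<kappa> N \<delta> = (max (Lam \<beta>bar N \<delta> / b) 1) powr (1 / \<kappa>)"

lemma Ifun_lag: "Ifun \<beta>bar b \<kappa> N \<delta> = 32 * Lam \<beta>bar N \<delta> * lag \<beta>bar b \<kappa> N \<delta>"
  by (simp add: Ifun_def lag_def)

lemma lag_ge_1: "0 < \<kappa> \<Longrightarrow> 1 \<le> lag \<beta>bar b \<kappa> N \<delta>"
  unfolding lag_def by (rule ge_one_powr_ge_zero) auto

text \<open>The entry 4 e^2 of the maximum keeps the second logarithm above 2. The exponential form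
  turns tail bounds of order exp(-\<Lambda>) into multiples of \<delta> / N^2.\<close>

lemma Lam_bounds:
  assumes "1 \<le> N" "0 < \<delta>" "\<delta> < 1"
  shows "1 \<le> Lam \<beta>bar N \<delta>" "ln (real N) \<le> Lam \<beta>bar N \<delta>"
    and "exp (- Lam \<beta>bar N \<delta>) = \<delta> / (8 * (real N)\<^sup>2 * max (4 * exp 2) (real N * \<beta>bar))"
proof -
  have N: "1 \<le> real N" using assms(1) by simp
  have m: "exp 2 \<le> max (4 * exp 2) (real N * \<beta>bar)" "0 < max (4 * exp 2) (real N * \<beta>bar)"
    by (simp_all add: le_max_iff_disj less_max_iff_disj)
  have 2: "2 \<le> ln (max (4 * exp 2) (real N * \<beta>bar))"
    using m by (simp add: ln_ge_iff)
  have NN: "real N \<le> (real N)\<^sup>2" using N self_le_power[of "real N" 2] by simp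
  have "real N * \<delta> \<le> 8 * (real N)\<^sup>2 * 1"
  proof (rule mult_mono)
    show "real N \<le> 8 * (real N)\<^sup>2" using NN zero_le_power2[of "real N"] by linarith
  qed (use assms in auto)
  then have "real N \<le> 8 * (real N)\<^sup>2 / \<delta>"
    using assms by (simp add: field_simps)
  then have 1: "ln (real N) \<le> ln (8 * (real N)\<^sup>2 / \<delta>)" using N by (intro ln_mono) auto
  show "ln (real N) \<le> Lam \<beta>bar N \<delta>" using 1 2 by (simp add: Lam_def)
  show "1 \<le> Lam \<beta>bar N \<delta>" using 1 2 ln_ge_zero[OF N] by (simp add: Lam_def)
  show "exp (- Lam \<beta>bar N \<delta>) = \<delta> / (8 * (real N)\<^sup>2 * max (4 * exp 2) (real N * \<beta>bar))"
  proof -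
    have p: "0 < 8 * (real N)\<^sup>2 / \<delta>" using N assms by simp
    have "Lam \<beta>bar N \<delta> = ln (8 * (real N)\<^sup>2 / \<delta> * max (4 * exp 2) (real N * \<beta>bar))"
      unfolding Lam_def using p m(2) by (rule ln_mult_pos[symmetric])
    then have "exp (Lam \<beta>bar N \<delta>) = 8 * (real N)\<^sup>2 / \<delta> * max (4 * exp 2) (real N * \<beta>bar)"
      using p m(2) by (simp only: exp_ln mult_pos_pos)
    then show ?thesis by (simp add: exp_minus)
  qed
qed

lemma mlen_nonneg:
  assumes "0 < \<gamma>" "\<gamma> < 1" "0 < lam" "lam < 1" "2 \<le> n"
  shows "0 \<le> mlen \<gamma> lam n" "ln (real (n - 1)) / ln (1 / (lam * \<gamma>)) \<le> mlen \<gamma> lam n"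
    "mlen \<gamma> lam n \<le> ln (real (n - 1)) / ln (1 / (lam * \<gamma>)) + 1" "0 < ln (1 / (lam * \<gamma>))"
    and "3 \<le> n \<Longrightarrow> 1 \<le> mlen \<gamma> lam n"
proof -
  have "lam * \<gamma> < 1" using assms by (smt (verit) mult_less_cancel_right2)
  then show l: "0 < ln (1 / (lam * \<gamma>))" using assms by (intro ln_gt_zero) (simp add: field_simps)
  show 1: "ln (real (n - 1)) / ln (1 / (lam * \<gamma>)) \<le> mlen \<gamma> lam n" unfolding mlen_def by (rule le_of_int_ceiling)
  show "mlen \<gamma> lam n \<le> ln (real (n - 1)) / ln (1 / (lam * \<gamma>)) + 1" unfolding mlen_def by linarith
  have "0 \<le> ln (real (n - 1))" using assms(5) by (intro ln_ge_zero) simp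
  then show "0 \<le> mlen \<gamma> lam n" using l 1 by (meson divide_nonneg_pos order_trans)
  show "1 \<le> mlen \<gamma> lam n" if "3 \<le> n"
  proof -
    have "0 < ln (real (n - 1))" using that by (intro ln_gt_zero) simp
    then have "0 < mlen \<gamma> lam n" using l 1 by (meson divide_pos_pos order_less_le_trans)
    then show ?thesis by (simp add: mlen_def)
  qed
qed

text \<open>All summands of the condition are nonnegative, so the first one alone is below 1. From
  \<open>mlen \<ge> 1\<close> its root is at least 8 sqrt Q, and 2 * 2 * 8 = 32. The later claims
  follow from the first by (1 - \<gamma>) \<nu> \<le> L^2 and R^2 = N Q, with 1024 = 32^2.\<close>

lemma n0_cond_consequences:
  fixes d n :: nat
  assumes \<gamma>: "0 < \<gamma>" "\<gamma> < 1" and lam: "0 < lam" "lam < 1" and \<nu>: "0 < \<nu>" "\<nu> \<le> L\<^sup>2" and d: "1 \<le> d"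
    and \<kappa>: "0 < \<kappa>" and \<delta>: "0 < \<delta>" "\<delta> < 1" and n: "2 \<le> n"
    and cond: "n0_cond d L \<gamma> lam \<nu> \<beta>bar b \<kappa> n \<delta>"
  defines "N \<equiv> n - 1"
  defines "Q \<equiv> Lam \<beta>bar N \<delta> * lag \<beta>bar b \<kappa> N \<delta>"
  defines "R \<equiv> sqrt (real N * Q)"
  shows "32 * real d * L\<^sup>2 * R < (1 - \<gamma>) * \<nu> * real N"
    and "32 * real d * Q < R" and "1024 * (real d)\<^sup>2 * Q < real N"
proof -
  have N: "1 \<le> N" using n by (simp add: N_def)
  have Q: "1 \<le> Q" unfolding Q_def
    using mult_mono[OF Lam_bounds(1)[OF N \<delta>, of \<beta>bar] lag_ge_1[OF \<kappa>, of \<beta>bar b N \<delta>]]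
      Lam_bounds(1)[OF N \<delta>, of \<beta>bar] by simp
  let ?C = "2 * real d * L\<^sup>2 / ((1 - \<gamma>) * \<nu>)"
  let ?m = "mlen \<gamma> lam n"
  have dL: "(1 - \<gamma>) * \<nu> \<le> real d * L\<^sup>2"
    using mult_mono[of "1 - \<gamma>" 1 \<nu> "L\<^sup>2"] mult_right_mono[of 1 "real d" "L\<^sup>2"] \<gamma> \<nu> d by simp
  have p: "0 < (1 - \<gamma>) * \<nu>" using \<gamma> \<nu> by simp
  then have C: "2 \<le> ?C" using dL by (simp add: field_simps)
  have m0: "0 \<le> ?m" by (rule mlen_nonneg(1)[OF \<gamma> lam n])
  have c1: "lam * \<gamma> < 1" using \<gamma> lam by (smt (verit) mult_less_cancel_right2)
  have I: "Ifun \<beta>bar b \<kappa> N \<delta> = 32 * Q" by (simp add: Ifun_lag Q_def)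
  have sq: "0 < sqrt (real N)" using N by simp
  let ?t = "2 / sqrt (real N) * sqrt ((?m + 1) * (32 * Q))"
  have cond': "?C * (?t + 1 / (real N * (1 - lam * \<gamma>)) + 2 / real N * ?m) < 1"
    using cond unfolding n0_cond_def N_def[symmetric] I .
  have "?C * ?t \<le> ?C * (?t + 1 / (real N * (1 - lam * \<gamma>)) + 2 / real N * ?m)"
    using C m0 c1 by (intro mult_left_mono) auto
  then have t: "?C * ?t < 1" using cond' by linarith
  \<comment> \<open>At N = 1 the logarithm vanishes and \<open>mlen\<close> is 0, so
    \<open>mlen \<ge> 1\<close> needs this case excluded; there the first summand alone is already
    at least 1.\<close>
  have N2: "2 \<le> N"
  proof (rule ccontr)
    assume "\<not> 2 \<le> N"
    then have N1: "N = 1" using N by simp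
    have "1 \<le> sqrt ((?m + 1) * (32 * Q))"
      using mult_mono[of 1 "?m + 1" 1 "32 * Q"] m0 Q by simp
    then have "1 \<le> ?t" using N1 by (simp del: real_sqrt_ge_1_iff)
    then have "1 \<le> ?C * ?t" using C mult_mono[of 1 ?C 1 ?t] by simp
    then show False using t by simp
  qed
  then have m1: "1 \<le> ?m" using mlen_nonneg(5)[OF \<gamma> lam n] by (simp add: N_def)
  have "8 * sqrt Q = sqrt (64 * Q)" by (simp add: real_sqrt_mult)
  also have "\<dots> \<le> sqrt ((?m + 1) * (32 * Q))"
    using mult_right_mono[of 2 "?m + 1" "32 * Q"] m1 Q by simp
  finally have "2 / sqrt (real N) * (8 * sqrt Q) \<le> ?t" using sq by (intro mult_left_mono) auto
  then have "?C * (2 / sqrt (real N) * (8 * sqrt Q)) \<le> ?C * ?t" by (rule mult_left_mono) (use C in linarith)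
  then have "?C * (2 / sqrt (real N) * (8 * sqrt Q)) < 1" using t by linarith
  then have "32 * real d * L\<^sup>2 * sqrt Q < (1 - \<gamma>) * \<nu> * sqrt (real N)"
  proof -
    have "?C * (2 / sqrt (real N) * (8 * sqrt Q)) = 32 * real d * L\<^sup>2 * sqrt Q / ((1 - \<gamma>) * \<nu> * sqrt (real N))"
      by simp
    then show "32 * real d * L\<^sup>2 * sqrt Q < (1 - \<gamma>) * \<nu> * sqrt (real N)"
      using \<open>?C * (2 / sqrt (real N) * (8 * sqrt Q)) < 1\<close> divide_less_eq_1_pos[OF mult_pos_pos[OF p sq]] by metis
  qed
  then have "32 * real d * L\<^sup>2 * sqrt Q * sqrt (real N) < (1 - \<gamma>) * \<nu> * sqrt (real N) * sqrt (real N)"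
    using sq by (rule mult_strict_right_mono)
  then show 1: "32 * real d * L\<^sup>2 * R < (1 - \<gamma>) * \<nu> * real N"
    using Q N by (simp add: R_def real_sqrt_mult mult_ac)
  have L: "0 < L\<^sup>2" using \<nu> by linarith
  have "(1 - \<gamma>) * \<nu> * real N \<le> L\<^sup>2 * real N"
    using mult_mono[of "1 - \<gamma>" 1 \<nu> "L\<^sup>2"] \<gamma> \<nu> by (intro mult_right_mono) auto
  then have "L\<^sup>2 * (32 * real d * R) < L\<^sup>2 * real N" using 1 by (simp add: mult_ac)
  then have 2: "32 * real d * R < real N" using L by simp
  have R0: "0 < R" using N Q by (simp add: R_def)
  have "32 * real d * R * Q < real N * Q" using 2 Q by (intro mult_strict_right_mono) auto
  also have "real N * Q = R * R" using N Q by (simp add: R_def)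
  finally have "R * (32 * real d * Q) < R * R" by (simp add: mult_ac)
  then show 3: "32 * real d * Q < R" using R0 by simp
  have "32 * real d * (32 * real d * Q) < 32 * real d * R" using 3 d by (intro mult_strict_left_mono) auto
  then show "1024 * (real d)\<^sup>2 * Q < real N" using 2 by (simp add: power2_eq_square mult_ac)
qed

text \<open>\<open>LEAST\<close> says something only if an admissible index exists, so the condition
  has to be shown to hold eventually.\<close>

lemma n0_spec:
  fixes d :: nat
  assumes \<gamma>: "0 < \<gamma>" "\<gamma> < 1" and lam: "0 < lam" "lam < 1" and \<nu>: "0 < \<nu>"
    and p: "0 < \<beta>bar" "0 < b" "0 < \<kappa>" and \<delta>: "0 < \<delta>" "\<delta> < 1"
  shows "2 \<le> n0 d L \<gamma> lam \<nu> \<beta>bar b \<kappa> \<delta>"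
    and "n \<ge> n0 d L \<gamma> lam \<nu> \<beta>bar b \<kappa> \<delta> \<Longrightarrow> n0_cond d L \<gamma> lam \<nu> \<beta>bar b \<kappa> n \<delta>"
proof -
  define l where "l = ln (1 / (lam * \<gamma>))"
  have l: "0 < l" unfolding l_def by (rule mlen_nonneg(4)[OF \<gamma> lam, of 2]) simp
  define q where "q = 1 - lam * \<gamma>"
  have q: "0 < q" using \<gamma> lam unfolding q_def by (smt (verit) mult_less_cancel_right2)
  define C where "C = 2 * real d * L\<^sup>2 / ((1 - \<gamma>) * \<nu>)"
  have C: "0 \<le> C" unfolding C_def using \<gamma> \<nu> by simp
  \<comment> \<open>A majorant of the left side of the condition as a function of a real x = n - 1:
    the ceiling is replaced by adding 1, which leaves an expression open to automatic
    asymptotics.\<close>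
  define F where "F = (\<lambda>x::real. C * (2 / sqrt x * sqrt ((ln x / l + 2) * (32 * (ln (8 * x\<^sup>2 / \<delta>) + ln (max (4 * exp 2) (x * \<beta>bar)))
     * (max ((ln (8 * x\<^sup>2 / \<delta>) + ln (max (4 * exp 2) (x * \<beta>bar))) / b) 1) powr (1 / \<kappa>)))
     + 1 / (x * q) + 2 / x * (ln x / l + 1)))"
  have "(F \<longlongrightarrow> 0) at_top"
    unfolding F_def using l q p \<delta> by real_asymp
  moreover have "filterlim (\<lambda>n. real (n - 1)) at_top sequentially" by real_asymp
  ultimately have "((\<lambda>n. F (real (n - 1))) \<longlongrightarrow> 0) sequentially" by (rule filterlim_compose)
  then have "eventually (\<lambda>n. F (real (n - 1)) < 1) sequentially" by (rule order_tendstoD) simp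
  moreover have "eventually (\<lambda>n::nat. 2 \<le> n) sequentially" by (rule eventually_ge_at_top)
  ultimately have "eventually (\<lambda>n. n0_cond d L \<gamma> lam \<nu> \<beta>bar b \<kappa> n \<delta>) sequentially"
  proof eventually_elim
    case (elim n)
    let ?I = "Ifun \<beta>bar b \<kappa> (n - 1) \<delta>"
    have "1 \<le> n - 1" using elim(2) by simp
    then have "0 \<le> Lam \<beta>bar (n - 1) \<delta>" using Lam_bounds(1)[of "n - 1" \<delta> \<beta>bar] \<delta> by linarith
    then have I: "0 \<le> ?I" unfolding Ifun_def by (intro mult_nonneg_nonneg) auto
    have m: "mlen \<gamma> lam n \<le> ln (real (n - 1)) / l + 1"
      unfolding l_def by (rule mlen_nonneg(3)[OF \<gamma> lam elim(2)])
    have s: "sqrt ((mlen \<gamma> lam n + 1) * ?I) \<le> sqrt ((ln (real (n - 1)) / l + 2) * ?I)"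
      by (rule real_sqrt_le_mono, rule mult_right_mono[OF _ I]) (use m in linarith)
    have "C * (2 / sqrt (real (n - 1)) * sqrt ((mlen \<gamma> lam n + 1) * ?I)
        + 1 / (real (n - 1) * q) + 2 / real (n - 1) * mlen \<gamma> lam n)
      \<le> C * (2 / sqrt (real (n - 1)) * sqrt ((ln (real (n - 1)) / l + 2) * ?I)
        + 1 / (real (n - 1) * q) + 2 / real (n - 1) * (ln (real (n - 1)) / l + 1))"
      by (rule mult_left_mono[OF _ C], rule add_mono[OF add_right_mono])
        (rule mult_left_mono[OF s] mult_left_mono[OF m]; simp)+
    also have "\<dots> = F (real (n - 1))" by (simp add: F_def Ifun_def Lam_def)
    finally show ?case using elim(1) by (simp add: n0_cond_def C_def q_def)
  qed
  then obtain m where "\<forall>n\<ge>m. n0_cond d L \<gamma> lam \<nu> \<beta>bar b \<kappa> n \<delta>"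
    by (auto simp: eventually_sequentially)
  then have ex: "\<exists>m. 2 \<le> m \<and> (\<forall>n\<ge>m. n0_cond d L \<gamma> lam \<nu> \<beta>bar b \<kappa> n \<delta>)"
    by (intro exI[of _ "max 2 m"]) auto
  from LeastI_ex[OF ex, folded n0_def]
  show "2 \<le> n0 d L \<gamma> lam \<nu> \<beta>bar b \<kappa> \<delta>"
    and "n \<ge> n0 d L \<gamma> lam \<nu> \<beta>bar b \<kappa> \<delta> \<Longrightarrow> n0_cond d L \<gamma> lam \<nu> \<beta>bar b \<kappa> n \<delta>"
    by auto
qed

section \<open>Coercivity of the resolvent form\<close>

context stationary_chain begin

text \<open>The mean is \<open>Pop\<close> for the kernel all of whose rows are \<mu>, so the
  linearity lemmas for \<open>Pop\<close> carry over.\<close>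

lemma mean_Pop: "mean f = Pop (\<lambda>_. \<mu>) f x"
  by (simp add: mean_def Pop_def)

lemma stoch_mu: "stochastic (\<lambda>_. \<mu>)"
  using mu_nonneg mu_has_sum by (simp add: stochastic_def)

lemma mean_add: "bdd_by f B \<Longrightarrow> bdd_by g C \<Longrightarrow> mean (\<lambda>x. f x + g x) = mean f + mean g"
  unfolding mean_Pop[of _ undefined] by (rule Pop_add[OF stoch_mu])

lemma mean_diff: "bdd_by f B \<Longrightarrow> bdd_by g C \<Longrightarrow> mean (\<lambda>x. f x - g x) = mean f - mean g"
  unfolding mean_Pop[of _ undefined] by (rule Pop_diff[OF stoch_mu])

lemma mean_cmult: "mean (\<lambda>x. c * f x) = c * mean f"
  unfolding mean_Pop[of _ undefined] by (rule Pop_cmult)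

lemma mean_sum:
  "finite I \<Longrightarrow> (\<And>i. i \<in> I \<Longrightarrow> bdd_by (f i) (B i)) \<Longrightarrow> mean (\<lambda>x. \<Sum>i\<in>I. f i x) = (\<Sum>i\<in>I. mean (f i))"
  unfolding mean_Pop[of _ undefined] by (rule Pop_sum[OF stoch_mu])

lemma mean_nonneg: "(\<And>x. 0 \<le> f x) \<Longrightarrow> 0 \<le> mean f"
  unfolding mean_def using mu_nonneg by (intro infsum_nonneg) auto

lemma mean_mono:
  assumes "bdd_by f B" "bdd_by g C" "\<And>x. f x \<le> g x"
  shows "mean f \<le> mean g"
  using mean_nonneg[of "\<lambda>x. g x - f x"] mean_diff[OF assms(2,1)] assms(3) by simp

text \<open>Read off the chain, as E[(P f)(X_1)] = E[f(X_2)] with both states distributed by \<mu>;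
  this avoids interchanging a double sum.\<close>

lemma mean_invariant:
  assumes "bdd_by f B"
  shows "mean (Pop P f) = mean f"
proof -
  have "mean (Pop P f) = (\<integral>\<omega>. Pop P f (X 1 \<omega>) \<partial>M)"
    unfolding mean_def by (rule expectation_stat[OF Pop_bdd[OF stoch assms], symmetric]) simp
  also have "\<dots> = (\<integral>\<omega>. f (X 2 \<omega>) \<partial>M)"
    using markov_step[OF order_refl adapted_const[of 1 1] _ assms, of 1] by (simp add: numeral_2_eq_2)
  also have "\<dots> = mean f"
    unfolding mean_def by (rule expectation_stat[OF assms]) simp
  finally show ?thesis .
qed

text \<open>Jensen's inequality, obtained from the nonnegativity of P applied to (w - t)^2 at t = (P
  w)(x), followed by invariance of \<mu>.\<close>

lemma mean_square_contract:
  assumes w: "bdd_by w B"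
  shows "mean (\<lambda>x. (Pop P w x)\<^sup>2) \<le> mean (\<lambda>x. (w x)\<^sup>2)"
proof -
  have w2: "bdd_by (\<lambda>x. (w x)\<^sup>2) (B * B)" using bdd_by_mult[OF w w] by (simp add: power2_eq_square)
  have p2: "bdd_by (\<lambda>x. (Pop P w x)\<^sup>2) (B * B)"
    using bdd_by_mult[OF Pop_bdd[OF stoch w] Pop_bdd[OF stoch w]] by (simp add: power2_eq_square)
  have "(Pop P w x)\<^sup>2 \<le> Pop P (\<lambda>x. (w x)\<^sup>2) x" for x
  proof -
    define t where "t = Pop P w x"
    have sP: "(P x has_sum 1) UNIV" using stoch by (simp add: stochastic_def)
    have const: "Pop P (\<lambda>_. s) x = s" for s
      using infsumI[OF has_sum_cmult_left[OF sP, of s]] by (simp add: Pop_def)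
    have c: "bdd_by (\<lambda>_::'s. s) \<bar>s\<bar>" for s by (simp add: bdd_by_def)
    have "0 \<le> Pop P (\<lambda>y. (w y - t)\<^sup>2) x"
      unfolding Pop_def using stoch by (intro infsum_nonneg) (auto simp: stochastic_def)
    also have "(\<lambda>y. (w y - t)\<^sup>2) = (\<lambda>y. ((w y)\<^sup>2 - (2 * t) * w y) + t\<^sup>2)"
      by (simp add: power2_eq_square algebra_simps)
    also have "Pop P \<dots> x = Pop P (\<lambda>y. (w y)\<^sup>2) x - (2 * t) * t + t\<^sup>2"
      using Pop_add[OF stoch bdd_by_diff[OF w2 bdd_by_cmult[OF w, of "2 * t"]] c, of "t\<^sup>2" x]
        Pop_diff[OF stoch w2 bdd_by_cmult[OF w, of "2 * t"], of x] Pop_cmult[of P "2 * t" w x]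
      by (simp add: const t_def)
    finally show ?thesis by (simp add: t_def power2_eq_square)
  qed
  then have "mean (\<lambda>x. (Pop P w x)\<^sup>2) \<le> mean (Pop P (\<lambda>x. (w x)\<^sup>2))"
    by (rule mean_mono[OF p2 Pop_bdd[OF stoch w2]])
  then show ?thesis using mean_invariant[OF w2] by simp
qed

text \<open>With \<open>f = w - c P w\<close> the pointwise identity
  \<open>f (w - g P w) = (1-g)/(1-c) f\<^sup>2 + (g-c)/2 (w\<^sup>2 - (P w)\<^sup>2) + (g-c)(1+c)/(2(1-c)) (w - P w)\<^sup>2\<close>
  reduces coercivity to the contraction property of \<open>P\<close> in mean square.\<close>

lemma resolvent_coercive:
  fixes w :: "'s \<Rightarrow> real" and c g :: real
  assumes w: "bdd_by w B" and c: "0 \<le> c" "c < 1" and g: "c \<le> g"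
  defines "f \<equiv> \<lambda>x. w x - c * Pop P w x"
  shows "(1 - g) / (1 - c) * mean (\<lambda>x. (f x)\<^sup>2) \<le> mean (\<lambda>x. f x * (w x - g * Pop P w x))"
proof -
  let ?p = "Pop P w"
  have p: "bdd_by ?p B" by (rule Pop_bdd[OF stoch w])
  have fb: "bdd_by f (B + \<bar>c\<bar> * B)" unfolding f_def by (intro bdd_by_diff bdd_by_cmult w p)
  have gb: "bdd_by (\<lambda>x. w x - g * ?p x) (B + \<bar>g\<bar> * B)" by (intro bdd_by_diff bdd_by_cmult w p)
  have f2: "bdd_by (\<lambda>x. (f x)\<^sup>2) ((B + \<bar>c\<bar> * B) * (B + \<bar>c\<bar> * B))"
    using bdd_by_mult[OF fb fb] by (simp add: power2_eq_square)
  have w2: "bdd_by (\<lambda>x. (w x)\<^sup>2) (B * B)" using bdd_by_mult[OF w w] by (simp add: power2_eq_square)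
  have p2: "bdd_by (\<lambda>x. (?p x)\<^sup>2) (B * B)" using bdd_by_mult[OF p p] by (simp add: power2_eq_square)
  let ?k = "(1 - g) / (1 - c)"
  have pt: "?k * (f x)\<^sup>2 + (g - c) / 2 * ((w x)\<^sup>2 - (?p x)\<^sup>2) \<le> f x * (w x - g * ?p x)" for x
  proof -
    have "f x * (w x - g * ?p x) - (?k * (f x)\<^sup>2 + (g - c) / 2 * ((w x)\<^sup>2 - (?p x)\<^sup>2))
      = (g - c) * (1 + c) / (2 * (1 - c)) * (w x - ?p x)\<^sup>2"
      using c by (simp add: f_def divide_simps) (simp add: algebra_simps power2_eq_square)
    also have "0 \<le> \<dots>" using c g by (intro mult_nonneg_nonneg divide_nonneg_nonneg) auto
    finally show ?thesis by simp
  qed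
  have "mean (\<lambda>x. ?k * (f x)\<^sup>2 + (g - c) / 2 * ((w x)\<^sup>2 - (?p x)\<^sup>2))
      = ?k * mean (\<lambda>x. (f x)\<^sup>2) + (g - c) / 2 * (mean (\<lambda>x. (w x)\<^sup>2) - mean (\<lambda>x. (?p x)\<^sup>2))"
    using mean_add[OF bdd_by_cmult[OF f2, of ?k] bdd_by_cmult[OF bdd_by_diff[OF w2 p2], of "(g - c) / 2"]]
    by (simp only: mean_cmult mean_diff[OF w2 p2])
  moreover have "0 \<le> (g - c) / 2 * (mean (\<lambda>x. (w x)\<^sup>2) - mean (\<lambda>x. (?p x)\<^sup>2))"
    using mean_square_contract[OF w] g by simp
  moreover have "mean (\<lambda>x. ?k * (f x)\<^sup>2 + (g - c) / 2 * ((w x)\<^sup>2 - (?p x)\<^sup>2)) \<le> mean (\<lambda>x. f x * (w x - g * ?p x))"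
    by (rule mean_mono[OF bdd_by_add[OF bdd_by_cmult[OF f2] bdd_by_cmult[OF bdd_by_diff[OF w2 p2]]] bdd_by_mult[OF fb gb] pt])
  ultimately show ?thesis by linarith
qed

section \<open>Positivity of the stationary distribution\<close>

lemma kpow_eq: "kpow P n x y = (Pop P ^^ n) (\<lambda>z. of_bool (z = y)) x"
proof (induction n arbitrary: x)
  case (Suc n) then show ?case by (simp add: Pop_def)
qed simp

text \<open>Some state x has positive mass, and by invariance \<mu>(y) = mean (P^n 1_y) \<ge>
  \<mu>(x) P^n(x, y), which irreducibility makes positive for a suitable n. Linear independence of
  the features is a statement about all states; this lets it be tested in the \<mu>-weighted
  norm.\<close>

lemma mu_pos:
  assumes "irreducible_kernel P"
  shows "0 < \<mu> y"
proof -
  have ib: "bdd_by (\<lambda>z. of_bool (z = y)) 1" by (simp add: bdd_by_def)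
  obtain x where x: "0 < \<mu> x"
  proof (rule ccontr)
    assume "\<not> thesis"
    then have "\<not> 0 < \<mu> x" for x using that by blast
    then have "\<mu> x = 0" for x using mu_nonneg[of x] by (simp add: less_le)
    then have "\<mu> = (\<lambda>_. 0)" by auto
    then show False using has_sum_unique[OF mu_has_sum, of 0] by simp
  qed
  obtain n where n: "0 < kpow P n x y" using assms unfolding irreducible_kernel_def by blast
  let ?f = "(Pop P ^^ n) (\<lambda>z. of_bool (z = y))"
  have fb: "bdd_by ?f 1" by (rule Pop_pow_bdd[OF stoch ib])
  have f0: "0 \<le> (Pop P ^^ k) (\<lambda>z. of_bool (z = y)) z" for k z
  proof (induction k arbitrary: z)
    case (Suc k) then show ?case using stoch by (auto simp: Pop_def stochastic_def intro!: infsum_nonneg)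
  qed simp
  have m: "mean ((Pop P ^^ k) (\<lambda>z. of_bool (z = y))) = mean (\<lambda>z. of_bool (z = y))" for k
    by (induction k) (simp_all add: mean_invariant[OF Pop_pow_bdd[OF stoch ib]])
  have "0 < \<mu> x * ?f x" using x n by (simp add: kpow_eq)
  also have "\<dots> \<le> mean ?f"
  proof -
    have "(\<Sum>x\<in>{x}. \<mu> x * ?f x) \<le> (\<Sum>\<^sub>\<infinity>x. \<mu> x * ?f x)"
      using f0 mu_nonneg by (intro finite_sum_le_infsum weighted_summable[OF mu_nonneg mu_summable fb]) auto
    then show ?thesis by (simp add: mean_def)
  qed
  also have "\<dots> = mean (\<lambda>z. of_bool (z = y))" by (rule m)
  also have "\<dots> = \<mu> y"
  proof -
    have "mean (\<lambda>z. of_bool (z = y)) = (\<integral>\<omega>. of_bool (X 1 \<omega> = y) \<partial>M)"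
      unfolding mean_def by (rule expectation_stat[OF ib, symmetric]) simp
    also have "\<dots> = \<mu> y" using prob_X[of 1 y] by (simp add: expectation_of_bool)
    finally show ?thesis .
  qed
  finally show ?thesis .
qed

section \<open>Calibration of the tail bound\<close>

lemma trace_tail_explicit:
  fixes u f :: "'s \<Rightarrow> real" and c g F U :: real and N :: nat
  assumes f: "bdd_by f F" and u: "bdd_by u U" and c: "0 \<le> c" "c < 1"
    and mix: "\<And>i. 1 \<le> i \<Longrightarrow> beta_coef M X i \<le> \<beta>bar * exp (- b * real i powr \<kappa>)"
    and p: "0 < \<beta>bar" "0 < b" "0 < \<kappa>" and \<delta>: "0 < \<delta>" "\<delta> < 1"
  defines "Q \<equiv> Lam \<beta>bar N \<delta> * lag \<beta>bar b \<kappa> N \<delta>"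
  defines "R \<equiv> sqrt (real N * Q)"
  assumes N: "1 \<le> N" "32 * Q \<le> R" "1024 * Q \<le> real N"
  defines "w \<equiv> resolvent P c u"
  defines "m \<equiv> mean (\<lambda>x. f x * (w x - g * Pop P w x))"
  defines "D \<equiv> 1 + \<bar>g - c\<bar> / (1 - c)"
  shows "prob {\<omega> \<in> space M. F * U * D * (12 * R)
      < (1 - c) * \<bar>(\<Sum>i=1..N. etrace c f i \<omega> * (u (X i \<omega>) - g * u (X (Suc i) \<omega>))) - real N * m\<bar>}
    \<le> \<delta> / (2 * (real N)\<^sup>2)" (is "prob ?E \<le> _")
proof -
  define \<Lambda> where "\<Lambda> = Lam \<beta>bar N \<delta>"
  define a0 where "a0 = lag \<beta>bar b \<kappa> N \<delta>"
  define a where "a = nat \<lceil>a0\<rceil>"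
  have \<Lambda>: "1 \<le> \<Lambda>" "ln (real N) \<le> \<Lambda>"
    and e\<Lambda>: "exp (- \<Lambda>) = \<delta> / (8 * (real N)\<^sup>2 * max (4 * exp 2) (real N * \<beta>bar))"
    unfolding \<Lambda>_def using Lam_bounds[OF N(1) \<delta>] by auto
  have a0: "1 \<le> a0" unfolding a0_def by (rule lag_ge_1[OF p(3)])
  have Q: "Q = \<Lambda> * a0" by (simp add: Q_def \<Lambda>_def a0_def)
  have Qa: "a0 \<le> Q" "\<Lambda> \<le> Q" "1 \<le> Q"
  proof -
    show "a0 \<le> Q" using mult_right_mono[of 1 \<Lambda> a0] \<Lambda> a0 by (simp add: Q)
    then show "1 \<le> Q" using a0 by linarith
    show "\<Lambda> \<le> Q" using mult_left_mono[of 1 a0 \<Lambda>] \<Lambda> a0 by (simp add: Q)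
  qed
  have a: "a0 \<le> real a" "real a \<le> 2 * a0" "1 \<le> a"
    using a0 unfolding a_def by linarith+
  have "real a \<le> real N" using a Qa N by linarith
  then have aN: "a \<le> N" by simp
  define K where "K = N div a + 1"
  have aK: "real a * real K \<le> 2 * real N"
  proof -
    have "a * K \<le> N + a" by (simp add: K_def)
    then have "a * K \<le> 2 * N" using aN by linarith
    then show ?thesis by (metis of_nat_le_iff of_nat_mult of_nat_numeral)
  qed
  have K1: "1 \<le> K" by (simp add: K_def)
  \<comment> \<open>The constant 16 makes each class fail with probability of order exp(-2
    \<Lambda>). One factor exp(-\<Lambda>) pays for the union over the a classes, since a \<le> N
    \<le> exp \<Lambda>.\<close>
  define \<tau> where "\<tau> = sqrt (16 * real K * \<Lambda>)"
  define \<tau>' where "\<tau>' = sqrt (8 * real N * \<Lambda>)"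
  have t0: "0 \<le> \<tau>" "0 \<le> \<tau>'" using \<Lambda> by (simp_all add: \<tau>_def \<tau>'_def)
  have R0: "0 \<le> R" and RR: "R\<^sup>2 = real N * Q" using Qa by (simp_all add: R_def)
  \<comment> \<open>Since a K \<le> 2 N and a \<le> 2 a0, (a \<tau>)^2 = 16 a (a K) \<Lambda> is at
    most 64 N Q.\<close>
  have t1: "real a * \<tau> \<le> 8 * R"
  proof -
    have "(real a * \<tau>)\<^sup>2 = 16 * (real a * (real a * real K)) * \<Lambda>"
      using \<Lambda> by (simp add: \<tau>_def power_mult_distrib power2_eq_square)
    also have "\<dots> \<le> 16 * ((2 * a0) * (2 * real N)) * \<Lambda>"
      using \<Lambda> by (intro mult_right_mono mult_left_mono mult_mono[OF a(2) aK]) (use a0 in auto)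
    also have "\<dots> = (8 * R)\<^sup>2" by (simp add: power_mult_distrib RR) (simp add: Q)
    finally show ?thesis by (rule power2_le_imp_le) (use R0 in simp)
  qed
  have t2: "\<tau>' \<le> 3 * R"
  proof -
    have "\<tau>'\<^sup>2 = 8 * (real N * \<Lambda>)" using \<Lambda> by (simp add: \<tau>'_def)
    also have "\<dots> \<le> 9 * (real N * Q)" using Qa \<Lambda> by (intro mult_mono mult_left_mono) auto
    also have "\<dots> = (3 * R)\<^sup>2" by (simp add: power_mult_distrib RR)
    finally show ?thesis by (rule power2_le_imp_le) (use R0 in simp)
  qed
  \<comment> \<open>The budget is 8 R for the classes and 3 R for the martingale; 2 a + 2 \<le> 4 Q
    + 2 \<le> 6 Q fits easily into the last R because 32 Q \<le> R.\<close>
  have small: "real a * \<tau> + 2 * real a + 2 + \<tau>' \<le> 12 * R"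
    using t1 t2 a Qa N by linarith
  have FUD: "0 \<le> F * U * D" using bdd_by_nonneg[OF f] bdd_by_nonneg[OF u] c by (simp add: D_def)
  have [measurable]: "etrace c f i \<in> borel_measurable M" for i by (rule adapted_borel[OF trace_adapted])
  have "prob ?E \<le> prob {\<omega> \<in> space M. F * U * D * (real a * \<tau> + 2 * real a + 2 + \<tau>')
      < (1 - c) * \<bar>(\<Sum>i=1..N. etrace c f i \<omega> * (u (X i \<omega>) - g * u (X (Suc i) \<omega>))) - real N * m\<bar>}"
  proof (rule finite_measure_mono)
    show "?E \<subseteq> {\<omega> \<in> space M. F * U * D * (real a * \<tau> + 2 * real a + 2 + \<tau>')
      < (1 - c) * \<bar>(\<Sum>i=1..N. etrace c f i \<omega> * (u (X i \<omega>) - g * u (X (Suc i) \<omega>))) - real N * m\<bar>}"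
      using mult_left_mono[OF small FUD] by auto
  qed measurable
  also have "\<dots> \<le> 2 * real a * exp (- \<tau>\<^sup>2 / (8 * real (N div a + 1))) + 2 * real N * beta_coef M X a
      + 2 * exp (- \<tau>'\<^sup>2 / (8 * real N))"
    unfolding m_def w_def D_def by (rule trace_tail[OF f u c a(3) aN t0])
  also have "exp (- \<tau>\<^sup>2 / (8 * real (N div a + 1))) = exp (- \<Lambda>) * exp (- \<Lambda>)"
  proof -
    have "- \<tau>\<^sup>2 / (8 * real K) = - \<Lambda> + - \<Lambda>" using \<Lambda> K1 by (simp add: \<tau>_def)
    then show ?thesis unfolding K_def by (simp only: exp_add)
  qed
  also have "- \<tau>'\<^sup>2 / (8 * real N) = - \<Lambda>" using \<Lambda> N by (simp add: \<tau>'_def)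
  also have "2 * real a * (exp (- \<Lambda>) * exp (- \<Lambda>)) \<le> 2 * exp (- \<Lambda>)"
  proof -
    have "exp (- \<Lambda>) \<le> exp (- ln (real N))" using \<Lambda>(2) by simp
    also have "\<dots> = 1 / real N" using N by (simp add: exp_minus inverse_eq_divide)
    finally have "real a * exp (- \<Lambda>) \<le> real N * (1 / real N)"
      using aN by (intro mult_mono) auto
    then have "real a * exp (- \<Lambda>) \<le> 1" using N by simp
    from mult_right_mono[OF this, of "2 * exp (- \<Lambda>)"] show ?thesis by (simp add: mult_ac)
  qed
  also have "2 * real N * beta_coef M X a \<le> 2 * real N * \<beta>bar * exp (- \<Lambda>)"
  proof -
    have "max (\<Lambda> / b) 1 = a0 powr \<kappa>"
      using p by (simp add: a0_def lag_def \<Lambda>_def powr_powr)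
    also have "\<dots> \<le> real a powr \<kappa>" using a a0 p by (intro powr_mono2) auto
    finally have "\<Lambda> / b \<le> real a powr \<kappa>" by simp
    then have "\<Lambda> \<le> b * real a powr \<kappa>" using p by (simp add: field_simps)
    then have "exp (- b * real a powr \<kappa>) \<le> exp (- \<Lambda>)" by simp
    then have "beta_coef M X a \<le> \<beta>bar * exp (- \<Lambda>)"
      using mix[OF a(3)] mult_left_mono[of _ "exp (- \<Lambda>)" \<beta>bar] p by (meson less_imp_le order_trans)
    then show ?thesis using mult_left_mono[of _ _ "2 * real N"] by (simp add: mult.assoc)
  qed
  also have "2 * exp (- \<Lambda>) + 2 * real N * \<beta>bar * exp (- \<Lambda>) + 2 * exp (- \<Lambda>) = (4 + 2 * (real N * \<beta>bar)) * exp (- \<Lambda>)"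
    by (simp add: algebra_simps)
  \<comment> \<open>This is where the maximum in \<open>Lam\<close> is used: one of its entries
    covers the constant, the other the mixing term, and the result cancels against the denominator
    of exp(-\<Lambda>).\<close>
  also have "\<dots> \<le> (4 * max (4 * exp 2) (real N * \<beta>bar)) * exp (- \<Lambda>)"
  proof (rule mult_right_mono)
    have "(1::real) \<le> exp 2" by simp
    then have "2 \<le> 4 * exp (2::real)" by linarith
    then have "2 \<le> max (4 * exp 2) (real N * \<beta>bar)" by (rule max.coboundedI1)
    moreover have "real N * \<beta>bar \<le> max (4 * exp 2) (real N * \<beta>bar)" by simp
    ultimately show "4 + 2 * (real N * \<beta>bar) \<le> 4 * max (4 * exp 2) (real N * \<beta>bar)" by linarith
  qed simp
  also have "\<dots> = \<delta> / (2 * (real N)\<^sup>2)"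
  proof -
    have "0 < max (4 * exp 2) (real N * \<beta>bar)" by (simp add: less_max_iff_disj)
    then show ?thesis unfolding e\<Lambda> using N by (simp add: field_simps)
  qed
  finally show ?thesis by simp
qed

end

section \<open>The LSTD error\<close>

locale lstd = stationary_chain M X P \<mu>
  for M :: "'a measure" and X :: "nat \<Rightarrow> 'a \<Rightarrow> 's::countable" and P :: "'s \<Rightarrow> 's \<Rightarrow> real" and \<mu> :: "'s \<Rightarrow> real" +
  fixes r :: "'s \<Rightarrow> real" and \<phi> :: "'s \<Rightarrow> real ^ 'd::finite"
    and Rmax \<gamma> lam L \<beta>bar b \<kappa> :: real
  assumes irr: "irreducible_kernel P"
    and r_bound: "\<bar>r x\<bar> \<le> Rmax"
    and \<gamma>: "0 < \<gamma>" "\<gamma> < 1"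
    and \<phi>_bound: "\<bar>\<phi> x $ j\<bar> \<le> L"
    and indep_features: "(\<And>x. \<phi> x \<bullet> v = 0) \<Longrightarrow> v = 0"
    and lam: "0 < lam" "lam < 1"
    and mix_consts: "0 < \<beta>bar" "0 < b" "0 < \<kappa>"
    and mixing: "1 \<le> i \<Longrightarrow> beta_coef M X i \<le> \<beta>bar * exp (- b * real i powr \<kappa>)"
begin

abbreviation "c \<equiv> lam * \<gamma>"
abbreviation "G \<equiv> gram \<mu> \<phi>"
abbreviation "\<nu> \<equiv> min_eigenvalue G"
abbreviation "A \<equiv> A_lstd P \<mu> \<phi> \<gamma> lam"
abbreviation "bvec \<equiv> b_lstd P \<mu> \<phi> r \<gamma> lam"
abbreviation "Q N \<delta> \<equiv> Lam \<beta>bar N \<delta> * lag \<beta>bar b \<kappa> N \<delta>"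
abbreviation "Rad N \<delta> \<equiv> sqrt (real N * Q N \<delta>)"

lemma c: "0 \<le> c" "c < 1" "c < \<gamma>" "0 < c"
  using \<gamma> lam by (auto simp: mult_less_cancel_right2) (smt (verit) mult_less_cancel_right2)

lemma CARD_ge_1: "1 \<le> CARD('d)"
  by (simp add: Suc_le_eq)

lemma features_bdd: "bdd_by (\<lambda>x. \<phi> x $ j) L"
  using \<phi>_bound by (simp add: bdd_by_def)

lemma r_bdd: "bdd_by r Rmax"
  using r_bound by (simp add: bdd_by_def)

lemma L0: "0 \<le> L" and Rmax0: "0 \<le> Rmax"
  using bdd_by_nonneg[OF features_bdd] bdd_by_nonneg[OF r_bdd] by auto

lemma feature_comb: "\<phi> x \<bullet> y = (\<Sum>j\<in>UNIV. y $ j * \<phi> x $ j)"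
  by (simp add: inner_vec_def mult.commute)

lemma feature_bound: "bdd_by (\<lambda>x. \<phi> x \<bullet> y) (real CARD('d) * L * norm y)"
  unfolding bdd_by_def
proof
  fix x
  have "\<bar>\<phi> x \<bullet> y\<bar> \<le> norm (\<phi> x) * norm y" by (rule Cauchy_Schwarz_ineq2)
  also have "\<dots> \<le> real CARD('d) * L * norm y" by (intro mult_right_mono vector_bound \<phi>_bound) auto
  finally show "\<bar>\<phi> x \<bullet> y\<bar> \<le> real CARD('d) * L * norm y" .
qed

lemma quadratic_form:
  fixes E :: "real ^ 'd ^ 'd"
  shows "x \<bullet> (E *v x) = (\<Sum>j\<in>UNIV. \<Sum>l\<in>UNIV. x $ j * (x $ l * E $ j $ l))"
  by (simp add: inner_vec_def matrix_vector_mult_def sum_distrib_left mult_ac)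

lemma mean_bilinear:
  fixes f g :: "'d \<Rightarrow> 's \<Rightarrow> real"
  assumes f: "\<And>j. bdd_by (f j) B" and g: "\<And>j. bdd_by (g j) C"
  shows "mean (\<lambda>x. (\<Sum>j\<in>UNIV. y $ j * f j x) * (\<Sum>l\<in>UNIV. y $ l * g l x))
    = (\<Sum>j\<in>UNIV. \<Sum>l\<in>UNIV. y $ j * (y $ l * mean (\<lambda>x. f j x * g l x)))"
proof -
  have b: "bdd_by (\<lambda>x. y $ j * (y $ l * (f j x * g l x))) (\<bar>y $ j\<bar> * (\<bar>y $ l\<bar> * (B * C)))" for j l
    by (intro bdd_by_cmult bdd_by_mult f g)
  have "mean (\<lambda>x. (\<Sum>j\<in>UNIV. y $ j * f j x) * (\<Sum>l\<in>UNIV. y $ l * g l x))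
      = mean (\<lambda>x. \<Sum>j\<in>UNIV. \<Sum>l\<in>UNIV. y $ j * (y $ l * (f j x * g l x)))"
    by (simp add: sum_product mult_ac)
  also have "\<dots> = (\<Sum>j\<in>UNIV. mean (\<lambda>x. \<Sum>l\<in>UNIV. y $ j * (y $ l * (f j x * g l x))))"
    by (rule mean_sum[OF finite bdd_by_sum[OF b]])
  also have "\<dots> = (\<Sum>j\<in>UNIV. \<Sum>l\<in>UNIV. mean (\<lambda>x. y $ j * (y $ l * (f j x * g l x))))"
    by (intro sum.cong refl mean_sum[OF finite b])
  finally show ?thesis by (simp only: mean_cmult)
qed

lemma gram_entry: "G $ j $ l = mean (\<lambda>x. \<phi> x $ j * \<phi> x $ l)"
  by (simp add: gram_def mean_def mult.assoc)

lemma gram_sym: "transpose G = G"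
  by (simp add: vec_eq_iff transpose_def gram_entry mult.commute)

lemma gram_form: "y \<bullet> (G *v y) = mean (\<lambda>x. (\<phi> x \<bullet> y)\<^sup>2)"
  unfolding quadratic_form gram_entry feature_comb power2_eq_square
  by (rule mean_bilinear[symmetric]) (rule features_bdd)+

text \<open>At an eigenvector v for \<nu> the Gram form is the mean of the square of \<phi> . v, a
  function that is nonzero at some state, and every state has positive mass.\<close>

lemma \<nu>_pos: "0 < \<nu>"
proof -
  obtain v where v: "v \<noteq> 0" "G *v v = \<nu> *s v"
    using min_eigenvalue_rayleigh(1)[OF gram_sym] unfolding is_eigenvalue_def by blast
  have eq: "\<nu> * (v \<bullet> v) = mean (\<lambda>x. (\<phi> x \<bullet> v)\<^sup>2)"
    using gram_form[of v] unfolding v(2) by (simp add: scalar_mult_eq_scaleR)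
  have fb: "bdd_by (\<lambda>x. (\<phi> x \<bullet> v)\<^sup>2) (real CARD('d) * L * norm v * (real CARD('d) * L * norm v))"
    unfolding power2_eq_square by (intro bdd_by_mult feature_bound)
  have "0 < mean (\<lambda>x. (\<phi> x \<bullet> v)\<^sup>2)"
  proof -
    obtain x where x: "\<phi> x \<bullet> v \<noteq> 0" using indep_features v(1) by blast
    have "0 < \<mu> x * (\<phi> x \<bullet> v)\<^sup>2" using mu_pos[OF irr, of x] x by simp
    also have "\<dots> = (\<Sum>x\<in>{x}. \<mu> x * (\<phi> x \<bullet> v)\<^sup>2)" by simp
    also have "\<dots> \<le> mean (\<lambda>x. (\<phi> x \<bullet> v)\<^sup>2)"
      unfolding mean_def using mu_nonneg
      by (intro finite_sum_le_infsum weighted_summable[OF mu_nonneg mu_summable fb]) auto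
    finally show ?thesis .
  qed
  then show ?thesis using eq inner_ge_zero[of v] by (metis zero_less_mult_pos2 less_le inner_eq_zero_iff v(1))
qed

text \<open>The Rayleigh quotient at a coordinate vector. It lets \<nu> be eliminated from the
  condition behind \<open>n0\<close>.\<close>

lemma \<nu>_le: "\<nu> \<le> L\<^sup>2"
proof -
  obtain j :: 'd where True by simp
  let ?e = "axis j (1::real)"
  have "\<nu> * (?e \<bullet> ?e) \<le> ?e \<bullet> (G *v ?e)" by (rule min_eigenvalue_rayleigh(2)[OF gram_sym])
  also have "\<dots> = mean (\<lambda>x. \<phi> x $ j * \<phi> x $ j)"
    unfolding gram_form by (simp add: inner_axis power2_eq_square)
  also have "\<dots> \<le> L * L" using mean_bound[OF bdd_by_mult[OF features_bdd features_bdd, of j j]] by linarith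
  finally show ?thesis by (simp add: inner_axis_axis power2_eq_square)
qed

text \<open>One expression for the entries of both limits, so that a single tail bound serves
  \<open>A_hat\<close> (u a feature, g = \<gamma>) and \<open>b_hat\<close> (u = r, g = 0).\<close>

definition target :: "('s \<Rightarrow> real) \<Rightarrow> real \<Rightarrow> 'd \<Rightarrow> real" where
  "target u g j = mean (\<lambda>x. \<phi> x $ j * (resolvent P c u x - g * Pop P (resolvent P c u) x))"

lemma A_entry: "A $ j $ l = target (\<lambda>x. \<phi> x $ l) \<gamma> j"
  by (simp add: A_lstd_def target_def mean_def mult.assoc)

lemma b_entry: "bvec $ j = target r 0 j"
  by (simp add: b_lstd_def target_def mean_def mult.assoc mult.commute[of \<gamma>])

definition coercivity :: real where "coercivity = (1 - \<gamma>) / (1 - c) * \<nu>"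

lemma coercivity_pos: "0 < coercivity"
  using \<gamma> c \<nu>_pos by (simp add: coercivity_def)

text \<open>The combination W of the resolvents of the features satisfies \<phi> . y = W - c P W, so
  the scalar coercivity inequality applies to it with g = \<gamma>. Bilinearity of the mean
  identifies its right side with the quadratic form of A.\<close>

lemma A_coercive: "coercive A coercivity"
  unfolding coercive_def
proof
  fix y :: "real ^ 'd"
  let ?w = "\<lambda>l. resolvent P c (\<lambda>x. \<phi> x $ l)"
  let ?W = "\<lambda>x. \<Sum>l\<in>UNIV. y $ l * ?w l x"
  have wb: "bdd_by (?w l) (L / (1 - c))" for l by (rule resolvent_bdd[OF stoch features_bdd c(1,2)])
  have ywb: "bdd_by (\<lambda>x. y $ l * ?w l x) (\<bar>y $ l\<bar> * (L / (1 - c)))" for l by (rule bdd_by_cmult[OF wb])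
  have PW: "Pop P ?W x = (\<Sum>l\<in>UNIV. y $ l * Pop P (?w l) x)" for x
    using Pop_sum[OF stoch finite ywb, where x = x and I = UNIV] by (simp only: Pop_cmult)
  have f: "\<phi> x \<bullet> y = ?W x - c * Pop P ?W x" for x
  proof -
    have "\<phi> x \<bullet> y = (\<Sum>l\<in>UNIV. y $ l * (?w l x - c * Pop P (?w l) x))"
      unfolding feature_comb
      by (intro sum.cong refl arg_cong2[where f = "(*)"]) (subst resolvent_eq[OF stoch features_bdd c(1,2)], simp)
    then show ?thesis unfolding PW by (simp add: right_diff_distrib sum_subtractf sum_distrib_left mult_ac)
  qed
  have "coercivity * (y \<bullet> y) = (1 - \<gamma>) / (1 - c) * (\<nu> * (y \<bullet> y))" by (simp add: coercivity_def)
  also have "\<dots> \<le> (1 - \<gamma>) / (1 - c) * mean (\<lambda>x. (\<phi> x \<bullet> y)\<^sup>2)"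
    using min_eigenvalue_rayleigh(2)[OF gram_sym, of y] \<gamma> c unfolding gram_form
    by (intro mult_left_mono) auto
  also have "\<dots> \<le> mean (\<lambda>x. (\<phi> x \<bullet> y) * (?W x - \<gamma> * Pop P ?W x))"
    unfolding f using c lam by (intro resolvent_coercive[OF bdd_by_sum[OF ywb]]) auto
  also have "\<dots> = mean (\<lambda>x. (\<Sum>j\<in>UNIV. y $ j * \<phi> x $ j) * (\<Sum>l\<in>UNIV. y $ l * (?w l x - \<gamma> * Pop P (?w l) x)))"
    unfolding feature_comb PW by (simp add: right_diff_distrib sum_subtractf sum_distrib_left mult_ac)
  also have "\<dots> = y \<bullet> (A *v y)"
    unfolding quadratic_form A_entry target_def
    by (rule mean_bilinear[OF features_bdd bdd_by_diff[OF wb bdd_by_cmult[OF Pop_bdd[OF stoch wb]]]])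
  finally show "coercivity * (y \<bullet> y) \<le> y \<bullet> (A *v y)" .
qed

lemma A_invertible: "invertible A"
  by (rule coercive_invertible[OF A_coercive coercivity_pos])

definition empirical :: "('s \<Rightarrow> real) \<Rightarrow> real \<Rightarrow> 'd \<Rightarrow> nat \<Rightarrow> 'a \<Rightarrow> real" where
  "empirical u g j N \<omega> = (\<Sum>i=1..N. etrace c (\<lambda>x. \<phi> x $ j) i \<omega> * (u (X i \<omega>) - g * u (X (Suc i) \<omega>)))"

lemma z_trace_entry: "z_trace \<phi> \<gamma> lam (\<lambda>k. X k \<omega>) i $ j = etrace c (\<lambda>x. \<phi> x $ j) i \<omega>"
  by (simp add: z_trace_def etrace_def)

lemma A_hat_entry: "A_hat \<phi> \<gamma> lam (\<lambda>k. X k \<omega>) (Suc N) $ j $ l = empirical (\<lambda>x. \<phi> x $ l) \<gamma> j N \<omega> / real N"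
  by (simp add: A_hat_def empirical_def outer_def z_trace_entry)

lemma b_hat_entry: "b_hat \<phi> r \<gamma> lam (\<lambda>k. X k \<omega>) (Suc N) $ j = empirical r 0 j N \<omega> / real N"
  by (simp add: b_hat_def empirical_def z_trace_entry mult.commute)

section \<open>Exceptional events and the error outside them\<close>

text \<open>The index \<open>None\<close> stands for an entry of \<open>b_hat\<close> and
  \<open>Some l\<close> for column l of \<open>A_hat\<close>, so the entries of both are counted by
  one finite type. The form \<open>0 - c\<close> is that of the scale D at g = 0.\<close>

definition bad :: "real \<Rightarrow> nat \<Rightarrow> 'd \<Rightarrow> 'd option \<Rightarrow> 'a set" where
  "bad \<delta> N j o' = (case o' of
      Some l \<Rightarrow> {\<omega> \<in> space M. L * L * (1 + \<bar>\<gamma> - c\<bar> / (1 - c)) * (12 * Rad N \<delta>)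
        < (1 - c) * \<bar>empirical (\<lambda>x. \<phi> x $ l) \<gamma> j N \<omega> - real N * target (\<lambda>x. \<phi> x $ l) \<gamma> j\<bar>}
    | None \<Rightarrow> {\<omega> \<in> space M. L * Rmax * (1 + \<bar>0 - c\<bar> / (1 - c)) * (12 * Rad N \<delta>)
        < (1 - c) * \<bar>empirical r 0 j N \<omega> - real N * target r 0 j\<bar>})"

lemma bad_events: "bad \<delta> N j o' \<in> events"
proof -
  have [measurable]: "etrace c f i \<in> borel_measurable M" for f i by (rule adapted_borel[OF trace_adapted])
  have [measurable]: "empirical u g j N \<in> borel_measurable M" for u g unfolding empirical_def by measurable
  show ?thesis unfolding bad_def by (cases o') auto
qed

lemma prob_bad:
  assumes "0 < \<delta>" "\<delta> < 1" "1 \<le> N" "32 * Q N \<delta> \<le> Rad N \<delta>" "1024 * Q N \<delta> \<le> real N"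
  shows "prob (bad \<delta> N j o') \<le> \<delta> / (2 * (real N)\<^sup>2)"
  unfolding bad_def empirical_def target_def
  using trace_tail_explicit[OF features_bdd[of j] r_bdd c(1,2) mixing mix_consts assms, where g = 0]
    trace_tail_explicit[OF features_bdd[of j] features_bdd c(1,2) mixing mix_consts assms, where g = \<gamma>]
  by (cases o') simp_all

text \<open>Coefficient of \<open>Rmax * sqrt (Q / N)\<close>: 12 L / (1 - c)^2 comes from the
  deviation of \<open>b_hat\<close>, 24 L^2 / (1 - c) from that of \<open>A_hat\<close>, and d L /
  (1 - c) / coercivity bounds the exact solution, with \<open>Rmax\<close> factored out. The divisor
  is the coercivity left to \<open>A_hat\<close>, and the outer d L passes to the \<mu>-norm. It
  depends on neither n nor \<delta>.\<close>

definition err_const :: real where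
  "err_const = real CARD('d) * L * (real CARD('d) * (12 * L / (1 - c)\<^sup>2 + 24 * L\<^sup>2 / (1 - c) * (real CARD('d) * (L / (1 - c)) / coercivity)) / (coercivity / 4))"

lemma err_const_nonneg: "0 \<le> err_const"
  unfolding err_const_def using L0 coercivity_pos c
  by (intro mult_nonneg_nonneg divide_nonneg_nonneg add_nonneg_nonneg) auto

lemma mu_norm_feature: "mu_norm \<mu> (\<lambda>x. \<phi> x \<bullet> y) \<le> real CARD('d) * L * norm y"
proof -
  have "mu_norm \<mu> (\<lambda>x. \<phi> x \<bullet> y) = sqrt (mean (\<lambda>x. (\<phi> x \<bullet> y)\<^sup>2))"
    by (simp add: mu_norm_def mean_def mult.commute)
  also have "\<dots> \<le> sqrt ((real CARD('d) * L * norm y)\<^sup>2)"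
    using mean_bound[OF bdd_by_mult[OF feature_bound feature_bound, of y y]]
    by (intro real_sqrt_le_mono) (simp add: power2_eq_square)
  also have "\<dots> = real CARD('d) * L * norm y" using L0 by simp
  finally show ?thesis .
qed

text \<open>Deterministic: on a path outside the exceptional events all entries are close to their
  targets, and the perturbation bound for linear systems does the rest.\<close>

lemma good_bound:
  assumes N: "1 \<le> N" and R: "32 * real CARD('d) * L\<^sup>2 * Rad N \<delta> < (1 - \<gamma>) * \<nu> * real N"
    and \<omega>: "\<omega> \<in> space M" "\<And>j o'. \<omega> \<notin> bad \<delta> N j o'" and Q: "0 \<le> Q N \<delta>"
  shows "invertible (A_hat \<phi> \<gamma> lam (\<lambda>k. X k \<omega>) (Suc N))"
    and "mu_norm \<mu> (\<lambda>x. v_lstd P \<mu> \<phi> r \<gamma> lam x - v_hat \<phi> r \<gamma> lam (\<lambda>k. X k \<omega>) (Suc N) x)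
      \<le> Rmax * err_const * sqrt (Q N \<delta> / real N)"
proof -
  let ?A = "A_hat \<phi> \<gamma> lam (\<lambda>k. X k \<omega>) (Suc N)" and ?b = "b_hat \<phi> r \<gamma> lam (\<lambda>k. X k \<omega>) (Suc N)"
  define q where "q = 1 - c"
  define s where "s = sqrt (Q N \<delta> / real N)"
  have q: "0 < q" using c by (simp add: q_def)
  have N0: "0 < real N" using N by simp
  have s0: "0 \<le> s" using Q by (simp add: s_def)
  have R_s: "Rad N \<delta> = real N * s"
    using N0 by (simp add: s_def real_sqrt_mult real_sqrt_divide field_simps)
  have dev: "\<bar>x / real N - m\<bar> \<le> K * s / q" if "\<not> K * Rad N \<delta> < q * \<bar>x - real N * m\<bar>" for K x m
  proof -
    have "real N * (q * \<bar>x / real N - m\<bar>) = q * \<bar>x - real N * m\<bar>"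
    proof -
      have "real N * \<bar>x / real N - m\<bar> = \<bar>real N * (x / real N - m)\<bar>" by (simp add: abs_mult)
      also have "real N * (x / real N - m) = x - real N * m" using N0 by (simp add: right_diff_distrib)
      finally show ?thesis by (simp add: mult.left_commute)
    qed
    also have "\<dots> \<le> real N * (K * s)" using that by (simp add: R_s mult_ac)
    finally have "q * \<bar>x / real N - m\<bar> \<le> K * s" using N0 by simp
    then show ?thesis using q by (simp add: field_simps)
  qed
  define e where "e = 24 * L\<^sup>2 / q * s"
  define e' where "e' = 12 * (L * Rmax) / q\<^sup>2 * s"
  \<comment> \<open>Since c < \<gamma> < 1, the scale for \<open>A_hat\<close> is at most 2, whence
    24 = 2 * 12; for \<open>b_hat\<close> it is exactly 1 / (1 - c), whence the square of q in
    e'.\<close>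
  have D: "1 + \<bar>\<gamma> - c\<bar> / q \<le> 2" "1 + \<bar>0 - c\<bar> / q = 1 / q"
    using c \<gamma> q unfolding q_def by (simp_all add: field_simps)
  have AA: "\<bar>(?A - A) $ j $ l\<bar> \<le> e" for j l
  proof -
    have "\<not> (L * L * (1 + \<bar>\<gamma> - c\<bar> / q) * 12) * Rad N \<delta>
        < q * \<bar>empirical (\<lambda>x. \<phi> x $ l) \<gamma> j N \<omega> - real N * target (\<lambda>x. \<phi> x $ l) \<gamma> j\<bar>"
      using \<omega>(2)[of j "Some l"] \<omega>(1) by (auto simp only: bad_def option.case mem_Collect_eq q_def mult.assoc)
    from dev[OF this] have "\<bar>(?A - A) $ j $ l\<bar> \<le> (L * L * (1 + \<bar>\<gamma> - c\<bar> / q) * 12) * s / q"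
      by (simp only: vector_minus_component A_hat_entry A_entry)
    also have "\<dots> \<le> (L * L * 2 * 12) * s / q"
      using D(1) q s0 L0 by (intro divide_right_mono mult_right_mono mult_left_mono) auto
    finally show ?thesis by (simp add: e_def power2_eq_square)
  qed
  have bb: "\<bar>(?b - bvec) $ j\<bar> \<le> e'" for j
  proof -
    have "\<not> (L * Rmax * (1 + \<bar>0 - c\<bar> / q) * 12) * Rad N \<delta>
        < q * \<bar>empirical r 0 j N \<omega> - real N * target r 0 j\<bar>"
      using \<omega>(2)[of j None] \<omega>(1) by (auto simp only: bad_def option.case mem_Collect_eq q_def mult.assoc)
    from dev[OF this] have "\<bar>(?b - bvec) $ j\<bar> \<le> (L * Rmax * (1 + \<bar>0 - c\<bar> / q) * 12) * s / q"
      by (simp only: vector_minus_component b_hat_entry b_entry)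
    then show ?thesis unfolding D(2) e'_def by (simp add: power2_eq_square mult_ac)
  qed
  \<comment> \<open>The quotient of the 24 R of deviation by the 32 R granted by the condition on
    n.\<close>
  have "real CARD('d) * e = 24 / 32 * (32 * real CARD('d) * L\<^sup>2 * Rad N \<delta>) / (q * real N)"
    using N0 by (simp add: e_def R_s)
  also have "\<dots> \<le> 24 / 32 * ((1 - \<gamma>) * \<nu> * real N) / (q * real N)"
    using R q N0 by (intro divide_right_mono mult_left_mono) auto
  also have "\<dots> = 3 / 4 * coercivity" using N0 by (simp add: coercivity_def q_def)
  finally have de: "coercivity / 4 \<le> coercivity - real CARD('d) * e" by simp
  have coer: "coercive ?A (coercivity / 4)"
    unfolding coercive_def
  proof
    fix y :: "real ^ 'd"
    have "coercivity / 4 * (y \<bullet> y) \<le> (coercivity - real CARD('d) * e) * (y \<bullet> y)" by (intro mult_right_mono de) simp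
    also have "\<dots> \<le> y \<bullet> (?A *v y)"
      using coercive_perturb[OF A_coercive AA] unfolding coercive_def by blast
    finally show "coercivity / 4 * (y \<bullet> y) \<le> y \<bullet> (?A *v y)" .
  qed
  have k4: "0 < coercivity / 4" using coercivity_pos by simp
  show "invertible ?A" by (rule coercive_invertible[OF coer k4])
  let ?x = "matrix_inv A *v bvec"
  have bvec: "\<bar>bvec $ j\<bar> \<le> L * (Rmax / (1 - c))" for j
    unfolding b_entry target_def
    using mean_bound[OF bdd_by_mult[OF features_bdd resolvent_bdd[OF stoch r_bdd c(1,2)]], of j] by simp
  have "A ** matrix_inv A = mat 1"
    using someI_ex[OF A_invertible[unfolded invertible_def]] unfolding matrix_inv_def by blast
  then have Ax: "A *v ?x = bvec" by (simp add: matrix_vector_mul_assoc)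
  have "coercivity * norm ?x \<le> norm bvec" using coercive_norm[OF A_coercive, of ?x] unfolding Ax .
  also have "\<dots> \<le> real CARD('d) * (L * (Rmax / (1 - c)))" by (rule vector_bound[OF bvec])
  finally have nx: "norm ?x \<le> real CARD('d) * (L * (Rmax / (1 - c))) / coercivity"
    unfolding pos_le_divide_eq[OF coercivity_pos] mult.commute[of coercivity] .
  have e0: "0 \<le> e" using q s0 by (simp add: e_def)
  have "norm (?x - matrix_inv ?A *v ?b) \<le> real CARD('d) * (e' + e * norm ?x) / (coercivity / 4)"
    by (rule solution_perturb[OF coer k4 A_invertible AA bb])
  also have "\<dots> \<le> real CARD('d) * (e' + e * (real CARD('d) * (L * (Rmax / (1 - c))) / coercivity)) / (coercivity / 4)"
    using k4 by (intro divide_right_mono mult_left_mono add_left_mono nx e0) auto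
  finally have nn: "norm (?x - matrix_inv ?A *v ?b) \<le> real CARD('d) * (e' + e * (real CARD('d) * (L * (Rmax / (1 - c))) / coercivity)) / (coercivity / 4)" .
  have "mu_norm \<mu> (\<lambda>x. v_lstd P \<mu> \<phi> r \<gamma> lam x - v_hat \<phi> r \<gamma> lam (\<lambda>k. X k \<omega>) (Suc N) x)
      = mu_norm \<mu> (\<lambda>x. \<phi> x \<bullet> (?x - matrix_inv ?A *v ?b))"
    by (simp add: v_lstd_def v_hat_def inner_diff_right)
  also have "\<dots> \<le> real CARD('d) * L * norm (?x - matrix_inv ?A *v ?b)" by (rule mu_norm_feature)
  also have "\<dots> \<le> real CARD('d) * L * (real CARD('d) * (e' + e * (real CARD('d) * (L * (Rmax / (1 - c))) / coercivity)) / (coercivity / 4))"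
    using L0 by (intro mult_left_mono nn) auto
  also have "\<dots> = Rmax * err_const * s"
    unfolding err_const_def e_def e'_def q_def by (simp add: algebra_simps add_divide_distrib)
  finally show "mu_norm \<mu> (\<lambda>x. v_lstd P \<mu> \<phi> r \<gamma> lam x - v_hat \<phi> r \<gamma> lam (\<lambda>k. X k \<omega>) (Suc N) x)
      \<le> Rmax * err_const * sqrt (Q N \<delta> / real N)" unfolding s_def .
qed

section \<open>Comparison with the leading term and the uniform statement\<close>

lemma L_pos: "0 < L\<^sup>2"
  using \<nu>_pos \<nu>_le by linarith

abbreviation "start \<delta> \<equiv> n0 CARD('d) L \<gamma> lam \<nu> \<beta>bar b \<kappa> \<delta>"

definition leading :: "nat \<Rightarrow> real \<Rightarrow> real" where
  "leading n \<delta> = 4 * (Rmax / (1 - \<gamma>)) * real CARD('d) * L\<^sup>2 / (sqrt (real (n - 1)) * (1 - \<gamma>) * \<nu>)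
     * sqrt ((1 + mlen \<gamma> lam n) * Ifun \<beta>bar b \<kappa> (n - 1) \<delta>)"

text \<open>Since no truncation is used, the error lacks the factor \<open>sqrt (1 + mlen)\<close> of the leading term,
  so the remainder vanishes for large \<open>n\<close>; it only absorbs the constant for small \<open>n\<close>.\<close>

definition remainder :: "nat \<Rightarrow> real \<Rightarrow> real" where
  "remainder n \<delta> = max 0 (Rmax * err_const * sqrt (Q (n - 1) \<delta> / real (n - 1)) - leading n \<delta>)"

lemma Q_ge_1:
  assumes "1 \<le> N" "0 < \<delta>" "\<delta> < 1"
  shows "1 \<le> Q N \<delta>"
  using mult_mono[OF Lam_bounds(1)[OF assms, of \<beta>bar] lag_ge_1[OF mix_consts(3), of \<beta>bar b N \<delta>]]
    Lam_bounds(1)[OF assms, of \<beta>bar] by simp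

text \<open>\<open>leading\<close> equals Rmax s K sqrt(32 (1 + mlen)) with the same s = sqrt (Q /
  N) as in the error and a constant K. As \<open>mlen\<close> grows like log n, the root eventually
  exceeds \<open>err_const / K\<close>.\<close>

lemma remainder_eventually_0:
  assumes \<delta>: "0 < \<delta>" "\<delta> < 1"
  shows "eventually (\<lambda>n. remainder n \<delta> = 0) sequentially"
proof -
  define K where "K = 4 * real CARD('d) * L\<^sup>2 / ((1 - \<gamma>) * (1 - \<gamma>) * \<nu>)"
  have K: "0 < K" unfolding K_def using L_pos \<nu>_pos \<gamma> CARD_ge_1 by (intro divide_pos_pos mult_pos_pos) auto
  define l where "l = ln (1 / c)"
  have l: "0 < l" unfolding l_def by (rule mlen_nonneg(4)[OF \<gamma> lam, of 2]) simp
  have "filterlim (\<lambda>n. ln (real (n - 1)) / l) at_top sequentially" using l by real_asymp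
  then have "eventually (\<lambda>n. (err_const / K)\<^sup>2 \<le> ln (real (n - 1)) / l) sequentially"
    by (simp add: filterlim_at_top)
  moreover have "eventually (\<lambda>n::nat. 2 \<le> n) sequentially" by (rule eventually_ge_at_top)
  ultimately show ?thesis
  proof eventually_elim
    case (elim n)
    define s where "s = sqrt (Q (n - 1) \<delta> / real (n - 1))"
    have m: "(err_const / K)\<^sup>2 \<le> mlen \<gamma> lam n"
      using elim(1) mlen_nonneg(2)[OF \<gamma> lam elim(2)] unfolding l_def by linarith
    have q1: "1 \<le> Q (n - 1) \<delta>" using elim(2) by (intro Q_ge_1 \<delta>) auto
    have s0: "0 \<le> s" using q1 by (simp add: s_def)
    have m0: "0 \<le> mlen \<gamma> lam n" using m zero_le_power2[of "err_const / K"] by linarith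
    have "err_const / K = sqrt ((err_const / K)\<^sup>2)" using err_const_nonneg K by simp
    also have "\<dots> \<le> sqrt ((1 + mlen \<gamma> lam n) * 32)"
      using m0 by (intro real_sqrt_le_mono order_trans[OF m]) simp
    finally have "err_const \<le> K * sqrt ((1 + mlen \<gamma> lam n) * 32)" using K by (simp add: field_simps)
    then have "Rmax * s * err_const \<le> Rmax * s * (K * sqrt ((1 + mlen \<gamma> lam n) * 32))"
      using Rmax0 s0 by (intro mult_left_mono) auto
    also have "\<dots> = leading n \<delta>"
    proof -
      have "sqrt ((1 + mlen \<gamma> lam n) * Ifun \<beta>bar b \<kappa> (n - 1) \<delta>) = sqrt ((1 + mlen \<gamma> lam n) * 32) * sqrt (Q (n - 1) \<delta>)"
        by (simp add: Ifun_lag mult.assoc flip: real_sqrt_mult)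
      then show ?thesis unfolding leading_def K_def s_def by (simp add: real_sqrt_divide mult_ac)
    qed
    finally show ?case by (simp add: remainder_def s_def mult_ac)
  qed
qed

text \<open>At each n the condition depends only on the list of the first n states, and every
  predicate of a countable-valued variable is measurable; no regularity of matrix inversion is
  involved. Monotonicity of the measure requires this of the larger event.\<close>

lemma event_measurable:
  "{\<omega> \<in> space M. \<forall>n \<ge> start \<delta>. invertible (A_hat \<phi> \<gamma> lam (\<lambda>k. X k \<omega>) n) \<and>
     mu_norm \<mu> (\<lambda>x. v_lstd P \<mu> \<phi> r \<gamma> lam x - v_hat \<phi> r \<gamma> lam (\<lambda>k. X k \<omega>) n x) \<le> B n} \<in> events"
proof -
  \<comment> \<open>Agrees with the chain only at the times 1 to n, which are all that the
    estimators at n read.\<close>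
  let ?y = "\<lambda>n \<omega> k. hist n \<omega> ! (k - 1)"
  have y: "?y n \<omega> k = X k \<omega>" if "1 \<le> k" "k \<le> n" for n \<omega> k
    using that by (simp add: hist_nth)
  have z: "z_trace \<phi> \<gamma> lam (\<lambda>k. X k \<omega>) i = z_trace \<phi> \<gamma> lam (?y n \<omega>) i" if "i \<le> n" for i n \<omega>
    unfolding z_trace_def
    by (intro sum.cong refl arg_cong2[where f = "(*\<^sub>R)"] arg_cong[where f = \<phi>] y[symmetric]) (use that in auto)
  have A: "A_hat \<phi> \<gamma> lam (\<lambda>k. X k \<omega>) n = A_hat \<phi> \<gamma> lam (?y n \<omega>) n" for n \<omega>
    unfolding A_hat_def
  proof (intro arg_cong2[where f = "(*\<^sub>R)"] sum.cong refl)
    fix i assume "i \<in> {1..n - 1}"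
    then have i: "i \<le> n" "1 \<le> i" "1 \<le> Suc i" "Suc i \<le> n" by auto
    show "outer (z_trace \<phi> \<gamma> lam (\<lambda>k. X k \<omega>) i) (\<phi> (X i \<omega>) - \<gamma> *\<^sub>R \<phi> (X (Suc i) \<omega>))
      = outer (z_trace \<phi> \<gamma> lam (?y n \<omega>) i) (\<phi> (?y n \<omega> i) - \<gamma> *\<^sub>R \<phi> (?y n \<omega> (Suc i)))"
      unfolding z[OF i(1)] y[OF i(2,1)] y[OF i(3,4)] ..
  qed
  have b: "b_hat \<phi> r \<gamma> lam (\<lambda>k. X k \<omega>) n = b_hat \<phi> r \<gamma> lam (?y n \<omega>) n" for n \<omega>
    unfolding b_hat_def
  proof (intro arg_cong2[where f = "(*\<^sub>R)"] sum.cong refl)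
    fix i assume "i \<in> {1..n - 1}"
    then have i: "i \<le> n" "1 \<le> i" by auto
    show "r (X i \<omega>) = r (?y n \<omega> i)" unfolding y[OF i(2,1)] ..
    show "z_trace \<phi> \<gamma> lam (\<lambda>k. X k \<omega>) i = z_trace \<phi> \<gamma> lam (?y n \<omega>) i" by (rule z[OF i(1)])
  qed
  define good where "good n xs \<longleftrightarrow> invertible (A_hat \<phi> \<gamma> lam (\<lambda>k. xs ! (k - 1)) n) \<and>
     mu_norm \<mu> (\<lambda>x. v_lstd P \<mu> \<phi> r \<gamma> lam x - v_hat \<phi> r \<gamma> lam (\<lambda>k. xs ! (k - 1)) n x) \<le> B n" for n xs
  have "{\<omega> \<in> space M. \<forall>n \<ge> start \<delta>. good n (hist n \<omega>)} \<in> events"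
  proof -
    have [measurable]: "Measurable.pred M (\<lambda>\<omega>. good n (hist n \<omega>))" for n
      by (rule measurable_compose[OF hist_measurable]) simp
    show ?thesis by measurable
  qed
  then show ?thesis unfolding good_def v_hat_def A b .
qed

text \<open>At sample size N the d (d + 1) \<le> 2 d^2 events cost at most d^2 \<delta> / N^2.
  Summed over all N from N_0 on this telescopes to at most d^2 \<delta> / (N_0 - 1), and N_0 - 1
  \<ge> d^2.\<close>

lemma union_bound:
  assumes \<delta>: "0 < \<delta>" "\<delta> < 1"
  shows "prob (\<Union>k. \<Union>(j, o')\<in>UNIV. bad \<delta> (start \<delta> - 1 + k) j o') \<le> \<delta>"
proof -
  define N where "N k = start \<delta> - 1 + k" for k
  let ?D = "real CARD('d)"
  have s2: "2 \<le> start \<delta>" by (rule n0_spec(1)[OF \<gamma> lam \<nu>_pos mix_consts \<delta>])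
  have N1: "1 \<le> N k" and cond: "n0_cond CARD('d) L \<gamma> lam \<nu> \<beta>bar b \<kappa> (N k + 1) \<delta>" for k
  proof -
    show "1 \<le> N k" using s2 by (simp add: N_def)
    show "n0_cond CARD('d) L \<gamma> lam \<nu> \<beta>bar b \<kappa> (N k + 1) \<delta>"
      by (rule n0_spec(2)[OF \<gamma> lam \<nu>_pos mix_consts \<delta>]) (use s2 in \<open>simp add: N_def\<close>)
  qed
  have cons: "32 * ?D * Q (N k) \<delta> < Rad (N k) \<delta>" "1024 * ?D\<^sup>2 * Q (N k) \<delta> < real (N k)" for k
    using n0_cond_consequences(2,3)[OF \<gamma> lam \<nu>_pos \<nu>_le CARD_ge_1 mix_consts(3) \<delta> _ cond[of k]] N1[of k] by simp_all
  have D1: "1 \<le> ?D" using CARD_ge_1 by simp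
  have D2: "1 \<le> ?D\<^sup>2" using D1 by simp
  have q1: "1 \<le> Q (N k) \<delta>" for k by (rule Q_ge_1[OF N1 \<delta>])
  have c32: "32 * Q (N k) \<delta> \<le> Rad (N k) \<delta>" for k
    using cons(1)[of k] mult_right_mono[OF D1, of "32 * Q (N k) \<delta>"] q1[of k] by simp
  have c1024: "1024 * Q (N k) \<delta> \<le> real (N k)" for k
    using cons(2)[of k] mult_right_mono[OF D2, of "1024 * Q (N k) \<delta>"] q1[of k] by simp
  \<comment> \<open>From 1024 d^2 Q < N and Q \<ge> 1. The subtracted 1 matches the telescoping
    bound 1 / N^2 \<le> 1 / (N - 1) - 1 / N.\<close>
  have big: "?D\<^sup>2 \<le> real (N k) - 1" for k
  proof -
    have "1024 * ?D\<^sup>2 * 1 \<le> 1024 * ?D\<^sup>2 * Q (N k) \<delta>" by (rule mult_left_mono[OF q1]) simp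
    then show ?thesis using cons(2)[of k] D2 by linarith
  qed
  let ?B = "\<lambda>k. \<Union>(j, o')\<in>UNIV. bad \<delta> (N k) j o'"
  have pB: "prob (?B k) \<le> ?D\<^sup>2 * \<delta> * (1 / (real (N k) - 1) - 1 / real (N k))" for k
  proof -
    have "prob (?B k) \<le> (\<Sum>p\<in>UNIV. prob (case p of (j, o') \<Rightarrow> bad \<delta> (N k) j o'))"
      by (rule measure_UNION_le) (auto intro: bad_events split: prod.split)
    also have "\<dots> \<le> (\<Sum>p\<in>(UNIV :: ('d \<times> 'd option) set). \<delta> / (2 * (real (N k))\<^sup>2))"
    proof (rule sum_mono)
      fix p :: "'d \<times> 'd option"
      obtain j o' where p: "p = (j, o')" by (cases p)
      show "prob (case p of (j, o') \<Rightarrow> bad \<delta> (N k) j o') \<le> \<delta> / (2 * (real (N k))\<^sup>2)"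
        unfolding p prod.case by (rule prob_bad[OF \<delta> N1 c32 c1024])
    qed
    also have "\<dots> = ?D * (?D + 1) * (\<delta> / (2 * (real (N k))\<^sup>2))"
    proof -
      have "real CARD('d \<times> 'd option) = ?D * (?D + 1)" by (simp add: distrib_left)
      then show ?thesis by (simp only: sum_constant)
    qed
    also have "\<dots> \<le> ?D * (2 * ?D) * (\<delta> / (2 * (real (N k))\<^sup>2))"
      using D1 \<delta> by (intro mult_right_mono mult_left_mono) auto
    also have "\<dots> = ?D\<^sup>2 * \<delta> * (1 / (real (N k))\<^sup>2)" by (simp add: power2_eq_square)
    also have "\<dots> \<le> ?D\<^sup>2 * \<delta> * (1 / (real (N k) - 1) - 1 / real (N k))"
    proof (rule mult_left_mono)
      have n: "0 < real (N k) - 1" using big[of k] D2 by linarith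
      have "1 / (real (N k))\<^sup>2 \<le> 1 / ((real (N k) - 1) * real (N k))"
        using n by (intro divide_left_mono) (auto simp: power2_eq_square mult_right_mono)
      also have "\<dots> = 1 / (real (N k) - 1) - 1 / real (N k)" using n by (simp add: field_simps)
      finally show "1 / (real (N k))\<^sup>2 \<le> 1 / (real (N k) - 1) - 1 / real (N k)" .
    qed (use \<delta> in simp)
    finally show ?thesis .
  qed
  have tel: "(\<lambda>k. 1 / (real (N k) - 1) - 1 / real (N k)) sums (1 / (real (N 0) - 1))"
  proof -
    have "(\<lambda>k. 1 / (real (N k) - 1)) \<longlonglongrightarrow> 0"
    proof -
      have "(\<lambda>k. 1 / (real (m + k) - 1)) \<longlonglongrightarrow> 0" for m :: nat by real_asymp
      then show ?thesis unfolding N_def .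
    qed
    from telescope_sums'[OF this] show ?thesis by (simp add: N_def)
  qed
  have sm: "summable (\<lambda>k. ?D\<^sup>2 * \<delta> * (1 / (real (N k) - 1) - 1 / real (N k)))"
    using tel by (intro summable_mult) (rule sums_summable)
  have sB: "summable (\<lambda>k. prob (?B k))"
    by (rule summable_comparison_test'[OF sm, of 0]) (use pB in simp)
  have "prob (\<Union>k. ?B k) \<le> (\<Sum>k. prob (?B k))"
    by (rule finite_measure_subadditive_countably[OF _ sB]) (auto intro!: sets.finite_UN bad_events)
  also have "\<dots> \<le> (\<Sum>k. ?D\<^sup>2 * \<delta> * (1 / (real (N k) - 1) - 1 / real (N k)))"
    by (rule suminf_le[OF pB sB sm])
  also have "\<dots> = ?D\<^sup>2 * \<delta> * (1 / (real (N 0) - 1))"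
    using sums_unique[OF sums_mult[OF tel, of "?D\<^sup>2 * \<delta>"]] by simp
  also have "\<dots> \<le> \<delta>"
  proof -
    have n: "0 < real (N 0) - 1" using big[of 0] D2 by linarith
    have "?D\<^sup>2 * \<delta> \<le> (real (N 0) - 1) * \<delta>" using big[of 0] \<delta> by (intro mult_right_mono) auto
    then show ?thesis using n by (simp add: field_simps)
  qed
  finally show ?thesis by (simp add: N_def)
qed

lemma error_bound:
  assumes \<delta>: "0 < \<delta>" "\<delta> < 1"
  shows "1 - \<delta> \<le> prob {\<omega> \<in> space M. \<forall>n \<ge> start \<delta>. invertible (A_hat \<phi> \<gamma> lam (\<lambda>k. X k \<omega>) n) \<and>
     mu_norm \<mu> (\<lambda>x. v_lstd P \<mu> \<phi> r \<gamma> lam x - v_hat \<phi> r \<gamma> lam (\<lambda>k. X k \<omega>) n x) \<le> leading n \<delta> + remainder n \<delta>}"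
    (is "_ \<le> prob ?E")
proof -
  let ?U = "\<Union>k. \<Union>(j, o')\<in>UNIV. bad \<delta> (start \<delta> - 1 + k) j o'"
  have U: "?U \<in> events" by (auto intro!: sets.countable_UN sets.finite_UN bad_events)
  have s2: "2 \<le> start \<delta>" by (rule n0_spec(1)[OF \<gamma> lam \<nu>_pos mix_consts \<delta>])
  have "1 - \<delta> \<le> prob (space M - ?U)" using union_bound[OF \<delta>] prob_compl[OF U] by linarith
  also have "\<dots> \<le> prob ?E"
  proof (rule finite_measure_mono[OF _ event_measurable], rule subsetI)
    fix \<omega> assume \<omega>: "\<omega> \<in> space M - ?U"
    have "invertible (A_hat \<phi> \<gamma> lam (\<lambda>k. X k \<omega>) n) \<and>
      mu_norm \<mu> (\<lambda>x. v_lstd P \<mu> \<phi> r \<gamma> lam x - v_hat \<phi> r \<gamma> lam (\<lambda>k. X k \<omega>) n x) \<le> leading n \<delta> + remainder n \<delta>"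
      if n: "start \<delta> \<le> n" for n
    proof -
      define N where "N = n - 1"
      have n2: "2 \<le> n" using s2 n by linarith
      have N: "1 \<le> N" and Sn: "Suc N = n" using n2 by (auto simp: N_def)
      \<comment> \<open>The events are indexed by N = n - 1, the number of transitions, so n =
        \<open>start\<close> corresponds to offset 0.\<close>
      have "N = start \<delta> - 1 + (n - start \<delta>)" using n s2 by (simp add: N_def)
      then have nb: "\<omega> \<notin> bad \<delta> N j o'" for j o' using \<omega> by blast
      have R: "32 * real CARD('d) * L\<^sup>2 * Rad N \<delta> < (1 - \<gamma>) * \<nu> * real N"
        using n0_cond_consequences(1)[OF \<gamma> lam \<nu>_pos \<nu>_le CARD_ge_1 mix_consts(3) \<delta> n2
            n0_spec(2)[OF \<gamma> lam \<nu>_pos mix_consts \<delta> n]] by (simp add: N_def)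
      have Q0: "0 \<le> Q N \<delta>" using Q_ge_1[OF N \<delta>] by linarith
      have "\<omega> \<in> space M" using \<omega> by simp
      note gb = good_bound[OF N R this nb Q0, unfolded Sn]
      have "Rmax * err_const * sqrt (Q N \<delta> / real N) \<le> leading n \<delta> + remainder n \<delta>"
        by (simp add: remainder_def N_def)
      with gb show ?thesis by (meson order_trans)
    qed
    then show "\<omega> \<in> ?E" using \<omega> by simp
  qed
  finally show ?thesis .
qed

end

theorem theorem1:
  fixes M :: "'a measure"
    and X :: "nat \<Rightarrow> 'a \<Rightarrow> 's::countable"
    and P :: "'s \<Rightarrow> 's \<Rightarrow> real"
    and \<mu> :: "'s \<Rightarrow> real"
    and r :: "'s \<Rightarrow> real"
    and \<phi> :: "'s \<Rightarrow> real ^ 'd::finite"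
    and Rmax \<gamma> lam L \<beta>bar b \<kappa> :: real
  assumes "prob_space M"
    and "stochastic P"
    and "ergodic_kernel P"
    and "stationary_dist P \<mu>"
    and "\<forall>\<mu>'. stationary_dist P \<mu>' \<longrightarrow> \<mu>' = \<mu>"
    and "markov_chain_from M X P \<mu>"
    and "\<forall>x. \<bar>r x\<bar> \<le> Rmax"
    and "0 < \<gamma>" and "\<gamma> < 1"
    and "\<forall>x j. \<bar>\<phi> x $ j\<bar> \<le> L"
    and "\<forall>c. (\<forall>x. \<phi> x \<bullet> c = 0) \<longrightarrow> c = 0"
    and "0 < lam" and "lam < 1"
    and "0 < \<beta>bar" and "0 < b" and "0 < \<kappa>"
    and "\<forall>i\<ge>1. beta_coef M X i \<le> \<beta>bar * exp (- b * real i powr \<kappa>)"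
  shows "\<exists>h :: nat \<Rightarrow> real \<Rightarrow> real.
     (\<exists>k::nat. \<forall>\<delta>\<in>{0<..<1}. (\<lambda>n. h n \<delta>) \<in> O(\<lambda>n. ln (real n) ^ k / real n)) \<and>
     (\<forall>\<delta>\<in>{0<..<1}.
        measure M {\<omega> \<in> space M.
          \<forall>n \<ge> n0 CARD('d) L \<gamma> lam (min_eigenvalue (gram \<mu> \<phi>)) \<beta>bar b \<kappa> \<delta>.
            invertible (A_hat \<phi> \<gamma> lam (\<lambda>k. X k \<omega>) n) \<and>
            mu_norm \<mu> (\<lambda>x. v_lstd P \<mu> \<phi> r \<gamma> lam x - v_hat \<phi> r \<gamma> lam (\<lambda>k. X k \<omega>) n x)
            \<le> 4 * (Rmax / (1 - \<gamma>)) * real CARD('d) * L\<^sup>2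
                / (sqrt (real (n - 1)) * (1 - \<gamma>) * min_eigenvalue (gram \<mu> \<phi>))
                * sqrt ((1 + mlen \<gamma> lam n) * Ifun \<beta>bar b \<kappa> (n - 1) \<delta>)
              + h n \<delta>}
        \<ge> 1 - \<delta>)"
proof -
  interpret prob_space M by fact
  interpret lstd M X P \<mu> r \<phi> Rmax \<gamma> lam L \<beta>bar b \<kappa>
    by unfold_locales (use assms(2-4,6-17) in \<open>auto simp: ergodic_kernel_def\<close>)
  show ?thesis
  \<comment> \<open>The logarithmic power k = 0 suffices, because for each fixed \<delta> the
    remainder is zero from some n on; that index may depend on \<delta>.\<close>
  proof (intro exI[of _ remainder] conjI exI[of _ "0::nat"] ballI)
    fix \<delta> :: real assume "\<delta> \<in> {0<..<1}"
    then have \<delta>: "0 < \<delta>" "\<delta> < 1" by auto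
    have "(\<lambda>n. remainder n \<delta>) \<in> O(\<lambda>n. ln (real n) ^ 0 / real n) \<longleftrightarrow> (\<lambda>_::nat. 0::real) \<in> O(\<lambda>n. ln (real n) ^ 0 / real n)"
      by (rule landau_o.big.in_cong[OF remainder_eventually_0[OF \<delta>]])
    then show "(\<lambda>n. remainder n \<delta>) \<in> O(\<lambda>n. ln (real n) ^ 0 / real n)" by simp
    show "1 - \<delta> \<le> measure M {\<omega> \<in> space M.
          \<forall>n \<ge> start \<delta>. invertible (A_hat \<phi> \<gamma> lam (\<lambda>k. X k \<omega>) n) \<and>
            mu_norm \<mu> (\<lambda>x. v_lstd P \<mu> \<phi> r \<gamma> lam x - v_hat \<phi> r \<gamma> lam (\<lambda>k. X k \<omega>) n x)
            \<le> 4 * (Rmax / (1 - \<gamma>)) * real CARD('d) * L\<^sup>2 / (sqrt (real (n - 1)) * (1 - \<gamma>) * \<nu>)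
                * sqrt ((1 + mlen \<gamma> lam n) * Ifun \<beta>bar b \<kappa> (n - 1) \<delta>) + remainder n \<delta>}"
      using error_bound[OF \<delta>] unfolding leading_def .
  qed
qed

end
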